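(* Let $\nu>-1$. The maximal operators $\mathfrak{T}_*^\nu$ and $\mathfrak{T}_*^{\nu,M}$ are bounded on $L^p(d\eta_\nu)$, $1<p\le\infty$, and from $L^1(d\eta_\nu)$ to weak $L^1(d\eta_\nu)$.
   Context: All $L^p$ spaces are over the interval $(0,1)$. For $\nu>-1$ let $J_\nu$ be the Bessel function of the first kind of order $\nu$ on $(0,\infty)$, and let $0<\lambda_{1,\nu}<\lambda_{2,\nu}<\dots$ be its successive positive zeros. For $n\ge1$ and $x\in(0,1)$ set $$\phi_n^\nu(x)=\frac{\sqrt2}{|J_{\nu+1}(\lambda_{n,\nu})|}x^{-\nu}J_\nu(\lambda_{n,\nu}x),\qquad \varphi_n^\nu(x)=\frac{\phi_n^\nu(x)}{\phi_1^\nu(x)},\qquad d\eta_\nu(x)=x^{2\nu+1}[\phi_1^\nu(x)]^2dx.$$ The system $\{\varphi_n^\nu:n\ge1\}$ is an orthonormal basis of $L^2(d\eta_\nu)$. For $t>0$ and $x,y\in(0,1)$ let $$\mathfrak{G}_t^\nu(x,y)=\sum_{n\ge1}e^{-\lambda_{n,\nu}^2t}\varphi_n^\nu(x)\varphi_n^\nu(y),\qquad \mathfrak{G}_t^{\nu,M}(x,y)=e^{\lambda_{1,\nu}^2t}\mathfrak{G}_t^\nu(x,y),$$ and for $f\in L^1(d\eta_\nu)$ $$\mathfrak{T}_t^\nu f(x)=\int_0^1\mathfrak{G}_t^\nu(x,y)f(y)\,d\eta_\nu(y),\qquad \mathfrak{T}_t^{\nu,M}f(x)=\int_0^1\mathfrak{G}_t^{\nu,M}(x,y)f(y)\,d\eta_\nu(y),$$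 $$\mathfrak{T}_*^\nu f=\sup_{t>0}|\mathfrak{T}_t^\nu f|,\qquad \mathfrak{T}_*^{\nu,M}f=\sup_{t>0}|\mathfrak{T}_t^{\nu,M}f|.$$ *)

theory Defs
  imports "HOL-Analysis.Analysis" "HOL-Probability.Essential_Supremum"
begin

section \<open>Bessel functions and their zeros\<close>

definition bessel_J :: "real \<Rightarrow> real \<Rightarrow> real" where
  "bessel_J \<nu> x =
     (\<Sum>k. (-1) ^ k / (fact k * Gamma (real k + \<nu> + 1)) * (x / 2) powr (2 * real k + \<nu>))"

text \<open>For \<open>n \<ge> 1\<close>, \<open>bessel_zero \<nu> n\<close> is the \<open>n\<close>-th positive zero. The value at \<open>0\<close> is not a zero
  of the Bessel function; it only starts the recursion. The infimum is attained at every step when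
  \<open>\<nu> > -1\<close>, the positive zeros then being infinitely many, without accumulation at a finite
  point and bounded away from \<open>0\<close>.\<close>

primrec bessel_zero :: "real \<Rightarrow> nat \<Rightarrow> real" where
  "bessel_zero \<nu> 0 = 0"
| "bessel_zero \<nu> (Suc n) = Inf {x. bessel_zero \<nu> n < x \<and> bessel_J \<nu> x = 0}"

section \<open>The Fourier--Bessel system, its measure and its heat semigroup\<close>

definition phi :: "real \<Rightarrow> nat \<Rightarrow> real \<Rightarrow> real" where
  "phi \<nu> n x = sqrt 2 / \<bar>bessel_J (\<nu> + 1) (bessel_zero \<nu> n)\<bar>
               * x powr (- \<nu>) * bessel_J \<nu> (bessel_zero \<nu> n * x)"

definition varphi :: "real \<Rightarrow> nat \<Rightarrow> real \<Rightarrow> real" where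
  "varphi \<nu> n x = phi \<nu> n x / phi \<nu> 1 x"

definition eta :: "real \<Rightarrow> real measure" where
  "eta \<nu> = density (restrict_space lborel {0<..<1})
             (\<lambda>x. ennreal (x powr (2 * \<nu> + 1) * (phi \<nu> 1 x)\<^sup>2))"

definition heat_kernel :: "real \<Rightarrow> real \<Rightarrow> real \<Rightarrow> real \<Rightarrow> real" where
  "heat_kernel \<nu> t x y =
     (\<Sum>n. exp (- (bessel_zero \<nu> (Suc n))\<^sup>2 * t) * varphi \<nu> (Suc n) x * varphi \<nu> (Suc n) y)"

definition heat_kernel_M :: "real \<Rightarrow> real \<Rightarrow> real \<Rightarrow> real \<Rightarrow> real" where
  "heat_kernel_M \<nu> t x y = exp ((bessel_zero \<nu> 1)\<^sup>2 * t) * heat_kernel \<nu> t x y"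

definition heat_op :: "real \<Rightarrow> real \<Rightarrow> (real \<Rightarrow> complex) \<Rightarrow> real \<Rightarrow> complex" where
  "heat_op \<nu> t f x = (LINT y|eta \<nu>. complex_of_real (heat_kernel \<nu> t x y) * f y)"

definition heat_op_M :: "real \<Rightarrow> real \<Rightarrow> (real \<Rightarrow> complex) \<Rightarrow> real \<Rightarrow> complex" where
  "heat_op_M \<nu> t f x = (LINT y|eta \<nu>. complex_of_real (heat_kernel_M \<nu> t x y) * f y)"

text \<open>The suprema are taken in the extended nonnegative reals, so they carry no implicit
  finiteness assumption.\<close>

definition max_heat_op :: "real \<Rightarrow> (real \<Rightarrow> complex) \<Rightarrow> real \<Rightarrow> ennreal" where
  "max_heat_op \<nu> f x = (SUP t\<in>{0<..}. ennreal (cmod (heat_op \<nu> t f x)))"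

definition max_heat_op_M :: "real \<Rightarrow> (real \<Rightarrow> complex) \<Rightarrow> real \<Rightarrow> ennreal" where
  "max_heat_op_M \<nu> f x = (SUP t\<in>{0<..}. ennreal (cmod (heat_op_M \<nu> t f x)))"

section \<open>Strong and weak type bounds\<close>

text \<open>Intended for exponents \<open>r > 0\<close> only.\<close>

definition ennreal_powr :: "ennreal \<Rightarrow> real \<Rightarrow> ennreal" where
  "ennreal_powr a r = (if a = \<infinity> then \<infinity> else ennreal (enn2real a powr r))"

text \<open>The \<open>L\<^sup>p\<close> norm, \<open>0 < p \<le> \<infinity>\<close>, of (the absolute value of) a measurable function.\<close>

definition Lp_norm :: "ennreal \<Rightarrow> 'a measure \<Rightarrow> ('a \<Rightarrow> ennreal) \<Rightarrow> ennreal" where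
  "Lp_norm p M g =
     (if p = \<infinity> then esssup M g
      else ennreal_powr (\<integral>\<^sup>+ x. ennreal_powr (g x) (enn2real p) \<partial>M) (1 / enn2real p))"

definition weak_L1_norm :: "'a measure \<Rightarrow> ('a \<Rightarrow> ennreal) \<Rightarrow> ennreal" where
  "weak_L1_norm M g =
     (SUP s\<in>{0<..}. ennreal s * emeasure M {x \<in> space M. ennreal s < g x})"

definition Lp_space :: "ennreal \<Rightarrow> 'a measure \<Rightarrow> ('a \<Rightarrow> complex) set" where
  "Lp_space p M =
     {f \<in> borel_measurable M. Lp_norm p M (\<lambda>x. ennreal (cmod (f x))) < \<infinity>}"

text \<open>Measurability of \<open>T f\<close> has to be required explicitly: \<open>nn_integral\<close> and \<open>emeasure\<close> also
  assign values to nonmeasurable functions and sets.\<close>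

definition bounded_on_Lp ::
    "ennreal \<Rightarrow> 'a measure \<Rightarrow> (('a \<Rightarrow> complex) \<Rightarrow> 'a \<Rightarrow> ennreal) \<Rightarrow> bool" where
  "bounded_on_Lp p M T \<longleftrightarrow>
     (\<exists>C::real. \<forall>f\<in>Lp_space p M. T f \<in> borel_measurable M \<and>
        Lp_norm p M (T f) \<le> ennreal C * Lp_norm p M (\<lambda>x. ennreal (cmod (f x))))"

definition bounded_L1_weak_L1 ::
    "'a measure \<Rightarrow> (('a \<Rightarrow> complex) \<Rightarrow> 'a \<Rightarrow> ennreal) \<Rightarrow> bool" where
  "bounded_L1_weak_L1 M T \<longleftrightarrow>
     (\<exists>C::real. \<forall>f\<in>Lp_space 1 M. T f \<in> borel_measurable M \<and>
        weak_L1_norm M (T f) \<le> ennreal C * Lp_norm 1 M (\<lambda>x. ennreal (cmod (f x))))"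

end

theory Submission
  imports Defs
begin

text \<open>
  The proof uses only real analysis. Write \<open>a = 2 \<nu> + 1\<close>, and let \<open>\<psi>\<^sub>n\<close> be the eigenfunctions of the
  Bessel operator on \<open>(0,1)\<close> with a Dirichlet condition at \<open>1\<close>, orthonormal for \<open>x\<^sup>a dx\<close>.

  The energy \<open>U\<^sup>2 + U'\<^sup>2\<close> of \<open>U(z) = sqrt z J\<^sub>\<nu>(z)\<close> is bounded above and below, which gives a gap
  between the zeros \<open>\<lambda>\<^sub>n\<close>, sharp pointwise bounds for \<open>\<psi>\<^sub>n\<close>, and an upper bound for the Dirichlet
  heat kernel on the diagonal. Completeness of \<open>(\<psi>\<^sub>n)\<close> follows from Courant's principle, proved with
  Picone's identity on the nodal intervals of \<open>\<psi>\<^sub>n\<close>.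

  Off the diagonal, consider the heat flow \<open>u\<close> started from a bump around \<open>x\<close>. Its moments
  \<open>\<integral> u\<^sup>2 (y - x)\<^bsup>2k\<^esup> y\<^sup>a dy\<close> obey a differential inequality that turns the diagonal bound into
  polynomial decay of the kernel of any order in \<open>|x - y| / sqrt t\<close>. Completeness enters as the
  initial condition of the flow. Dividing by \<open>\<psi>\<^sub>1(x) \<psi>\<^sub>1(y)\<close>, the maximal operators are dominated
  pointwise by the Hardy--Littlewood maximal function of \<open>\<eta>\<^sub>\<nu>\<close>, to which Vitali's covering lemma and
  Marcinkiewicz interpolation apply.
\<close>

section \<open>Bessel functions as entire series\<close>

text \<open>The estimates rest neither on positivity of the heat kernel nor on a maximum principle:
  off the diagonal everything goes through weighted \<open>L^2\<close> pairings. The kernel at time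
  \<open>2 T\<close> is the limit of pairings of two flows at time \<open>T\<close>, which is why
  squares of the kernel and products of densities at both points appear. Time derivatives and
  integrations by parts are carried out on finite partial sums; the truncation is removed together
  with the shrinking of the bumps, by dominated convergence of series. The obstacle at the start is
  that the squared norm of a bump of width \<open>e\<close> is of order \<open>1 / e\<close>. The
  moment inequality is therefore run with the clock shifted by \<open>e^2\<close>: the bad bound
  acts only during a time \<open>e^2\<close>, and its contribution vanishes with \<open>e\<close>.
  The exponent \<open>a > -1\<close> may have either sign and the measure degenerates at 1, so
  volumes at different scales and centres are compared through powers whose exponents involve
  \<open>|a|\<close>. Since volumes grow polynomially, finitely many orders of decay pay for
  changing the centre of a ball and for summing over shells.\<close>

definition bessel_coeff :: "real \<Rightarrow> nat \<Rightarrow> real" where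
  "bessel_coeff \<nu> k = (-1) ^ k / (fact k * Gamma (real k + \<nu> + 1))"

definition bessel_series :: "real \<Rightarrow> real \<Rightarrow> real" where
  "bessel_series \<nu> q = (\<Sum>k. bessel_coeff \<nu> k * q ^ k)"

text \<open>The entire factor of the Bessel function: for \<open>z > 0\<close>, \<open>J\<close> of
  order \<nu> is \<open>(z / 2) powr \<nu>\<close> times it. It has no singularity at 0, so
  continuity and derivatives are available on closed intervals that start at 0.\<close>

definition bessel_Phi :: "real \<Rightarrow> real \<Rightarrow> real" where
  "bessel_Phi \<nu> z = bessel_series \<nu> ((z / 2)\<^sup>2)"

lemma bessel_coeff_Suc:
  assumes "\<nu> > -1"
  shows "bessel_coeff \<nu> (Suc k) = - bessel_coeff \<nu> k / (real (Suc k) * (real k + \<nu> + 1))"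
proof -
  have "Gamma (real (Suc k) + \<nu> + 1) = (real k + \<nu> + 1) * Gamma (real k + \<nu> + 1)"
    using Gamma_plus1[of "real k + \<nu> + 1"] assms by (auto simp: algebra_simps nonpos_Ints_def)
  then show ?thesis by (simp add: bessel_coeff_def)
qed

lemma summable_bessel_coeff:
  assumes "\<nu> > -1"
  shows "summable (\<lambda>k. bessel_coeff \<nu> k * q ^ k)"
proof (rule summable_ratio_test[where c = "1/2"])
  define N where "N = nat \<lceil>2 * \<bar>q\<bar> + 1 - \<nu>\<rceil> + 1"
  show "norm (bessel_coeff \<nu> (Suc n) * q ^ Suc n) \<le> 1 / 2 * norm (bessel_coeff \<nu> n * q ^ n)"
    if "n \<ge> N" for n
  proof -
    have n: "real n + \<nu> \<ge> 2 * \<bar>q\<bar> + 1" using that unfolding N_def by linarith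
    have "2 * \<bar>q\<bar> \<le> 1 * (real n + \<nu> + 1)" using n by simp
    also have "\<dots> \<le> real (Suc n) * (real n + \<nu> + 1)"
      using assms by (intro mult_right_mono) auto
    finally have le: "\<bar>q\<bar> / (real (Suc n) * (real n + \<nu> + 1)) \<le> 1 / 2"
      using assms by (subst pos_divide_le_eq) auto
    have "norm (bessel_coeff \<nu> (Suc n) * q ^ Suc n)
        = \<bar>q\<bar> / (real (Suc n) * (real n + \<nu> + 1)) * norm (bessel_coeff \<nu> n * q ^ n)"
      using assms by (simp add: bessel_coeff_Suc abs_mult)
    also have "\<dots> \<le> 1 / 2 * norm (bessel_coeff \<nu> n * q ^ n)"
      by (intro mult_right_mono le) auto
    finally show ?thesis .
  qed
qed simp

text \<open>Differentiation in \<open>q\<close> raises the order, because \<open>k + 1\<close> times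
  the coefficient of index \<open>k + 1\<close> is minus the coefficient of index \<open>k\<close>
  for the order \<open>\<nu> + 1\<close>.\<close>

lemma DERIV_bessel_series:
  assumes "\<nu> > -1"
  shows "(bessel_series \<nu> has_field_derivative - bessel_series (\<nu> + 1) q) (at q)"
proof -
  have "diffs (bessel_coeff \<nu>) k = - bessel_coeff (\<nu> + 1) k" for k
    by (simp add: diffs_def bessel_coeff_def divide_simps)
  then have "(\<Sum>k. diffs (bessel_coeff \<nu>) k * q ^ k) = - bessel_series (\<nu> + 1) q"
    using suminf_minus[OF summable_bessel_coeff[of "\<nu> + 1" q]] assms
    by (simp add: bessel_series_def)
  moreover have "((\<lambda>q. \<Sum>k. bessel_coeff \<nu> k * q ^ k) has_field_derivative
      (\<Sum>k. diffs (bessel_coeff \<nu>) k * q ^ k)) (at q)"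
    by (rule termdiffs_strong_converges_everywhere) (rule summable_bessel_coeff[OF assms])
  ultimately show ?thesis by (simp add: bessel_series_def[abs_def])
qed

text \<open>The classical relation
  \<open>J_\<nu> + J_(\<nu>+2) = 2 (\<nu> + 1) / z * J_(\<nu>+1)\<close>, freed of its powers of
  \<open>z / 2\<close>. Together with the derivative rule it yields Bessel's differential
  equation.\<close>

lemma bessel_series_recurrence:
  assumes "\<nu> > -1"
  shows "bessel_series \<nu> q = (\<nu> + 1) * bessel_series (\<nu> + 1) q - q * bessel_series (\<nu> + 2) q"
proof -
  \<comment> \<open>The series of \<open>q\<close> times the function of order
    \<open>\<nu> + 2\<close>, shifted so that its term of index \<open>k\<close> carries
    \<open>q ^ k\<close>; the relation then holds term by term.\<close>
  define c where "c = (\<lambda>k. (case k of 0 \<Rightarrow> 0 | Suc j \<Rightarrow> bessel_coeff (\<nu> + 2) j) * q ^ k)"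
  have cS: "(\<lambda>k. c (Suc k)) = (\<lambda>k. q * (bessel_coeff (\<nu> + 2) k * q ^ k))"
    by (auto simp: c_def)
  have sc': "summable (\<lambda>k. c (Suc k))"
    unfolding cS using assms by (intro summable_mult summable_bessel_coeff) auto
  then have sc: "summable c" using summable_Suc_iff by blast
  have "suminf c = q * bessel_series (\<nu> + 2) q"
  proof -
    have "suminf c = (\<Sum>k. c (Suc k))" using suminf_split_head[OF sc] by (simp add: c_def)
    then show ?thesis unfolding cS bessel_series_def
      using suminf_mult[OF summable_bessel_coeff[of "\<nu> + 2" q]] assms by simp
  qed
  moreover have "bessel_coeff \<nu> k * q ^ k = (\<nu> + 1) * (bessel_coeff (\<nu> + 1) k * q ^ k) - c k" for k
  proof -
    have nz: "Gamma (real k + \<nu> + 1) > 0" using assms by (intro Gamma_real_pos) auto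
    have G: "Gamma (real k + \<nu> + 2) = (real k + \<nu> + 1) * Gamma (real k + \<nu> + 1)"
      using Gamma_plus1[of "real k + \<nu> + 1"] assms by (auto simp: algebra_simps nonpos_Ints_def)
    show ?thesis
    proof (cases k)
      case 0
      then show ?thesis using nz G assms by (simp add: bessel_coeff_def c_def add.commute)
    next
      case (Suc j)
      have "bessel_coeff \<nu> k = (real k + \<nu> + 1) * bessel_coeff (\<nu> + 1) k"
        using G assms by (simp add: bessel_coeff_def add.assoc)
      moreover have "bessel_coeff (\<nu> + 2) j = - real k * bessel_coeff (\<nu> + 1) k"
        by (simp add: bessel_coeff_def Suc field_simps del: of_nat_Suc)
           (simp add: algebra_simps)
      ultimately have "bessel_coeff \<nu> k = (\<nu> + 1) * bessel_coeff (\<nu> + 1) k - bessel_coeff (\<nu> + 2) j"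
        by (simp add: distrib_right)
      then have "bessel_coeff \<nu> k * q ^ k
          = ((\<nu> + 1) * bessel_coeff (\<nu> + 1) k - bessel_coeff (\<nu> + 2) j) * q ^ k" by simp
      also have "\<dots> = (\<nu> + 1) * (bessel_coeff (\<nu> + 1) k * q ^ k) - c k"
        by (simp add: c_def Suc left_diff_distrib mult.assoc)
      finally show ?thesis .
    qed
  qed
  ultimately show ?thesis
    using suminf_diff[OF summable_mult[OF summable_bessel_coeff[of "\<nu> + 1" q]] sc, of "\<nu> + 1"]
      suminf_mult[OF summable_bessel_coeff[of "\<nu> + 1" q]] assms
    by (simp add: bessel_series_def)
qed

lemma DERIV_bessel_Phi [derivative_intros]:
  assumes "\<nu> > -1" and "(g has_field_derivative g') (at x within S)"
  shows "((\<lambda>x. bessel_Phi \<nu> (g x)) has_field_derivative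
     (- (g x / 2) * bessel_Phi (\<nu> + 1) (g x) * g')) (at x within S)"
proof -
  have "((\<lambda>x. bessel_series \<nu> ((g x / 2)\<^sup>2)) has_field_derivative
     (- bessel_series (\<nu> + 1) ((g x / 2)\<^sup>2)) * (2 * (g x / 2) * (g' / 2))) (at x within S)"
    by (rule DERIV_chain2[OF DERIV_bessel_series[OF assms(1)]])
       (auto intro!: derivative_eq_intros assms(2))
  then show ?thesis by (simp add: bessel_Phi_def mult_ac)
qed

lemma continuous_on_bessel_Phi [continuous_intros]:
  assumes "\<nu> > -1" and "continuous_on S g"
  shows "continuous_on S (\<lambda>x. bessel_Phi \<nu> (g x))"
proof -
  have "continuous_on UNIV (bessel_Phi \<nu>)"
    using DERIV_bessel_Phi[OF assms(1) DERIV_ident]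
    by (intro continuous_at_imp_continuous_on) (auto intro: DERIV_isCont)
  then show ?thesis by (rule continuous_on_compose2[OF _ assms(2)]) auto
qed

lemma bessel_Phi_recurrence:
  "\<nu> > -1 \<Longrightarrow> bessel_Phi \<nu> z = (\<nu> + 1) * bessel_Phi (\<nu> + 1) z - (z / 2)\<^sup>2 * bessel_Phi (\<nu> + 2) z"
  unfolding bessel_Phi_def by (rule bessel_series_recurrence)

lemma bessel_Phi_0: "bessel_Phi \<nu> 0 = 1 / Gamma (\<nu> + 1)"
  using powser_zero[of "bessel_coeff \<nu>"]
  by (simp add: bessel_Phi_def bessel_series_def bessel_coeff_def)

lemma bessel_J_eq:
  assumes "\<nu> > -1" "x > 0"
  shows "bessel_J \<nu> x = (x / 2) powr \<nu> * bessel_Phi \<nu> x"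
proof -
  have "(-1) ^ k / (fact k * Gamma (real k + \<nu> + 1)) * (x / 2) powr (2 * real k + \<nu>)
      = (x / 2) powr \<nu> * (bessel_coeff \<nu> k * ((x / 2)\<^sup>2) ^ k)" for k
  proof -
    have "(x / 2) powr (2 * real k) = ((x / 2)\<^sup>2) ^ k"
      using powr_realpow[of "x/2" "2 * k"] assms(2) by (simp add: power_mult)
    then show ?thesis by (simp add: powr_add bessel_coeff_def)
  qed
  then show ?thesis
    using suminf_mult[OF summable_bessel_coeff[OF assms(1), of "(x/2)\<^sup>2"]]
    by (simp add: bessel_J_def bessel_Phi_def bessel_series_def)
qed

section \<open>Energy estimates and the zeros\<close>

text \<open>Stated for exponents of either sign because \<open>a\<close> is only known to exceed -1.
  One of the two comparisons serves each sign, and the constant sees only the absolute value of the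
  exponent.\<close>

lemma powr_comparable:
  fixes x y c s :: real
  assumes "0 < x" "0 < y" "x \<le> c * y" "y \<le> c * x" "c \<ge> 1"
  shows "x powr s \<le> c powr \<bar>s\<bar> * y powr s"
proof (cases "s \<ge> 0")
  case True
  then have "x powr s \<le> (c * y) powr s" using assms by (intro powr_mono2) auto
  then show ?thesis using True assms by (simp add: powr_mult)
next
  case False
  then have "(c * x) powr s \<le> y powr s" using assms by (intro powr_mono2') auto
  then have "c powr (- s) * (c powr s * x powr s) \<le> c powr (- s) * y powr s"
    using assms by (intro mult_left_mono) (auto simp: powr_mult)
  moreover have "c powr (- s) * (c powr s * x powr s) = x powr s"
    using assms by (simp add: powr_minus)
  ultimately show ?thesis using False by simp
qed

declare bessel_zero.simps(2) [simp del]

locale bessel =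
  fixes \<nu> a :: real
  assumes nu: "\<nu> > -1" and a_def: "a = 2 * \<nu> + 1"
begin

section \<open>Liouville normal form, energy and separation of zeros\<close>

lemma a_gt: "a > -1" using nu by (simp add: a_def)

text \<open>Equals \<open>2 powr \<nu>\<close> times \<open>sqrt z\<close> times the Bessel
  function; the square root removes the first-order term of Bessel's equation.\<close>

definition U :: "real \<Rightarrow> real" where
  "U z = z powr (a / 2) * bessel_Phi \<nu> z"

definition U' :: "real \<Rightarrow> real" where
  "U' z = (a / 2) * z powr (a / 2 - 1) * bessel_Phi \<nu> z
     - z powr (a / 2 + 1) / 2 * bessel_Phi (\<nu> + 1) z"

lemma DERIV_U: "z > 0 \<Longrightarrow> (U has_real_derivative U' z) (at z)"
  unfolding U_def[abs_def] U'_def using nu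
  by (auto intro!: derivative_eq_intros simp: powr_add)

lemma continuous_on_U: "(\<And>z. z \<in> S \<Longrightarrow> z > 0) \<Longrightarrow> continuous_on S U"
  by (intro continuous_at_imp_continuous_on ballI) (rule DERIV_isCont[OF DERIV_U])

text \<open>Bessel's equation in normal form: a harmonic oscillator perturbed by a potential of
  order \<open>1 / z^2\<close>, where \<open>(a / 2) * (a / 2 - 1)\<close> is
  \<open>\<nu>^2 - 1/4\<close>. The three-term recurrence eliminates the function of order
  \<open>\<nu> + 2\<close>.\<close>

lemma DERIV_U':
  assumes "z > 0"
  shows "(U' has_real_derivative - (1 - (a / 2) * (a / 2 - 1) / z\<^sup>2) * U z) (at z)"
proof -
  define P F1 F2 where "P = z powr (a / 2)" and "F1 = bessel_Phi (\<nu> + 1) z"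
    and "F2 = bessel_Phi (\<nu> + 2) z"
  have p: "z powr (a / 2 - 2) = P / z\<^sup>2" "z powr (a / 2 - 1) = P / z" "z powr (a / 2 + 1) = P * z"
    using assms by (simp_all add: P_def powr_diff powr_add power2_eq_square)
  have D: "(U' has_real_derivative
     (a / 2) * ((a / 2 - 1) * z powr (a / 2 - 2) * bessel_Phi \<nu> z + z powr (a / 2 - 1) * (- (z / 2) * F1))
     - ((a / 2 + 1) * z powr (a / 2) / 2 * F1 + z powr (a / 2 + 1) / 2 * (- (z / 2) * F2))) (at z)"
    unfolding U'_def[abs_def] F1_def F2_def using assms nu
    by (auto intro!: derivative_eq_intros simp: field_simps)
  have r: "bessel_Phi \<nu> z = (a + 1) / 2 * F1 - (z / 2)\<^sup>2 * F2"
    using bessel_Phi_recurrence[OF nu, of z] by (simp add: F1_def F2_def a_def)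
  have "(a / 2) * ((a / 2 - 1) * z powr (a / 2 - 2) * bessel_Phi \<nu> z + z powr (a / 2 - 1) * (- (z / 2) * F1))
     - ((a / 2 + 1) * z powr (a / 2) / 2 * F1 + z powr (a / 2 + 1) / 2 * (- (z / 2) * F2))
     = (a / 2) * (a / 2 - 1) / z\<^sup>2 * (P * bessel_Phi \<nu> z) - P * ((a + 1) / 2 * F1 - (z / 2)\<^sup>2 * F2)"
    unfolding p P_def[symmetric] using assms by (simp add: field_simps power2_eq_square)
  also have "\<dots> = - (1 - (a / 2) * (a / 2 - 1) / z\<^sup>2) * U z"
    unfolding r[symmetric] U_def P_def by (simp add: algebra_simps)
  finally show ?thesis using D by simp
qed

text \<open>The derivative of the energy is bounded by \<open>k / z^2\<close> times the energy, and
  \<open>k / z^2\<close> has the antiderivative \<open>- k / z\<close>, bounded away from 0. So the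
  energy times \<open>exp (- k / z)\<close> increases and the energy times
  \<open>exp (k / z)\<close> decreases. On the remaining interval up to \<open>z0\<close>,
  positivity of \<open>bessel_Phi\<close> excludes zeros.\<close>

lemma energy_bounds:
  obtains z0 q0 q1 where "0 < z0" "z0 \<le> 1" "0 < q0" "0 < q1"
    "\<forall>z. 0 \<le> z \<longrightarrow> z \<le> z0 \<longrightarrow> bessel_Phi \<nu> z > 0"
    "\<forall>z\<ge>z0. q0 \<le> (U z)\<^sup>2 + (U' z)\<^sup>2 \<and> (U z)\<^sup>2 + (U' z)\<^sup>2 \<le> q1"
proof -
  have "isCont (bessel_Phi \<nu>) 0"
    using DERIV_bessel_Phi[OF nu DERIV_ident] DERIV_isCont by blast
  moreover have "bessel_Phi \<nu> 0 > 0" using nu by (simp add: bessel_Phi_0 Gamma_real_pos)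
  ultimately have "\<forall>\<^sub>F z in nhds 0. bessel_Phi \<nu> z > 0"
    using order_tendstoD(1) tendsto_at_iff_tendsto_nhds isCont_def by metis
  then obtain r where r: "r > 0" "\<And>z. \<bar>z\<bar> < r \<Longrightarrow> bessel_Phi \<nu> z > 0"
    unfolding eventually_nhds_metric by (auto simp: dist_real_def)
  define z0 where "z0 = min 1 (r / 2)"
  define k where "k = \<bar>(a / 2) * (a / 2 - 1)\<bar>"
  define Q where "Q = (\<lambda>z. (U z)\<^sup>2 + (U' z)\<^sup>2)"
  have z0: "0 < z0" "z0 \<le> 1" "z0 < r" using r(1) by (auto simp: z0_def min_def)
  have Q0: "Q z0 > 0"
    using r(2)[of z0] z0 by (simp add: Q_def U_def sum_power2_gt_zero_iff)
  have DQ: "(Q has_real_derivative 2 * U' z * U z * ((a / 2) * (a / 2 - 1)) / z\<^sup>2) (at z)" if "z > 0" for z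
    unfolding Q_def using that
    by (auto intro!: derivative_eq_intros DERIV_U DERIV_U' simp: field_simps)
  have bQ: "\<bar>2 * U' z * U z * ((a / 2) * (a / 2 - 1)) / z\<^sup>2\<bar> \<le> k / z\<^sup>2 * Q z" for z
  proof -
    have "\<bar>2 * U' z * U z\<bar> \<le> Q z"
      using sum_squares_bound[of "U z" "U' z"] sum_squares_bound[of "- U z" "U' z"]
      unfolding Q_def by (simp add: abs_le_iff algebra_simps)
    then have "\<bar>2 * U' z * U z\<bar> * k / z\<^sup>2 \<le> Q z * k / z\<^sup>2"
      by (intro divide_right_mono mult_right_mono) (auto simp: k_def)
    then show ?thesis by (simp add: k_def abs_mult mult_ac)
  qed
  have lo: "Q z0 * exp (- k / z0) \<le> Q z * exp (- k / z)" if "z \<ge> z0" for z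
  proof (rule DERIV_nonneg_imp_nondecreasing[OF that])
    fix x assume x: "z0 \<le> x" "x \<le> z"
    have "((\<lambda>z. Q z * exp (- k / z)) has_real_derivative
       (2 * U' x * U x * ((a / 2) * (a / 2 - 1)) / x\<^sup>2 + k / x\<^sup>2 * Q x) * exp (- k / x)) (at x)"
      using x z0 by (auto intro!: derivative_eq_intros DQ simp: field_simps power2_eq_square)
    moreover have "(2 * U' x * U x * ((a / 2) * (a / 2 - 1)) / x\<^sup>2 + k / x\<^sup>2 * Q x) * exp (- k / x) \<ge> 0"
      using bQ[of x] by (intro mult_nonneg_nonneg exp_ge_zero) linarith
    ultimately show "\<exists>y. ((\<lambda>z. Q z * exp (- k / z)) has_real_derivative y) (at x) \<and> y \<ge> 0" by blast
  qed
  have hi: "Q z0 * exp (k / z0) \<ge> Q z * exp (k / z)" if "z \<ge> z0" for z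
  proof (rule DERIV_nonpos_imp_nonincreasing[OF that])
    fix x assume x: "z0 \<le> x" "x \<le> z"
    have "((\<lambda>z. Q z * exp (k / z)) has_real_derivative
       (2 * U' x * U x * ((a / 2) * (a / 2 - 1)) / x\<^sup>2 - k / x\<^sup>2 * Q x) * exp (k / x)) (at x)"
      using x z0 by (auto intro!: derivative_eq_intros DQ simp: field_simps power2_eq_square)
    moreover have "(2 * U' x * U x * ((a / 2) * (a / 2 - 1)) / x\<^sup>2 - k / x\<^sup>2 * Q x) * exp (k / x) \<le> 0"
      using bQ[of x] by (intro mult_nonpos_nonneg exp_ge_zero) linarith
    ultimately show "\<exists>y. ((\<lambda>z. Q z * exp (k / z)) has_real_derivative y) (at x) \<and> y \<le> 0" by blast
  qed
  have k0: "k \<ge> 0" by (simp add: k_def)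
  have "Q z0 * exp (- k / z0) \<le> Q z" "Q z \<le> Q z0 * exp (k / z0)" if "z \<ge> z0" for z
  proof -
    have "Q z \<ge> 0" by (simp add: Q_def)
    moreover have "exp (- k / z) \<le> 1" "exp (k / z) \<ge> 1" using k0 that z0 by auto
    ultimately have "Q z * exp (- k / z) \<le> Q z * 1" "Q z * 1 \<le> Q z * exp (k / z)"
      by (intro mult_left_mono; simp)+
    then show "Q z0 * exp (- k / z0) \<le> Q z" "Q z \<le> Q z0 * exp (k / z0)"
      using lo[OF that] hi[OF that] by auto
  qed
  then show thesis
    using z0 Q0 r(2)
    by (intro that[of z0 "Q z0 * exp (- k / z0)" "Q z0 * exp (k / z0)"]) (auto simp: Q_def)
qed

lemma bessel_J_zero_iff:
  assumes "z > 0" shows "bessel_J \<nu> z = 0 \<longleftrightarrow> U z = 0"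
  using assms nu by (simp add: bessel_J_eq U_def)

lemma U_zero_iff: "z > 0 \<Longrightarrow> U z = 0 \<longleftrightarrow> bessel_Phi \<nu> z = 0"
  by (simp add: U_def)

text \<open>Between two zeros the derivative vanishes somewhere, and there the lower energy bound
  forces \<open>U^2\<close> to be at least \<open>q0\<close>. The slope never exceeds
  \<open>sqrt q1\<close>, so climbing from 0 to that height takes a length of at least
  \<open>sqrt (q0 / q1)\<close>.\<close>

lemma U_zeros_gap:
  "\<exists>d>0. (\<forall>z>0. U z = 0 \<longrightarrow> d \<le> z) \<and> (\<forall>z>0. \<forall>w>z. U z = 0 \<longrightarrow> U w = 0 \<longrightarrow> d \<le> w - z)"
proof -
  obtain z0 q0 q1 where z0: "0 < z0" "z0 \<le> 1" and q: "0 < q0" "0 < q1"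
    and pos': "\<forall>z. 0 \<le> z \<longrightarrow> z \<le> z0 \<longrightarrow> bessel_Phi \<nu> z > 0"
    and en': "\<forall>z\<ge>z0. q0 \<le> (U z)\<^sup>2 + (U' z)\<^sup>2 \<and> (U z)\<^sup>2 + (U' z)\<^sup>2 \<le> q1"
    using energy_bounds by blast
  have pos: "\<And>z. 0 \<le> z \<Longrightarrow> z \<le> z0 \<Longrightarrow> bessel_Phi \<nu> z > 0"
    and en: "\<And>z. z \<ge> z0 \<Longrightarrow> q0 \<le> (U z)\<^sup>2 + (U' z)\<^sup>2" "\<And>z. z \<ge> z0 \<Longrightarrow> (U z)\<^sup>2 + (U' z)\<^sup>2 \<le> q1"
    using pos' en' by auto
  have ge: "z0 < z" if "z > 0" "U z = 0" for z
    using pos[of z] that U_zero_iff[of z] by force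
  have gap: "sqrt (q0 / q1) \<le> w - z" if "z > 0" "w > z" "U z = 0" "U w = 0" for z w
  proof -
    have zz: "z0 < z" using ge that by blast
    have cont: "continuous_on {z..w} U"
      using that by (intro continuous_on_U) auto
    obtain c where c: "z < c" "c < w" "U' c = 0"
    proof -
      have "U differentiable (at x)" if "z < x" for x
        unfolding real_differentiable_def using DERIV_U[of x] \<open>z > 0\<close> that by auto
      then obtain c where "z < c" "c < w" "DERIV U c :> 0"
        using Rolle[of z w U] \<open>w > z\<close> \<open>U z = 0\<close> \<open>U w = 0\<close> cont by auto
      moreover have "U' c = 0"
        using DERIV_unique[OF DERIV_U[of c]] \<open>z > 0\<close> calculation by simp
      ultimately show ?thesis using that by blast
    qed
    obtain \<xi> where \<xi>: "z < \<xi>" "\<xi> < c" "U c - U z = (c - z) * U' \<xi>"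
    proof -
      have "\<exists>\<xi>>z. \<xi> < c \<and> U c - U z = (c - z) * U' \<xi>"
        by (rule MVT2) (use c \<open>z > 0\<close> in \<open>auto intro!: DERIV_U\<close>)
      then show ?thesis using that by blast
    qed
    have "q0 \<le> (U c)\<^sup>2" using en(1)[of c] c zz by simp
    also have "\<dots> = (c - z)\<^sup>2 * (U' \<xi>)\<^sup>2" using \<xi> that by (simp add: power_mult_distrib)
    also have "\<dots> \<le> (w - z)\<^sup>2 * q1"
    proof (intro mult_mono power_mono)
      have "(U' \<xi>)\<^sup>2 \<le> (U \<xi>)\<^sup>2 + (U' \<xi>)\<^sup>2" by simp
      then show "(U' \<xi>)\<^sup>2 \<le> q1" using en(2)[of \<xi>] \<xi> zz by linarith
    qed (use c in auto)
    finally have "q0 / q1 \<le> (w - z)\<^sup>2" using q by (simp add: field_simps)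
    then show ?thesis using that by (simp add: real_le_lsqrt)
  qed
  show ?thesis
    using z0 q ge gap by (intro exI[of _ "min z0 (sqrt (q0 / q1))"]) (auto simp: less_imp_le min_le_iff_disj)
qed

text \<open>Sturm comparison by hand. If \<open>U\<close> had no zero beyond \<open>A\<close>, then
  \<open>f = |U|\<close> would satisfy \<open>f'' \<le> - f / 2\<close> far out. Concavity makes
  \<open>f'\<close> nonnegative, since otherwise \<open>f\<close> would reach 0; hence
  \<open>f\<close> stays above a positive constant, and \<open>f'\<close> decreases at a fixed rate
  until it is negative.\<close>

lemma U_zeros_unbounded: "\<exists>z>A. U z = 0"
proof (rule ccontr)
  assume "\<not> ?thesis"
  then have nz: "\<And>z. z > A \<Longrightarrow> U z \<noteq> 0" by auto
  define k where "k = (a / 2) * (a / 2 - 1)"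
  \<comment> \<open>So far out that the coefficient \<open>1 - k / z^2\<close> is at least
    1/2.\<close>
  define B where "B = max (\<bar>A\<bar> + 1) (2 * \<bar>k\<bar> + 1)"
  have B: "B > A" "B \<ge> 1" "B \<ge> 2 * \<bar>k\<bar> + 1" by (auto simp: B_def)
  have coef: "1 - k / z\<^sup>2 \<ge> 1 / 2" if "z \<ge> B" for z
  proof -
    have "2 * \<bar>k\<bar> \<le> z * 1" using that B by linarith
    also have "\<dots> \<le> z * z" using that B by (intro mult_left_mono) auto
    finally have "2 * k \<le> z\<^sup>2" by (simp add: power2_eq_square)
    then show ?thesis using that B by (simp add: field_simps)
  qed
  define s where "s = sgn (U B)"
  have s1: "s * s = 1" "s * U B > 0" using nz[OF B(1)] by (auto simp: s_def sgn_if)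
  define f where "f = (\<lambda>z. s * U z)"
  define g where "g = (\<lambda>z. s * U' z)"
  have f': "(f has_real_derivative g z) (at z)" if "z \<ge> B" for z
    unfolding f_def g_def using that B by (intro DERIV_cmult DERIV_U) auto
  have g': "(g has_real_derivative - (1 - k / z\<^sup>2) * f z) (at z)" if "z \<ge> B" for z
    using DERIV_cmult[OF DERIV_U', of z s] that B
    by (auto simp: f_def g_def k_def mult_ac)
  have fpos: "f z > 0" if "z \<ge> B" for z
  proof (rule ccontr)
    assume "\<not> f z > 0"
    then have "f z \<le> 0" by simp
    moreover have "f B \<ge> 0" using s1 by (simp add: f_def)
    moreover have "continuous_on {B..z} f"
      unfolding f_def using B by (intro continuous_intros continuous_on_U) auto
    ultimately obtain c where "c \<ge> B" "f c = 0"
      using IVT2'[of f z 0 B] \<open>z \<ge> B\<close> by auto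
    then show False using nz[of c] B s1 by (auto simp: f_def)
  qed
  have gdec: "g w \<le> g z - (w - z) * (m / 2)" if "B \<le> z" "z \<le> w" "\<And>x. z \<le> x \<Longrightarrow> x \<le> w \<Longrightarrow> m \<le> f x" "m \<ge> 0" for z w m
  proof -
    have "g w + w * (m / 2) \<le> g z + z * (m / 2)"
    proof (rule DERIV_nonpos_imp_nonincreasing[OF that(2)])
      fix x assume x: "z \<le> x" "x \<le> w"
      have "((\<lambda>w. g w + w * (m / 2)) has_real_derivative - (1 - k / x\<^sup>2) * f x + m / 2) (at x)"
        using x that by (auto intro!: derivative_eq_intros g')
      moreover have "1 / 2 * m \<le> (1 - k / x\<^sup>2) * f x"
        using coef[of x] fpos[of x] that(3)[of x] x that by (intro mult_mono) linarith+
      ultimately show "\<exists>y. ((\<lambda>w. g w + w * (m / 2)) has_real_derivative y) (at x) \<and> y \<le> 0"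
        by (intro exI conjI) (assumption, linarith)
    qed
    then show ?thesis by (simp add: algebra_simps diff_divide_distrib)
  qed
  have flin: "f w \<le> f z + (w - z) * M" if "B \<le> z" "z \<le> w" "\<And>x. z \<le> x \<Longrightarrow> x \<le> w \<Longrightarrow> g x \<le> M" for z w M
  proof -
    have "f w - w * M \<le> f z - z * M"
    proof (rule DERIV_nonpos_imp_nonincreasing[OF that(2)])
      fix x assume x: "z \<le> x" "x \<le> w"
      have "((\<lambda>w. f w - w * M) has_real_derivative g x - M) (at x)"
        using x that by (auto intro!: derivative_eq_intros f')
      then show "\<exists>y. ((\<lambda>w. f w - w * M) has_real_derivative y) (at x) \<and> y \<le> 0"
        using that(3)[of x] x by auto
    qed
    then show ?thesis by (simp add: algebra_simps)
  qed
  have gpos: "g z \<ge> 0" if "z \<ge> B" for z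
  proof (rule ccontr)
    assume neg: "\<not> g z \<ge> 0"
    \<comment> \<open>The point where the tangent line of slope \<open>g z\<close> reaches
      0.\<close>
    define w where "w = z + f z / (- g z)"
    have w: "w \<ge> z" using neg fpos[OF that] by (simp add: w_def divide_nonneg_neg)
    have "f w \<le> f z + (w - z) * g z"
    proof (rule flin[OF that w])
      fix x assume x: "z \<le> x" "x \<le> w"
      have "g x \<le> g z - (x - z) * (0 / 2)"
        by (rule gdec) (use x that fpos in \<open>auto intro: less_imp_le\<close>)
      then show "g x \<le> g z" by simp
    qed
    also have "\<dots> = 0" using neg by (simp add: w_def)
    finally show False using fpos[of w] w that by simp
  qed
  have fmono: "f B \<le> f z" if "z \<ge> B" for z
    by (rule DERIV_nonneg_imp_nondecreasing[OF that]) (use f' gpos in blast)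
  have fB: "f B > 0" using fpos by simp
  \<comment> \<open>Chosen so that the upper bound for \<open>g w\<close> is exactly -1.\<close>
  define w where "w = B + (g B + 1) * 2 / f B"
  have w: "w \<ge> B" using fB gpos[of B] by (simp add: w_def)
  have "g w \<le> g B - (w - B) * (f B / 2)"
    by (rule gdec) (use w fmono fB in auto)
  also have "\<dots> = -1" using fB by (simp add: w_def field_simps)
  finally show False using gpos[OF w] by simp
qed

section \<open>Enumeration of the positive zeros\<close>

abbreviation "lam \<equiv> bessel_zero \<nu>"

text \<open>A zero closer to the infimum than the separation distance must be the least one, so the
  infimum is attained. The hypothesis keeps all candidates positive, where \<open>bessel_J\<close>
  and \<open>U\<close> have the same zeros.\<close>

lemma lam_Suc:
  assumes "lam n \<ge> 0"
  shows "lam n < lam (Suc n) \<and> U (lam (Suc n)) = 0 \<and> (\<forall>x. lam n < x \<longrightarrow> x < lam (Suc n) \<longrightarrow> U x \<noteq> 0)"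
proof -
  define S where "S = {x. lam n < x \<and> bessel_J \<nu> x = 0}"
  have S: "S = {x. lam n < x \<and> U x = 0}" using assms bessel_J_zero_iff by (auto simp: S_def)
  have ne: "S \<noteq> {}" using U_zeros_unbounded[of "lam n"] S by auto
  have bdd: "bdd_below S" unfolding S_def by (rule bdd_belowI[of _ "lam n"]) auto
  obtain d where d: "d > 0" "\<And>z w. z > 0 \<Longrightarrow> w > z \<Longrightarrow> U z = 0 \<Longrightarrow> U w = 0 \<Longrightarrow> d \<le> w - z"
    using U_zeros_gap by blast
  obtain x where x: "x \<in> S" "x < Inf S + d" using cInf_lessD[OF ne, of "Inf S + d"] d by auto
  have min: "x \<le> y" if "y \<in> S" for y
  proof (rule ccontr)
    assume "\<not> x \<le> y"
    then have "d \<le> x - y" using d(2)[of y x] that x assms by (auto simp: S)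
    moreover have "Inf S \<le> y" using that bdd by (rule cInf_lower)
    ultimately show False using x by linarith
  qed
  have "lam (Suc n) = x" using cInf_eq_minimum[OF x(1) min] by (simp add: S_def bessel_zero.simps)
  then show ?thesis using x(1) min by (force simp: S)
qed

lemma lam_nonneg: "lam n \<ge> 0"
proof (induction n)
  case (Suc n) then show ?case using lam_Suc[OF Suc] by linarith
qed simp

lemma lam_less_Suc: "lam n < lam (Suc n)" and U_lam_Suc: "U (lam (Suc n)) = 0"
  and U_nonzero_between: "lam n < x \<Longrightarrow> x < lam (Suc n) \<Longrightarrow> U x \<noteq> 0"
  using lam_Suc[OF lam_nonneg, of n] by auto

lemma strict_mono_lam: "strict_mono lam"
  by (rule strict_monoI_Suc) (rule lam_less_Suc)

lemma lam_pos: "n \<ge> 1 \<Longrightarrow> lam n > 0"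
  using strict_monoD[OF strict_mono_lam, of 0 n] by simp

lemma Phi_lam: "n \<ge> 1 \<Longrightarrow> bessel_Phi \<nu> (lam n) = 0"
  using U_lam_Suc[of "n - 1"] lam_pos[of n] U_zero_iff[of "lam n"] by simp

lemma lam_gap: "\<exists>d>0. \<forall>n. d \<le> lam (Suc n) - lam n"
proof -
  obtain d where d: "d > 0" "\<And>z. z > 0 \<Longrightarrow> U z = 0 \<Longrightarrow> d \<le> z"
     "\<And>z w. z > 0 \<Longrightarrow> w > z \<Longrightarrow> U z = 0 \<Longrightarrow> U w = 0 \<Longrightarrow> d \<le> w - z"
    using U_zeros_gap by blast
  have "d \<le> lam (Suc n) - lam n" for n
  proof (cases n)
    case 0 then show ?thesis using d(2)[of "lam 1"] lam_pos[of 1] U_lam_Suc[of 0] by simp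
  next
    case (Suc m)
    then show ?thesis using d(3)[OF lam_pos[of n] lam_less_Suc] U_lam_Suc by simp
  qed
  then show ?thesis using d(1) by blast
qed

lemma lam_ge: "\<exists>d>0. \<forall>n. d * real n \<le> lam n"
proof -
  obtain d where d: "d > 0" "\<And>n. d \<le> lam (Suc n) - lam n" using lam_gap by blast
  have "d * real n \<le> lam n" for n
  proof (induction n)
    case (Suc n) then show ?case using d(2)[of n] by (simp add: algebra_simps)
  qed simp
  then show ?thesis using d(1) by blast
qed

lemma filterlim_lam: "filterlim lam at_top sequentially"
proof -
  obtain d where d: "d > 0" "\<And>n. d * real n \<le> lam n" using lam_ge by blast
  have "filterlim (\<lambda>n. d * real n) at_top sequentially"
    using d(1) by (intro filterlim_tendsto_pos_mult_at_top[OF tendsto_const _ filterlim_real_sequentially]) 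
  then show ?thesis by (rule filterlim_at_top_mono) (use d(2) in auto)
qed

text \<open>The least \<open>n\<close> with \<open>lam n\<close> at or beyond \<open>z\<close>
  exists because the zeros tend to infinity, and no zero lies strictly between consecutive
  ones.\<close>

lemma zeros_enum:
  assumes "z > 0" "bessel_Phi \<nu> z = 0"
  obtains n where "n \<ge> 1" "z = lam n"
proof -
  have "eventually (\<lambda>n. lam n \<ge> z) sequentially"
    using filterlim_lam by (simp add: filterlim_at_top)
  then obtain N where "lam N \<ge> z" by (auto simp: eventually_sequentially)
  define n where "n = (LEAST n. lam n \<ge> z)"
  have n: "lam n \<ge> z" unfolding n_def by (rule LeastI) fact
  have n0: "n \<noteq> 0"
  proof
    assume "n = 0" then show False using n assms by simp
  qed
  then obtain m where m: "n = Suc m" using not0_implies_Suc by blast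
  then have "lam m < z" using not_less_Least[of m "\<lambda>n. lam n \<ge> z"] by (simp add: n_def)
  then have "\<not> z < lam n" using U_nonzero_between[of m z] U_zero_iff[OF assms(1)] assms m by auto
  then show thesis using that[of n] n n0 by simp
qed

text \<open>On \<open>{0..1}\<close> both functions are bounded by compactness; for
  \<open>z \<ge> 1\<close> the energy bounds \<open>z powr a\<close> times their squares, the second
  one being \<open>U'\<close> up to a term in \<open>U / z\<close> and a power of \<open>z\<close>.
  The factor \<open>(1 + z) powr (- a)\<close> covers both ranges.\<close>

lemma Phi_bound:
  "\<exists>C>0. \<forall>z\<ge>0. (bessel_Phi \<nu> z)\<^sup>2 \<le> C * (1 + z) powr (- a)
      \<and> (z / 2 * bessel_Phi (\<nu> + 1) z)\<^sup>2 \<le> C * (1 + z) powr (- a)"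
proof -
  obtain z0 q0 q1 where z0: "0 < z0" "z0 \<le> 1" and q: "0 < q0" "0 < q1"
    and pos': "\<forall>z. 0 \<le> z \<longrightarrow> z \<le> z0 \<longrightarrow> bessel_Phi \<nu> z > 0"
    and en': "\<forall>z\<ge>z0. q0 \<le> (U z)\<^sup>2 + (U' z)\<^sup>2 \<and> (U z)\<^sup>2 + (U' z)\<^sup>2 \<le> q1"
    using energy_bounds by blast
  have pos: "\<And>z. 0 \<le> z \<Longrightarrow> z \<le> z0 \<Longrightarrow> bessel_Phi \<nu> z > 0"
    and en: "\<And>z. z \<ge> z0 \<Longrightarrow> q0 \<le> (U z)\<^sup>2 + (U' z)\<^sup>2" "\<And>z. z \<ge> z0 \<Longrightarrow> (U z)\<^sup>2 + (U' z)\<^sup>2 \<le> q1"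
    using pos' en' by auto
  define F where "F = (\<lambda>z. (bessel_Phi \<nu> z)\<^sup>2 + (z / 2 * bessel_Phi (\<nu> + 1) z)\<^sup>2)"
  have "continuous_on {0..1} F" unfolding F_def using nu by (intro continuous_intros) auto
  then obtain B where B0: "B \<ge> 0" and B': "\<And>z. z \<in> {0..1} \<Longrightarrow> norm (F z) \<le> B"
    using continuous_on_compact_bound[OF compact_Icc] by blast
  have B: "F z \<le> B" if "z \<in> {0..1}" for z using B'[OF that] by simp
  have F2: "F z \<le> q1 * (3 + 2 * a\<^sup>2) * z powr (- a)" if "z \<ge> 1" for z
  proof -
    have zz: "z > 0" "z \<ge> z0" using that z0 by auto
    have uv: "U z = z powr (a / 2) * bessel_Phi \<nu> z"
      "U' z = a / (2 * z) * U z - z powr (a / 2) * (z / 2 * bessel_Phi (\<nu> + 1) z)"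
      using zz by (simp_all add: U_def U'_def powr_add powr_diff)
    have "(z powr (a / 2))\<^sup>2 * F z = (U z)\<^sup>2 + (a / (2 * z) * U z - U' z)\<^sup>2"
    proof -
      have "a / (2 * z) * U z - U' z = z powr (a / 2) * (z / 2 * bessel_Phi (\<nu> + 1) z)"
        using uv(2) by simp
      then show ?thesis by (simp only: uv(1) F_def power_mult_distrib distrib_left)
    qed
    also have "\<dots> \<le> (U z)\<^sup>2 + (2 * (a / (2 * z) * U z)\<^sup>2 + 2 * (U' z)\<^sup>2)"
      using sum_squares_bound[of "a / (2 * z) * U z" "- U' z"]
      by (simp add: power2_eq_square algebra_simps)
    also have "(a / (2 * z) * U z)\<^sup>2 \<le> a\<^sup>2 * (U z)\<^sup>2"
    proof -
      have "1 \<le> (2 * z)\<^sup>2" using that by (intro one_le_power) auto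
      then have "a\<^sup>2 / (2 * z)\<^sup>2 \<le> a\<^sup>2 / 1" by (intro divide_left_mono) auto
      then show ?thesis unfolding power_mult_distrib power_divide by (intro mult_right_mono) auto
    qed
    also have "(U z)\<^sup>2 + (2 * (a\<^sup>2 * (U z)\<^sup>2) + 2 * (U' z)\<^sup>2) \<le> (3 + 2 * a\<^sup>2) * ((U z)\<^sup>2 + (U' z)\<^sup>2)"
      by (simp add: algebra_simps)
    also have "\<dots> \<le> (3 + 2 * a\<^sup>2) * q1" using en(2)[OF zz(2)] by (intro mult_left_mono) auto
    finally have "z powr a * F z \<le> (3 + 2 * a\<^sup>2) * q1"
      using zz by (simp add: power2_eq_square flip: powr_add)
    then show ?thesis using zz by (simp add: powr_minus field_simps)
  qed
  define C where "C = (q1 * (3 + 2 * a\<^sup>2) + B) * 2 powr \<bar>a\<bar>"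
  have "F z \<le> C * (1 + z) powr (- a)" if "z \<ge> 0" for z
  proof (cases "z \<ge> 1")
    case True
    have "F z \<le> (q1 * (3 + 2 * a\<^sup>2) + B) * z powr (- a)"
      using F2[OF True] mult_nonneg_nonneg[OF B0 powr_ge_zero[of z "- a"]] by (simp add: distrib_right)
    also have "z powr (- a) \<le> 2 powr \<bar>- a\<bar> * (1 + z) powr (- a)"
      using True by (intro powr_comparable) auto
    finally show ?thesis using B0 q by (simp add: C_def mult.assoc mult_left_mono)
  next
    case False
    have "F z \<le> B" using B[of z] False that by simp
    also have "\<dots> \<le> (q1 * (3 + 2 * a\<^sup>2) + B) * 1 powr (- a)" using q by simp
    also have "1 powr (- a) \<le> 2 powr \<bar>- a\<bar> * (1 + z) powr (- a)"
      using False that by (intro powr_comparable) auto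
    finally show ?thesis using B0 q by (simp add: C_def mult.assoc mult_left_mono)
  qed
  moreover have "C > 0" using q B0 by (auto simp: C_def intro!: mult_pos_pos add_pos_nonneg)
  moreover have "(bessel_Phi \<nu> z)\<^sup>2 \<le> F z" "(z / 2 * bessel_Phi (\<nu> + 1) z)\<^sup>2 \<le> F z" for z
    by (simp_all add: F_def)
  ultimately show ?thesis by (meson order_trans)
qed

text \<open>At a zero the whole energy sits in \<open>U'\<close>, which there reduces to its term
  with \<open>bessel_Phi (\<nu> + 1)\<close>. This controls the normalising constants of the
  eigenfunctions.\<close>

lemma flux_lam_lower:
  "\<exists>c>0. \<forall>n\<ge>1. c * lam n powr (- a) \<le> (lam n / 2 * bessel_Phi (\<nu> + 1) (lam n))\<^sup>2"
proof -
  obtain z0 q0 q1 where z0: "0 < z0" "z0 \<le> 1" and q: "0 < q0" "0 < q1"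
    and pos': "\<forall>z. 0 \<le> z \<longrightarrow> z \<le> z0 \<longrightarrow> bessel_Phi \<nu> z > 0"
    and en': "\<forall>z\<ge>z0. q0 \<le> (U z)\<^sup>2 + (U' z)\<^sup>2 \<and> (U z)\<^sup>2 + (U' z)\<^sup>2 \<le> q1"
    using energy_bounds by blast
  have pos: "\<And>z. 0 \<le> z \<Longrightarrow> z \<le> z0 \<Longrightarrow> bessel_Phi \<nu> z > 0"
    and en: "\<And>z. z \<ge> z0 \<Longrightarrow> q0 \<le> (U z)\<^sup>2 + (U' z)\<^sup>2" "\<And>z. z \<ge> z0 \<Longrightarrow> (U z)\<^sup>2 + (U' z)\<^sup>2 \<le> q1"
    using pos' en' by auto
  have "q0 * lam n powr (- a) \<le> (lam n / 2 * bessel_Phi (\<nu> + 1) (lam n))\<^sup>2" if n: "n \<ge> 1" for n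
  proof -
    have l: "lam n > 0" "lam n \<ge> z0"
      using lam_pos[OF n] pos[of "lam n"] Phi_lam[OF n] by force+
    have "U (lam n) = 0" using U_zero_iff[of "lam n"] l Phi_lam[OF n] by simp
    then have "q0 \<le> (U' (lam n))\<^sup>2" using en(1)[of "lam n"] l by simp
    also have "U' (lam n) = - (lam n powr (a / 2)) * (lam n / 2 * bessel_Phi (\<nu> + 1) (lam n))"
      using l by (simp add: U'_def Phi_lam[OF n] powr_add)
    also have "\<dots>\<^sup>2 = lam n powr a * (lam n / 2 * bessel_Phi (\<nu> + 1) (lam n))\<^sup>2"
      unfolding power_mult_distrib using l by (simp add: power2_eq_square flip: powr_add)
    finally show ?thesis using l by (simp add: powr_minus field_simps)
  qed
  then show ?thesis using q by blast
qed

section \<open>The eigenfunctions\<close>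

text \<open>The gauge integral is chosen for its fundamental theorem, which tolerates exceptional
  points. Since \<open>0 powr a = 0\<close>, the value of \<open>f\<close> at 0 never counts, so
  comparisons of integrands are asked for only at \<open>x > 0\<close>.\<close>

definition wint :: "(real \<Rightarrow> real) \<Rightarrow> real" where
  "wint f = integral {0..1} (\<lambda>x. x powr a * f x)"

lemma weight_absolutely_integrable: "(\<lambda>x. x powr a) absolutely_integrable_on {0..1}"
  using has_integral_powr_from_0[of a 1] a_gt
  by (intro nonnegative_absolutely_integrable_1) (auto simp: integrable_on_def)

lemma wint_integrable:
  assumes "continuous_on {0..1} f"
  shows "(\<lambda>x. x powr a * f x) integrable_on {0..1}"
proof -
  have "bounded (f ` {0..1})"
    using assms by (intro compact_imp_bounded compact_continuous_image) auto
  then have "(\<lambda>x. f x * x powr a) absolutely_integrable_on {0..1}"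
    using weight_absolutely_integrable assms
    by (intro absolutely_integrable_bounded_measurable_product_real
        continuous_imp_measurable_on_sets_lebesgue) auto
  then show ?thesis by (simp add: mult.commute absolutely_integrable_on_def)
qed

lemma wint_add:
  "continuous_on {0..1} f \<Longrightarrow> continuous_on {0..1} g \<Longrightarrow> wint (\<lambda>x. f x + g x) = wint f + wint g"
  unfolding wint_def distrib_left by (intro integral_add wint_integrable)

lemma wint_diff:
  "continuous_on {0..1} f \<Longrightarrow> continuous_on {0..1} g \<Longrightarrow> wint (\<lambda>x. f x - g x) = wint f - wint g"
  unfolding wint_def right_diff_distrib by (intro integral_diff wint_integrable)

lemma wint_cmult: "wint (\<lambda>x. c * f x) = c * wint f"
proof -
  have "(\<lambda>x. x powr a * (c * f x)) = (\<lambda>x. c * (x powr a * f x))" by (simp add: mult_ac)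
  then show ?thesis by (simp add: wint_def)
qed

lemma wint_0 [simp]: "wint (\<lambda>x. 0) = 0"
  by (simp add: wint_def)

lemma wint_sum:
  assumes "finite A" "\<And>i. i \<in> A \<Longrightarrow> continuous_on {0..1} (f i)"
  shows "wint (\<lambda>x. \<Sum>i\<in>A. f i x) = (\<Sum>i\<in>A. wint (f i))"
  using assms by (induction A) (auto simp: wint_add continuous_on_sum)

lemma wint_mono:
  assumes "continuous_on {0..1} f" "continuous_on {0..1} g" "\<And>x. 0 < x \<Longrightarrow> x \<le> 1 \<Longrightarrow> f x \<le> g x"
  shows "wint f \<le> wint g"
  unfolding wint_def
proof (intro integral_le wint_integrable assms(1,2))
  fix x :: real assume "x \<in> {0..1}"
  then show "x powr a * f x \<le> x powr a * g x"
    using assms(3)[of x] by (cases "x = 0") (auto intro: mult_left_mono)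
qed

lemma wint_cong:
  assumes "\<And>x. 0 < x \<Longrightarrow> x \<le> 1 \<Longrightarrow> f x = g x"
  shows "wint f = wint g"
  unfolding wint_def
proof (rule Henstock_Kurzweil_Integration.integral_cong)
  fix x :: real assume "x \<in> {0..1}"
  then show "x powr a * f x = x powr a * g x"
    using assms[of x] by (cases "x = 0") auto
qed

lemma wint_nonneg:
  assumes "continuous_on {0..1} f" "\<And>x. 0 < x \<Longrightarrow> x \<le> 1 \<Longrightarrow> f x \<ge> 0"
  shows "wint f \<ge> 0"
  using wint_mono[OF continuous_on_const assms(1), of 0] assms(2) by simp

text \<open>Derivatives are asked for only inside the interval and off a finite set: the weight may
  be singular at 0, and in Picone's identity \<open>S\<close> is the set of nodes.\<close>

lemma wint_FTC:
  assumes "continuous_on {0..1} G" "finite S"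
    and "\<And>x. 0 < x \<Longrightarrow> x < 1 \<Longrightarrow> x \<notin> S \<Longrightarrow> (G has_real_derivative x powr a * f x) (at x)"
  shows "((\<lambda>x. x powr a * f x) has_integral (G 1 - G 0)) {0..1}"
  using assms by (intro fundamental_theorem_of_calculus_interior_strong[where S = S])
    (auto simp flip: has_real_derivative_iff_has_vector_derivative)

lemma wint_Cauchy_Schwarz:
  assumes "continuous_on {0..1} f" "continuous_on {0..1} g"
  shows "(wint (\<lambda>x. f x * g x))\<^sup>2 \<le> wint (\<lambda>x. (f x)\<^sup>2) * wint (\<lambda>x. (g x)\<^sup>2)"
proof -
  define p q r where "p = wint (\<lambda>x. (f x)\<^sup>2)" and "q = wint (\<lambda>x. f x * g x)"
    and "r = wint (\<lambda>x. (g x)\<^sup>2)"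
  have *: "0 \<le> s\<^sup>2 * p - 2 * s * t * q + t\<^sup>2 * r" for s t
  proof -
    have "0 \<le> wint (\<lambda>x. (s * f x - t * g x)\<^sup>2)"
      using assms by (intro wint_nonneg continuous_intros) auto
    also have "wint (\<lambda>x. (s * f x - t * g x)\<^sup>2)
        = wint (\<lambda>x. s\<^sup>2 * (f x)\<^sup>2 + ((- 2 * s * t) * (f x * g x) + t\<^sup>2 * (g x)\<^sup>2))"
      by (intro wint_cong) (simp add: power2_eq_square algebra_simps)
    also have "\<dots> = s\<^sup>2 * p + ((- 2 * s * t) * q + t\<^sup>2 * r)"
    proof -
      have c: "continuous_on {0..1} (\<lambda>x. s\<^sup>2 * (f x)\<^sup>2)" "continuous_on {0..1} (\<lambda>x. (- 2 * s * t) * (f x * g x))"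
        "continuous_on {0..1} (\<lambda>x. t\<^sup>2 * (g x)\<^sup>2)"
        by (intro continuous_intros assms)+
      show ?thesis unfolding p_def q_def r_def wint_cmult[symmetric]
        using wint_add[OF c(1) continuous_on_add[OF c(2,3)]] wint_add[OF c(2,3)] by simp
    qed
    finally show ?thesis by simp
  qed
  have r0: "r \<ge> 0" and p0: "p \<ge> 0" using *[of 0 1] *[of 1 0] by auto
  show ?thesis
  proof (cases "r = 0")
    case True
    have "q = 0"
    proof (rule ccontr)
      assume "q \<noteq> 0"
      \<comment> \<open>With \<open>r = 0\<close> the form is affine in \<open>t\<close>, and this
        \<open>t\<close> gives it the value -1.\<close>
      then show False using *[of 1 "(p + 1) / (2 * q)"] True by (simp add: field_simps)
    qed
    then show ?thesis using True unfolding p_def q_def r_def by simp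
  next
    case False
    \<comment> \<open>The form at \<open>s = r\<close>, \<open>t = q\<close>.\<close>
    have "0 \<le> r * (r * p - q\<^sup>2)" using *[of r q] by (simp add: power2_eq_square algebra_simps)
    then show ?thesis using False r0 unfolding p_def q_def r_def
      by (simp add: zero_le_mult_iff algebra_simps)
  qed
qed

section \<open>Eigenfunctions, their derivatives and their fluxes\<close>

definition psi_const :: "nat \<Rightarrow> real" where
  "psi_const n = sqrt 2 / \<bar>lam n / 2 * bessel_Phi (\<nu> + 1) (lam n)\<bar>"

text \<open>The continuous extension of \<open>phi\<close> to \<open>x = 0\<close>:
  \<open>x powr (- \<nu>)\<close> is cancelled against the power inside the Bessel function, and
  \<open>psi_const\<close> has absorbed the remaining power of \<open>lam n / 2\<close>.\<close>

definition psi :: "nat \<Rightarrow> real \<Rightarrow> real" where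
  "psi n x = psi_const n * bessel_Phi \<nu> (lam n * x)"

definition dpsi :: "nat \<Rightarrow> real \<Rightarrow> real" where
  "dpsi n x = - psi_const n * ((lam n)\<^sup>2 * x / 2) * bessel_Phi (\<nu> + 1) (lam n * x)"

text \<open>This is \<open>x powr a\<close> times the derivative, written with the single power
  \<open>x powr (a + 1)\<close>: as \<open>a + 1 > 0\<close>, it is continuous up to 0 and vanishes
  there even when \<open>x powr a\<close> blows up.\<close>

definition flux :: "nat \<Rightarrow> real \<Rightarrow> real" where
  "flux n x = - psi_const n * (lam n)\<^sup>2 / 2 * x powr (a + 1) * bessel_Phi (\<nu> + 1) (lam n * x)"

lemma flux_eq: "x \<ge> 0 \<Longrightarrow> flux n x = x powr a * dpsi n x"
  by (cases "x = 0") (auto simp: flux_def dpsi_def powr_add)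

lemma flux_lam_nz: "n \<ge> 1 \<Longrightarrow> bessel_Phi (\<nu> + 1) (lam n) \<noteq> 0"
proof
  assume n: "n \<ge> 1" and "bessel_Phi (\<nu> + 1) (lam n) = 0"
  moreover obtain c where "c > 0" "\<And>n. n \<ge> 1 \<Longrightarrow> c * lam n powr (- a) \<le> (lam n / 2 * bessel_Phi (\<nu> + 1) (lam n))\<^sup>2"
    using flux_lam_lower by auto
  ultimately show False using lam_pos[OF n] by (force simp: mult_le_0_iff)
qed

lemma psi_const_pos: "n \<ge> 1 \<Longrightarrow> psi_const n > 0"
  using flux_lam_nz[of n] lam_pos[of n] by (simp add: psi_const_def)

lemma phi_eq_psi:
  assumes "n \<ge> 1" "x > 0"
  shows "phi \<nu> n x = psi n x"
proof -
  have l: "lam n > 0" using assms lam_pos by simp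
  have "x powr - \<nu> * (lam n * x / 2) powr \<nu> = (lam n / 2) powr \<nu>"
    using assms l powr_mult[of x "lam n / 2" \<nu>] by (simp add: powr_minus field_simps)
  then show ?thesis using assms l nu
    by (simp add: phi_def bessel_J_eq psi_def psi_const_def abs_mult powr_add field_simps)
qed

lemma continuous_on_psi [continuous_intros]: "continuous_on S g \<Longrightarrow> continuous_on S (\<lambda>x. psi n (g x))"
  unfolding psi_def using nu by (intro continuous_intros) auto

lemma continuous_on_dpsi [continuous_intros]: "continuous_on S g \<Longrightarrow> continuous_on S (\<lambda>x. dpsi n (g x))"
  unfolding dpsi_def using nu by (intro continuous_intros) auto

lemma continuous_on_flux: "continuous_on {0..1} (flux n)"
  unfolding flux_def using nu a_gt by (intro continuous_intros continuous_on_powr') auto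

lemma DERIV_psi: "(psi n has_real_derivative dpsi n x) (at x within S)"
  unfolding psi_def[abs_def] dpsi_def using nu
  by (auto intro!: derivative_eq_intros simp: power2_eq_square)

text \<open>The Sturm--Liouville form of Bessel's equation; the recurrence supplies the
  cancellation.\<close>

lemma DERIV_flux:
  assumes "x > 0"
  shows "(flux n has_real_derivative - (lam n)\<^sup>2 * x powr a * psi n x) (at x)"
proof -
  define F1 F2 where "F1 = bessel_Phi (\<nu> + 1) (lam n * x)" and "F2 = bessel_Phi (\<nu> + 2) (lam n * x)"
  have D: "(flux n has_real_derivative - psi_const n * (lam n)\<^sup>2 / 2 * ((a + 1) * x powr a * F1
      + x powr (a + 1) * (- (lam n * x / 2) * F2 * lam n))) (at x)"
    unfolding flux_def[abs_def] F1_def F2_def using assms nu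
    by (auto intro!: derivative_eq_intros simp: field_simps)
  have r: "bessel_Phi \<nu> (lam n * x) = (a + 1) / 2 * F1 - (lam n * x / 2)\<^sup>2 * F2"
    using bessel_Phi_recurrence[OF nu, of "lam n * x"] by (simp add: F1_def F2_def a_def)
  have "- psi_const n * (lam n)\<^sup>2 / 2 * ((a + 1) * x powr a * F1 + x powr (a + 1) * (- (lam n * x / 2) * F2 * lam n))
     = - (lam n)\<^sup>2 * x powr a * psi n x"
    unfolding psi_def r using assms by (simp add: powr_add power2_eq_square field_simps)
  then show ?thesis using D by (simp only:)
qed

lemma psi_1: "n \<ge> 1 \<Longrightarrow> psi n 1 = 0"
  by (simp add: psi_def Phi_lam)

text \<open>The positive zeros of \<open>bessel_Phi\<close> are the \<open>lam j\<close>, where the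
  function of the next order does not vanish; so all nodes are simple.\<close>

lemma dpsi_nz:
  assumes "n \<ge> 1" "0 < x" "psi n x = 0"
  shows "dpsi n x \<noteq> 0"
proof -
  have "bessel_Phi \<nu> (lam n * x) = 0" using assms psi_const_pos[of n] by (simp add: psi_def)
  then obtain j where "j \<ge> 1" "lam n * x = lam j"
    using zeros_enum[of "lam n * x"] lam_pos[of n] assms by auto
  then show ?thesis using flux_lam_nz[of j] psi_const_pos[of n] lam_pos[of n] assms by (simp add: dpsi_def)
qed

text \<open>Integration by parts without boundary terms: \<open>f\<close> vanishes at 1 and the flux
  vanishes at 0, so \<open>f\<close> is free at 0.\<close>

lemma wint_green:
  assumes f: "\<And>x. 0 < x \<Longrightarrow> x < 1 \<Longrightarrow> (f has_real_derivative f' x) (at x)"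
    "continuous_on {0..1} f" "continuous_on {0..1} f'" "f 1 = 0"
  shows "wint (\<lambda>x. dpsi n x * f' x) = (lam n)\<^sup>2 * wint (\<lambda>x. psi n x * f x)"
proof -
  define h where "h = (\<lambda>x. dpsi n x * f' x - (lam n)\<^sup>2 * (psi n x * f x))"
  have c: "continuous_on {0..1} (\<lambda>x. dpsi n x * f' x)" "continuous_on {0..1} (\<lambda>x. (lam n)\<^sup>2 * (psi n x * f x))"
    by (intro continuous_intros assms)+
  have "((\<lambda>x. x powr a * h x) has_integral (flux n 1 * f 1 - flux n 0 * f 0)) {0..1}"
  proof (rule wint_FTC[where S = "{}"])
    show "continuous_on {0..1} (\<lambda>x. flux n x * f x)"
      by (intro continuous_on_mult continuous_on_flux assms)
    fix x :: real assume x: "0 < x" "x < 1"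
    have "((\<lambda>x. flux n x * f x) has_real_derivative
        - (lam n)\<^sup>2 * x powr a * psi n x * f x + f' x * flux n x) (at x)"
      by (rule DERIV_mult[OF DERIV_flux f(1)]) (use x in auto)
    then show "((\<lambda>x. flux n x * f x) has_real_derivative x powr a * h x) (at x)"
      using x by (simp add: h_def flux_eq algebra_simps)
  qed auto
  then have "wint h = 0" using f(4) by (simp add: wint_def integral_unique flux_def)
  moreover have "wint h = wint (\<lambda>x. dpsi n x * f' x) - (lam n)\<^sup>2 * wint (\<lambda>x. psi n x * f x)"
    unfolding h_def using wint_diff[OF c] wint_cmult by simp
  ultimately show ?thesis by simp
qed

lemma wint_dpsi_dpsi:
  assumes "m \<ge> 1" "n \<ge> 1"
  shows "wint (\<lambda>x. dpsi n x * dpsi m x) = (lam n)\<^sup>2 * wint (\<lambda>x. psi n x * psi m x)"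
  by (rule wint_green) (use assms in \<open>auto intro!: DERIV_psi continuous_intros simp: psi_1\<close>)

lemma psi_orthogonal:
  assumes "m \<ge> 1" "n \<ge> 1" "m \<noteq> n"
  shows "wint (\<lambda>x. psi n x * psi m x) = 0"
proof -
  have "(lam n)\<^sup>2 * wint (\<lambda>x. psi n x * psi m x) = (lam m)\<^sup>2 * wint (\<lambda>x. psi n x * psi m x)"
    using wint_dpsi_dpsi[OF assms(1,2)] wint_dpsi_dpsi[OF assms(2,1)]
    unfolding mult.commute[of "dpsi m _"] mult.commute[of "psi m _"] by linarith
  moreover have "(lam n)\<^sup>2 \<noteq> (lam m)\<^sup>2"
    using strict_mono_eq[OF strict_mono_lam, of n m] assms lam_pos[of n] lam_pos[of m]
    by (simp add: power2_eq_iff_nonneg)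
  ultimately show ?thesis by simp
qed

text \<open>Lommel's integral: \<open>x\<^sup>a u\<^sup>2\<close> has the antiderivative
  \<open>(x\<^bsup>a+1\<^esup> (u'\<^sup>2 + \<lambda>\<^sup>2 u\<^sup>2) + (a - 1) x\<^sup>a u u') / (2 \<lambda>\<^sup>2)\<close> for every solution \<open>u\<close> of the Bessel equation
  with eigenvalue \<open>\<lambda>\<^sup>2\<close>.\<close>

lemma psi_normalized:
  assumes "n \<ge> 1"
  shows "wint (\<lambda>x. (psi n x)\<^sup>2) = 1"
proof -
  define l where "l = lam n"
  have l: "l > 0" using lam_pos[OF assms] by (simp add: l_def)
  define G where "G = (\<lambda>x. x * dpsi n x * flux n x + l\<^sup>2 * x powr (a + 1) * (psi n x)\<^sup>2 + (a - 1) * psi n x * flux n x)"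
  have "((\<lambda>x. x powr a * (2 * l\<^sup>2 * (psi n x)\<^sup>2)) has_integral (G 1 - G 0)) {0..1}"
  proof (rule wint_FTC[where S = "{}"])
    show "continuous_on {0..1} G"
      unfolding G_def using a_gt
      by (intro continuous_intros continuous_on_flux continuous_on_powr') auto
    fix x :: real assume x: "0 < x" "x < 1"
    have dd: "(dpsi n has_real_derivative - l\<^sup>2 * psi n x - a / x * dpsi n x) (at x)"
    proof -
      have "((\<lambda>x. flux n x * x powr (- a)) has_real_derivative
          - l\<^sup>2 * x powr a * psi n x * x powr (- a) + (- a * x powr (- a - 1)) * flux n x) (at x)"
        using x by (auto intro!: derivative_eq_intros DERIV_flux simp: l_def)
      moreover have "- l\<^sup>2 * x powr a * psi n x * x powr (- a) + (- a * x powr (- a - 1)) * flux n x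
          = - l\<^sup>2 * psi n x - a / x * dpsi n x"
        using x by (simp add: flux_eq powr_minus powr_diff field_simps)
      moreover have "\<forall>\<^sub>F y in nhds x. flux n y * y powr (- a) = dpsi n y"
        using eventually_nhds_in_open[of "{0<..}" x] x
        by (auto elim!: eventually_mono simp: flux_eq powr_minus)
      ultimately show ?thesis using DERIV_cong_ev by fastforce
    qed
    have "(G has_real_derivative
       (1 * dpsi n x + x * (- l\<^sup>2 * psi n x - a / x * dpsi n x)) * flux n x
        + x * dpsi n x * (- l\<^sup>2 * x powr a * psi n x)
        + l\<^sup>2 * ((a + 1) * x powr a * (psi n x)\<^sup>2 + x powr (a + 1) * (2 * psi n x * dpsi n x))
        + (a - 1) * (dpsi n x * flux n x + psi n x * (- l\<^sup>2 * x powr a * psi n x))) (at x)"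
      unfolding G_def using x
      by (auto intro!: derivative_eq_intros DERIV_psi DERIV_flux dd simp: l_def algebra_simps)
    moreover have "(1 * dpsi n x + x * (- l\<^sup>2 * psi n x - a / x * dpsi n x)) * flux n x
        + x * dpsi n x * (- l\<^sup>2 * x powr a * psi n x)
        + l\<^sup>2 * ((a + 1) * x powr a * (psi n x)\<^sup>2 + x powr (a + 1) * (2 * psi n x * dpsi n x))
        + (a - 1) * (dpsi n x * flux n x + psi n x * (- l\<^sup>2 * x powr a * psi n x))
        = x powr a * (2 * l\<^sup>2 * (psi n x)\<^sup>2)"
      using x by (simp add: flux_eq powr_add power2_eq_square field_simps)
    ultimately show "(G has_real_derivative x powr a * (2 * l\<^sup>2 * (psi n x)\<^sup>2)) (at x)" by simp
  qed auto
  then have "wint (\<lambda>x. 2 * l\<^sup>2 * (psi n x)\<^sup>2) = G 1 - G 0"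
    by (simp add: wint_def integral_unique)
  then have "2 * l\<^sup>2 * wint (\<lambda>x. (psi n x)\<^sup>2) = G 1 - G 0"
    by (simp only: wint_cmult)
  \<comment> \<open>\<open>psi n\<close> vanishes at 1, while \<open>flux n\<close> and
    \<open>x powr (a + 1)\<close> vanish at 0; one squared derivative is left.\<close>
  also have "\<dots> = (dpsi n 1)\<^sup>2"
    using psi_1[OF assms] flux_eq[of 1 n] by (simp add: G_def power2_eq_square) (simp add: flux_def)
  also have "\<dots> = 2 * l\<^sup>2"
  proof -
    have "dpsi n 1 = - l * (psi_const n * (l / 2 * bessel_Phi (\<nu> + 1) l))"
      by (simp add: dpsi_def l_def power2_eq_square)
    then have "(dpsi n 1)\<^sup>2 = l\<^sup>2 * ((psi_const n)\<^sup>2 * (l / 2 * bessel_Phi (\<nu> + 1) l)\<^sup>2)"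
      by (simp only: power_mult_distrib power2_minus)
    also have "(psi_const n)\<^sup>2 * (l / 2 * bessel_Phi (\<nu> + 1) l)\<^sup>2 = 2"
      using flux_lam_nz[OF assms] l unfolding psi_const_def l_def[symmetric]
      by (simp add: power_divide power_mult_distrib)
    finally show ?thesis by simp
  qed
  finally show ?thesis using l by simp
qed

end

section \<open>Completeness\<close>

text \<open>More vectors \<open>v k\<close> than coordinates are dependent, by elimination: a vector
  \<open>v p\<close> with nonzero entry \<open>j\<close> clears that entry in all others, and the
  induction hypothesis applies to the rest.\<close>

lemma underdetermined_system:
  fixes v :: "'i \<Rightarrow> 'j \<Rightarrow> real"
  assumes "finite J" "finite K" "card J < card K"
  shows "\<exists>c. (\<exists>k\<in>K. c k \<noteq> 0) \<and> (\<forall>j\<in>J. (\<Sum>k\<in>K. c k * v k j) = 0)"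
  using assms
proof (induction J arbitrary: K v rule: finite_induct)
  case empty
  then have "K \<noteq> {}" by auto
  then show ?case by (intro exI[of _ "\<lambda>_. 1"]) auto
next
  case (insert j J)
  show ?case
  proof (cases "\<forall>k\<in>K. v k j = 0")
    case True
    have "card J < card K" using insert by simp
    then obtain c where "\<exists>k\<in>K. c k \<noteq> 0" "\<forall>i\<in>J. (\<Sum>k\<in>K. c k * v k i) = 0"
      using insert.IH[OF insert.prems(1), of v] by blast
    then show ?thesis using True by (intro exI[of _ c]) auto
  next
    case False
    then obtain p where p: "p \<in> K" "v p j \<noteq> 0" by auto
    define w where "w = (\<lambda>k i. v k i - v k j / v p j * v p i)"
    have "card J < card (K - {p})" using insert p by simp
    then obtain c where c: "\<exists>k\<in>K-{p}. c k \<noteq> 0" "\<forall>i\<in>J. (\<Sum>k\<in>K-{p}. c k * w k i) = 0"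
      using insert.IH[of "K - {p}" w] insert.prems by auto
    \<comment> \<open>The coefficient of \<open>v p\<close> that undoes the elimination.\<close>
    define e where "e = - (\<Sum>k\<in>K-{p}. c k * (v k j / v p j))"
    define b where "b = c(p := e)"
    have sum_b: "(\<Sum>k\<in>K. b k * v k i) = (\<Sum>k\<in>K-{p}. c k * w k i)" for i
    proof -
      have "(\<Sum>k\<in>K. b k * v k i) = e * v p i + (\<Sum>k\<in>K-{p}. c k * v k i)"
        using insert.prems(1) p(1) by (subst sum.remove[of K p]) (auto simp: b_def intro!: sum.cong)
      also have "e * v p i = - (\<Sum>k\<in>K-{p}. c k * (v k j / v p j) * v p i)"
        by (simp add: e_def sum_distrib_right)
      finally show ?thesis
        by (simp add: w_def right_diff_distrib sum_subtractf mult.assoc)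
    qed
    have "(\<Sum>k\<in>K. b k * v k i) = 0" if "i \<in> insert j J" for i
    proof (cases "i = j")
      case True then show ?thesis unfolding sum_b using p by (simp add: w_def)
    next
      case False then show ?thesis unfolding sum_b using c(2) that by simp
    qed
    moreover have "\<exists>k\<in>K. b k \<noteq> 0" using c(1) p(1) by (auto simp: b_def)
    ultimately show ?thesis by blast
  qed
qed

text \<open>Writes \<open>f^2 / p\<close> as \<open>f\<close> times the ratio of the two difference
  quotients; the ratio converges and \<open>f\<close> tends to 0. It serves at the nodes in Picone's
  identity.\<close>

lemma quotient_tendsto_0_at_zero:
  assumes "(f has_real_derivative f') (at z within S)" "(p has_real_derivative p') (at z within S)"
    and "f z = 0" "p z = 0" "p' \<noteq> 0"
  shows "((\<lambda>x. (f x)\<^sup>2 / p x) \<longlongrightarrow> 0) (at z within S)"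
proof -
  have "((\<lambda>x. f x / (x - z)) \<longlongrightarrow> f') (at z within S)" "((\<lambda>x. p x / (x - z)) \<longlongrightarrow> p') (at z within S)"
    using assms by (simp_all add: has_field_derivative_iff)
  moreover have "(f \<longlongrightarrow> 0) (at z within S)"
    using DERIV_continuous[OF assms(1)] assms(3) by (simp add: continuous_within)
  ultimately have "((\<lambda>x. f x * ((f x / (x - z)) / (p x / (x - z)))) \<longlongrightarrow> 0 * (f' / p')) (at z within S)"
    using assms(5) by (intro tendsto_intros)
  moreover have "\<forall>\<^sub>F x in at z within S. f x * ((f x / (x - z)) / (p x / (x - z))) = (f x)\<^sup>2 / p x"
    unfolding eventually_at_filter by (intro always_eventually) (auto simp: power2_eq_square)
  ultimately show ?thesis using Lim_transform_eventually by force
qed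

context bessel
begin

section \<open>Nodes, Picone's identity and Courant's principle\<close>

lemma psi_nodes:
  assumes "n \<ge> 1" "0 < x" "x \<le> 1" "psi n x = 0"
  shows "x \<in> (\<lambda>j. lam j / lam n) ` {1..n}"
proof -
  have l: "lam n > 0" by (rule lam_pos) fact
  have "bessel_Phi \<nu> (lam n * x) = 0" using assms psi_const_pos[of n] by (simp add: psi_def)
  then obtain j where j: "j \<ge> 1" "lam n * x = lam j"
    using zeros_enum[of "lam n * x"] l assms by auto
  moreover have "lam j \<le> lam n" using assms j l mult_left_mono[of x 1 "lam n"] by simp
  then have "j \<le> n" using strict_mono_less_eq[OF strict_mono_lam] by blast
  ultimately show ?thesis using l by (intro image_eqI[of _ _ j]) (auto simp: field_simps)
qed

text \<open>Picone's identity: \<open>x\<^sup>a \<psi>' f\<^sup>2 / \<psi>\<close> has the derivative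
  \<open>x\<^sup>a (f'\<^sup>2 - \<lambda>\<^sup>2 f\<^sup>2 - (f' - f \<psi>' / \<psi>)\<^sup>2)\<close>. At a node of the eigenfunction \<open>\<psi>\<close> both the limit of
  \<open>f\<^sup>2 / \<psi>\<close> and the junk value of the quotient are \<open>0\<close>, so the fundamental theorem applies on
  all of \<open>[0,1]\<close>.\<close>

lemma picone:
  assumes n: "n \<ge> 1"
    and f: "\<And>x. x \<in> {0..1} \<Longrightarrow> (f has_real_derivative f' x) (at x within {0..1})"
    and cf': "continuous_on {0..1} f'"
    and van: "\<And>x. 0 < x \<Longrightarrow> x \<le> 1 \<Longrightarrow> psi n x = 0 \<Longrightarrow> f x = 0"
  shows "(lam n)\<^sup>2 * wint (\<lambda>x. (f x)\<^sup>2) \<le> wint (\<lambda>x. (f' x)\<^sup>2)"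
proof -
  define S where "S = (\<lambda>j. lam j / lam n) ` {1..n}"
  have S: "x \<in> S" if "0 < x" "x \<le> 1" "psi n x = 0" for x
    unfolding S_def by (rule psi_nodes) fact+
  define G where "G = (\<lambda>x. flux n x * ((f x)\<^sup>2 / psi n x))"
  define h where "h = (\<lambda>x. (f' x)\<^sup>2 - (lam n)\<^sup>2 * (f x)\<^sup>2 - (f' x - f x * dpsi n x / psi n x)\<^sup>2)"
  have cf: "continuous_on {0..1} f" by (rule DERIV_continuous_on) (rule f)
  \<comment> \<open>So every node is positive, as the vanishing assumption on \<open>f\<close>
    requires.\<close>
  have nz0: "psi n 0 \<noteq> 0"
  proof -
    have "Gamma (\<nu> + 1) > 0" using nu by (intro Gamma_real_pos) auto
    then show ?thesis using psi_const_pos[OF n] by (simp add: psi_def bessel_Phi_0)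
  qed
  have hasint: "((\<lambda>x. x powr a * h x) has_integral (G 1 - G 0)) {0..1}"
  proof (rule wint_FTC)
    show "finite S" by (simp add: S_def)
    show "continuous_on {0..1} G" unfolding G_def
    proof (rule continuous_on_mult[OF continuous_on_flux])
      show "continuous_on {0..1} (\<lambda>x. (f x)\<^sup>2 / psi n x)"
        unfolding continuous_on_def
      proof
        fix z :: real assume z: "z \<in> {0..1}"
        show "((\<lambda>x. (f x)\<^sup>2 / psi n x) \<longlongrightarrow> (f z)\<^sup>2 / psi n z) (at z within {0..1})"
        proof (cases "psi n z = 0")
          case True
          then have "z > 0" using z nz0 by (cases "z = 0") auto
          then have "dpsi n z \<noteq> 0" "f z = 0" using dpsi_nz[OF n _ True] van[OF _ _ True] z by auto
          then show ?thesis
            using quotient_tendsto_0_at_zero[OF f[OF z] DERIV_psi, of n] True by simp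
        next
          case False
          have "(f \<longlongrightarrow> f z) (at z within {0..1})" using cf z by (auto simp: continuous_on_def)
          moreover have "(psi n \<longlongrightarrow> psi n z) (at z within {0..1})"
            using DERIV_continuous[OF DERIV_psi[of n z "{0..1}"]] by (simp add: continuous_within)
          ultimately show ?thesis using False by (intro tendsto_intros)
        qed
      qed
    qed
    fix x :: real assume x: "0 < x" "x < 1" "x \<notin> S"
    then have nz: "psi n x \<noteq> 0" using S[of x] by auto
    have df: "(f has_real_derivative f' x) (at x)"
      using f[of x] x by (simp add: at_within_Icc_at)
    have "(G has_real_derivative flux n x * ((2 * f x * f' x * psi n x - (f x)\<^sup>2 * dpsi n x) / (psi n x * psi n x))
        + (- (lam n)\<^sup>2 * x powr a * psi n x) * ((f x)\<^sup>2 / psi n x)) (at x)"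
      unfolding G_def using nz x
      by (auto intro!: derivative_eq_intros DERIV_flux DERIV_psi df simp: field_simps)
    moreover have "flux n x * ((2 * f x * f' x * psi n x - (f x)\<^sup>2 * dpsi n x) / (psi n x * psi n x))
        + (- (lam n)\<^sup>2 * x powr a * psi n x) * ((f x)\<^sup>2 / psi n x) = x powr a * h x"
      using nz x by (simp add: flux_eq h_def power2_eq_square field_simps)
    ultimately show "(G has_real_derivative x powr a * h x) (at x)" by simp
  qed
  have "G 1 - G 0 = 0" using van[of 1] psi_1[OF n] by (simp add: G_def flux_def)
  moreover have cc: "continuous_on {0..1} (\<lambda>x. (f' x)\<^sup>2 - (lam n)\<^sup>2 * (f x)\<^sup>2)"
    by (intro continuous_intros cf cf')
  \<comment> \<open>The inequality comes from dropping the square in \<open>h\<close>.\<close>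
  have "G 1 - G 0 \<le> wint (\<lambda>x. (f' x)\<^sup>2 - (lam n)\<^sup>2 * (f x)\<^sup>2)"
    unfolding wint_def
    by (rule has_integral_le[OF hasint integrable_integral[OF wint_integrable[OF cc]]])
       (auto simp: h_def intro: mult_left_mono)
  moreover have "wint (\<lambda>x. (f' x)\<^sup>2 - (lam n)\<^sup>2 * (f x)\<^sup>2) = wint (\<lambda>x. (f' x)\<^sup>2) - (lam n)\<^sup>2 * wint (\<lambda>x. (f x)\<^sup>2)"
    unfolding wint_cmult[symmetric] by (intro wint_diff continuous_intros cf cf')
  ultimately show ?thesis by simp
qed

text \<open>The \<open>p k\<close> are not assumed normalised because the lemma serves both the
  eigenfunctions and their derivatives, whose squared norms are \<open>(lam k)^2\<close>.\<close>

lemma wint_pythagoras: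
  assumes "finite A" "continuous_on {0..1} s" "\<And>k. k \<in> A \<Longrightarrow> continuous_on {0..1} (p k)"
    and "\<And>k. k \<in> A \<Longrightarrow> wint (\<lambda>x. p k x * s x) = 0"
    and "\<And>k l. k \<in> A \<Longrightarrow> l \<in> A \<Longrightarrow> k \<noteq> l \<Longrightarrow> wint (\<lambda>x. p k x * p l x) = 0"
  shows "wint (\<lambda>x. (s x + (\<Sum>k\<in>A. d k * p k x))\<^sup>2)
    = wint (\<lambda>x. (s x)\<^sup>2) + (\<Sum>k\<in>A. (d k)\<^sup>2 * wint (\<lambda>x. (p k x)\<^sup>2))"
  using assms
proof (induction A rule: finite_induct)
  case (insert j A)
  define t where "t = (\<lambda>x. s x + (\<Sum>k\<in>A. d k * p k x))"
  have ct: "continuous_on {0..1} t" and cp: "continuous_on {0..1} (p j)"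
    unfolding t_def using insert by (auto intro!: continuous_intros)
  have "wint (\<lambda>x. p j x * t x) = wint (\<lambda>x. p j x * s x + (\<Sum>k\<in>A. d k * (p j x * p k x)))"
    by (intro wint_cong) (simp add: t_def distrib_left sum_distrib_left mult_ac)
  also have "\<dots> = wint (\<lambda>x. p j x * s x) + (\<Sum>k\<in>A. wint (\<lambda>x. d k * (p j x * p k x)))"
    using insert cp
    by (subst wint_add, (intro continuous_intros; simp)+) (subst wint_sum, auto intro!: continuous_intros)
  also have "\<dots> = 0"
  proof -
    have "wint (\<lambda>x. p j x * p k x) = 0" if "k \<in> A" for k
      using insert.prems(4)[of j k] insert.hyps(2) that by auto
    then show ?thesis using insert.prems(3)[of j] by (simp add: wint_cmult)
  qed
  finally have pt: "wint (\<lambda>x. p j x * t x) = 0" .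
  have "wint (\<lambda>x. (s x + (\<Sum>k\<in>insert j A. d k * p k x))\<^sup>2)
      = wint (\<lambda>x. (t x)\<^sup>2 + (2 * d j * (p j x * t x) + (d j)\<^sup>2 * (p j x)\<^sup>2))"
    using insert(1,2) by (intro wint_cong) (simp add: t_def power2_eq_square algebra_simps)
  also have "\<dots> = wint (\<lambda>x. (t x)\<^sup>2) + (2 * d j * wint (\<lambda>x. p j x * t x) + (d j)\<^sup>2 * wint (\<lambda>x. (p j x)\<^sup>2))"
  proof -
    have c: "continuous_on {0..1} (\<lambda>x. (t x)\<^sup>2)" "continuous_on {0..1} (\<lambda>x. 2 * d j * (p j x * t x))"
        "continuous_on {0..1} (\<lambda>x. (d j)\<^sup>2 * (p j x)\<^sup>2)"
      by (intro continuous_intros ct cp)+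
    show ?thesis unfolding wint_cmult[symmetric]
      using wint_add[OF c(1) continuous_on_add[OF c(2,3)]] wint_add[OF c(2,3)] by simp
  qed
  also have "\<dots> = wint (\<lambda>x. (s x)\<^sup>2) + (\<Sum>k\<in>insert j A. (d k)\<^sup>2 * wint (\<lambda>x. (p k x)\<^sup>2))"
    using insert pt by (simp add: t_def)
  finally show ?case .
qed simp

lemma wint_dpsi_sq: "n \<ge> 1 \<Longrightarrow> wint (\<lambda>x. (dpsi n x)\<^sup>2) = (lam n)\<^sup>2"
  using wint_dpsi_dpsi[of n n] psi_normalized[of n] by (simp add: power2_eq_square)

lemma dpsi_orthogonal: "m \<ge> 1 \<Longrightarrow> n \<ge> 1 \<Longrightarrow> m \<noteq> n \<Longrightarrow> wint (\<lambda>x. dpsi n x * dpsi m x) = 0"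
  using wint_dpsi_dpsi[of m n] psi_orthogonal[of m n] by simp

definition coef :: "(real \<Rightarrow> real) \<Rightarrow> nat \<Rightarrow> real" where
  "coef g k = wint (\<lambda>x. psi k x * g x)"

lemma coef_remainder:
  assumes "continuous_on {0..1} g" "finite A" "j \<in> A" "A \<subseteq> {1..}"
  shows "wint (\<lambda>x. psi j x * (g x - (\<Sum>k\<in>A. coef g k * psi k x))) = 0"
proof -
  have "wint (\<lambda>x. psi j x * (g x - (\<Sum>k\<in>A. coef g k * psi k x)))
      = wint (\<lambda>x. psi j x * g x - (\<Sum>k\<in>A. coef g k * (psi j x * psi k x)))"
    by (intro wint_cong) (simp add: right_diff_distrib sum_distrib_left mult_ac)
  also have "\<dots> = coef g j - (\<Sum>k\<in>A. wint (\<lambda>x. coef g k * (psi j x * psi k x)))"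
    unfolding coef_def using assms
    by (subst wint_diff, (intro continuous_intros; simp)+) (subst wint_sum, auto intro!: continuous_intros)
  also have "(\<Sum>k\<in>A. wint (\<lambda>x. coef g k * (psi j x * psi k x))) = (\<Sum>k\<in>A. if k = j then coef g j else 0)"
  proof (rule sum.cong[OF refl])
    fix k assume "k \<in> A"
    then have "k \<ge> 1" "j \<ge> 1" using assms by auto
    then show "wint (\<lambda>x. coef g k * (psi j x * psi k x)) = (if k = j then coef g j else 0)"
      using psi_orthogonal[of k j] psi_normalized[of j] by (auto simp: wint_cmult simp flip: power2_eq_square)
  qed
  also have "\<dots> = coef g j" using assms by simp
  finally show ?thesis by simp
qed

text \<open>Courant's principle: \<open>n - 1\<close> eigenfunctions can be combined with \<open>g\<close> so as to vanish at the
  \<open>n - 1\<close> interior nodes of the \<open>n\<close>-th one, and then Picone's identity applies.\<close>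

theorem eigenfunction_expansion_remainder:
  assumes n: "n \<ge> 1"
    and g: "\<And>x. x \<in> {0..1} \<Longrightarrow> (g has_real_derivative g' x) (at x within {0..1})"
    and cg': "continuous_on {0..1} g'" and g1: "g 1 = 0"
  shows "(lam n)\<^sup>2 * wint (\<lambda>x. (g x - (\<Sum>k\<in>{1..<n}. coef g k * psi k x))\<^sup>2) \<le> wint (\<lambda>x. (g' x)\<^sup>2)"
proof -
  let ?A = "{1..<n}"
  define c where "c = coef g"
  define r where "r = (\<lambda>x. g x - (\<Sum>k\<in>?A. c k * psi k x))"
  define r' where "r' = (\<lambda>x. g' x - (\<Sum>k\<in>?A. c k * dpsi k x))"
  have cg: "continuous_on {0..1} g" by (rule DERIV_continuous_on) (rule g)
  have cr: "continuous_on {0..1} r" "continuous_on {0..1} r'"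
    unfolding r_def r'_def by (intro continuous_intros cg cg')+
  have dr: "(r has_real_derivative r' x) (at x within {0..1})" if "x \<in> {0..1}" for x
    unfolding r_def r'_def using that
    by (auto intro!: derivative_eq_intros g DERIV_psi simp: mult.commute)
  have r1: "r 1 = 0" unfolding r_def using g1 by (auto simp: psi_1)
  have rp: "wint (\<lambda>x. psi k x * r x) = 0" if "k \<in> ?A" for k
    unfolding r_def c_def by (rule coef_remainder[OF cg _ that]) auto
  have rp': "wint (\<lambda>x. dpsi k x * r' x) = 0" if "k \<in> ?A" for k
  proof -
    have "wint (\<lambda>x. dpsi k x * r' x) = (lam k)\<^sup>2 * wint (\<lambda>x. psi k x * r x)"
    proof (rule wint_green)
      fix x :: real assume "0 < x" "x < 1"
      then show "(r has_real_derivative r' x) (at x)" using dr[of x] by (simp add: at_within_Icc_at)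
    qed (use cr r1 in auto)
    then show ?thesis using rp[OF that] by simp
  qed
  \<comment> \<open>Index 0 stands for \<open>g\<close>: there are \<open>n\<close> unknown
    coefficients against \<open>n - 1\<close> interior nodes.\<close>
  define u where "u = (\<lambda>k. if k = 0 then g else psi k)"
  obtain b where b: "\<exists>k\<in>{..<n}. b k \<noteq> 0" "\<forall>j\<in>?A. (\<Sum>k\<in>{..<n}. b k * u k (lam j / lam n)) = 0"
    using underdetermined_system[of ?A "{..<n}" "\<lambda>k j. u k (lam j / lam n)"] n by auto
  define al where "al = b 0"
  \<comment> \<open>Splitting \<open>g\<close> into its remainder \<open>r\<close> and its
    projection turns the combination into \<open>al * r\<close> plus eigenfunctions orthogonal to
    \<open>r\<close>.\<close>
  define d where "d = (\<lambda>k. b k + al * c k)"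
  have split0: "{..<n} = insert 0 ?A" using n by auto
  define f where "f = (\<lambda>x. al * r x + (\<Sum>k\<in>?A. d k * psi k x))"
  define f' where "f' = (\<lambda>x. al * r' x + (\<Sum>k\<in>?A. d k * dpsi k x))"
  have f_eq: "f x = (\<Sum>k\<in>{..<n}. b k * u k x)" for x
  proof -
    have "(\<Sum>k\<in>?A. d k * psi k x) = (\<Sum>k\<in>?A. b k * u k x) + al * (\<Sum>k\<in>?A. c k * psi k x)"
      unfolding sum_distrib_left sum.distrib[symmetric]
      by (intro sum.cong) (auto simp: d_def u_def algebra_simps)
    then show ?thesis unfolding split0 by (simp add: f_def r_def u_def al_def right_diff_distrib)
  qed
  have "(lam n)\<^sup>2 * wint (\<lambda>x. (f x)\<^sup>2) \<le> wint (\<lambda>x. (f' x)\<^sup>2)"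
  proof (rule picone[OF n])
    show "(f has_real_derivative f' x) (at x within {0..1})" if "x \<in> {0..1}" for x
      unfolding f_def f'_def using that by (auto intro!: derivative_eq_intros dr DERIV_psi simp: mult.commute)
    show "continuous_on {0..1} f'" unfolding f'_def by (intro continuous_intros cr)
    fix x assume x: "0 < x" "x \<le> 1" "psi n x = 0"
    obtain j where j: "j \<in> {1..n}" "x = lam j / lam n" using psi_nodes[OF n x] by blast
    show "f x = 0"
    proof (cases "j = n")
      case True
      then have "x = 1" using j lam_pos[OF n] by simp
      then show ?thesis using r1 by (auto simp: f_def psi_1)
    next
      case False then show ?thesis using b(2) j by (auto simp: f_eq)
    qed
  qed
  moreover have "wint (\<lambda>x. (f x)\<^sup>2) = al\<^sup>2 * wint (\<lambda>x. (r x)\<^sup>2) + (\<Sum>k\<in>?A. (d k)\<^sup>2)"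
  proof -
    have "wint (\<lambda>x. (f x)\<^sup>2) = wint (\<lambda>x. (al * r x)\<^sup>2) + (\<Sum>k\<in>?A. (d k)\<^sup>2 * wint (\<lambda>x. (psi k x)\<^sup>2))"
      unfolding f_def
      by (rule wint_pythagoras) (use rp in \<open>auto intro!: continuous_intros cr psi_orthogonal
          simp: mult.left_commute wint_cmult\<close>)
    then show ?thesis by (simp add: power_mult_distrib wint_cmult psi_normalized)
  qed
  moreover have "wint (\<lambda>x. (f' x)\<^sup>2) = al\<^sup>2 * wint (\<lambda>x. (r' x)\<^sup>2) + (\<Sum>k\<in>?A. (d k)\<^sup>2 * (lam k)\<^sup>2)"
  proof -
    have "wint (\<lambda>x. (f' x)\<^sup>2) = wint (\<lambda>x. (al * r' x)\<^sup>2) + (\<Sum>k\<in>?A. (d k)\<^sup>2 * wint (\<lambda>x. (dpsi k x)\<^sup>2))"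
      unfolding f'_def
      by (rule wint_pythagoras) (use rp' in \<open>auto intro!: continuous_intros cr dpsi_orthogonal
          simp: mult.left_commute wint_cmult\<close>)
    then show ?thesis by (simp add: power_mult_distrib wint_cmult wint_dpsi_sq)
  qed
  moreover have "wint (\<lambda>x. (g' x)\<^sup>2) = wint (\<lambda>x. (r' x)\<^sup>2) + (\<Sum>k\<in>?A. (c k)\<^sup>2 * (lam k)\<^sup>2)"
  proof -
    have "wint (\<lambda>x. (g' x)\<^sup>2) = wint (\<lambda>x. (r' x + (\<Sum>k\<in>?A. c k * dpsi k x))\<^sup>2)"
      by (simp add: r'_def)
    also have "\<dots> = wint (\<lambda>x. (r' x)\<^sup>2) + (\<Sum>k\<in>?A. (c k)\<^sup>2 * wint (\<lambda>x. (dpsi k x)\<^sup>2))"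
      by (rule wint_pythagoras) (use rp' in \<open>auto intro!: continuous_intros cr dpsi_orthogonal\<close>)
    finally show ?thesis by (simp add: wint_dpsi_sq)
  qed
  moreover have gap: "(lam k)\<^sup>2 < (lam n)\<^sup>2" if "k \<in> ?A" for k
    using that strict_monoD[OF strict_mono_lam, of k n] lam_nonneg by (intro power_strict_mono) auto
  \<comment> \<open>Picone's inequality for \<open>f\<close> after both sides are expanded by
    Pythagoras.\<close>
  ultimately have main: "(\<Sum>k\<in>?A. (d k)\<^sup>2 * ((lam n)\<^sup>2 - (lam k)\<^sup>2))
      \<le> al\<^sup>2 * (wint (\<lambda>x. (r' x)\<^sup>2) - (lam n)\<^sup>2 * wint (\<lambda>x. (r x)\<^sup>2))"
    and E: "wint (\<lambda>x. (r' x)\<^sup>2) \<le> wint (\<lambda>x. (g' x)\<^sup>2)"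
    by (simp_all add: algebra_simps sum_subtractf sum_distrib_left sum_nonneg)
  have nn: "0 \<le> (d k)\<^sup>2 * ((lam n)\<^sup>2 - (lam k)\<^sup>2)" if "k \<in> ?A" for k
    using gap[OF that] by simp
  \<comment> \<open>Without \<open>g\<close> in the combination, the gaps
    \<open>(lam n)^2 - (lam k)^2 > 0\<close> would force all coefficients to vanish.\<close>
  have "al \<noteq> 0"
  proof
    assume al: "al = 0"
    have "d k = 0" if "k \<in> ?A" for k
    proof -
      have "(d k)\<^sup>2 * ((lam n)\<^sup>2 - (lam k)\<^sup>2) \<le> (\<Sum>k\<in>?A. (d k)\<^sup>2 * ((lam n)\<^sup>2 - (lam k)\<^sup>2))"
        by (rule member_le_sum[OF that]) (use nn in auto)
      then have "(d k)\<^sup>2 * ((lam n)\<^sup>2 - (lam k)\<^sup>2) \<le> 0" using main al by simp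
      then show ?thesis using gap[OF that] by (simp add: mult_le_0_iff)
    qed
    then show False using b(1) al by (auto simp: split0 d_def al_def)
  qed
  moreover have "0 \<le> (\<Sum>k\<in>?A. (d k)\<^sup>2 * ((lam n)\<^sup>2 - (lam k)\<^sup>2))"
    by (intro sum_nonneg nn)
  ultimately have "al\<^sup>2 > 0" "0 \<le> al\<^sup>2 * (wint (\<lambda>x. (r' x)\<^sup>2) - (lam n)\<^sup>2 * wint (\<lambda>x. (r x)\<^sup>2))"
    using main by (simp, linarith)
  then have "(lam n)\<^sup>2 * wint (\<lambda>x. (r x)\<^sup>2) \<le> wint (\<lambda>x. (r' x)\<^sup>2)"
    by (simp only: zero_le_mult_iff) auto
  then show ?thesis using E unfolding r_def c_def by simp
qed

end

section \<open>Eigenfunction bounds and the heat kernel on the diagonal\<close>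

text \<open>A Riemann sum with step \<open>r\<close> for \<open>s powr (- b) / (1 + s)^2\<close>.
  Each term, times \<open>1 - b\<close>, is at most an increment of \<open>G\<close>, and
  \<open>G\<close> runs from 0 to at most 1; so the bound depends neither on the step nor on
  \<open>N\<close>.\<close>

lemma sum_weight_bound:
  fixes b r :: real
  assumes "0 \<le> b" "b < 1" "r > 0"
  shows "(\<Sum>n<N. r * (r * real (Suc n)) powr (- b) / (1 + r * real (Suc n))\<^sup>2) \<le> 1 / (1 - b)"
proof -
  define G where "G = (\<lambda>s::real. (s / (1 + s)) powr (1 - b))"
  have dG: "(G has_real_derivative (1 - b) * (s / (1 + s)) powr (- b) / (1 + s)\<^sup>2) (at s)" if "s > 0" for s
  proof -
    have "((\<lambda>s. s / (1 + s)) has_real_derivative 1 / (1 + s)\<^sup>2) (at s)"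
      using that by (auto intro!: derivative_eq_intros simp: power2_eq_square)
    from DERIV_chain2[OF has_real_derivative_powr[of "s / (1 + s)" "1 - b"] this] that show ?thesis
      unfolding G_def by simp
  qed
  have cG: "continuous_on {0..} G"
    unfolding G_def using assms by (intro continuous_on_powr' continuous_intros) auto
  have step: "(1 - b) * (r * (r * real (Suc n)) powr (- b) / (1 + r * real (Suc n))\<^sup>2)
      \<le> G (r * real (Suc n)) - G (r * real n)" for n
  proof -
    let ?x = "r * real n" and ?y = "r * real (Suc n)"
    have xy: "0 \<le> ?x" "?x < ?y" using assms by auto
    have "\<exists>l z. ?x < z \<and> z < ?y \<and> DERIV G z :> l \<and> G ?y - G ?x = (?y - ?x) * l"
    proof (rule MVT)
      show "continuous_on {?x..?y} G" using cG by (rule continuous_on_subset) (use xy in auto)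
      fix z assume "?x < z" "z < ?y"
      then show "G differentiable at z" using dG[of z] xy unfolding real_differentiable_def by auto
    qed (rule xy)
    then obtain l z where z: "?x < z" "z < ?y" "DERIV G z :> l" "G ?y - G ?x = (?y - ?x) * l" by blast
    have z0: "z > 0" using z xy by linarith
    have l: "l = (1 - b) * (z / (1 + z)) powr (- b) / (1 + z)\<^sup>2"
      using DERIV_unique[OF z(3) dG[OF z0]] .
    have "?y powr (- b) \<le> (z / (1 + z)) powr (- b)"
    proof (rule powr_mono2')
      have "z / (1 + z) \<le> z / 1" using z0 by (intro divide_left_mono) auto
      then show "z / (1 + z) \<le> ?y" using z by simp
    qed (use assms z0 in auto)
    moreover have "(1 + z)\<^sup>2 \<le> (1 + ?y)\<^sup>2" using z z0 by (intro power_mono) auto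
    ultimately have "?y powr (- b) / (1 + ?y)\<^sup>2 \<le> (z / (1 + z)) powr (- b) / (1 + z)\<^sup>2"
      using z0 by (intro frac_le) auto
    then have "(1 - b) * (?y powr (- b) / (1 + ?y)\<^sup>2) \<le> l"
      unfolding l using assms by (simp add: mult_left_mono flip: times_divide_eq_right)
    then have "r * ((1 - b) * (?y powr (- b) / (1 + ?y)\<^sup>2)) \<le> r * l"
      using assms by (intro mult_left_mono) auto
    also have "r * l = G ?y - G ?x" using z(4) by (simp add: algebra_simps)
    finally show ?thesis by (simp add: mult_ac)
  qed
  have "(1 - b) * (\<Sum>n<N. r * (r * real (Suc n)) powr (- b) / (1 + r * real (Suc n))\<^sup>2)
      \<le> (\<Sum>n<N. G (r * real (Suc n)) - G (r * real n))"
    unfolding sum_distrib_left by (intro sum_mono step)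
  also have "\<dots> = G (r * real N) - G 0"
    using sum_lessThan_telescope[of "\<lambda>n. G (r * real n)" N] by simp
  also have "\<dots> \<le> 1"
  proof -
    have "0 \<le> r * real N" using assms by simp
    then have "r * real N / (1 + r * real N) \<le> 1" by (subst pos_divide_le_eq) auto
    then have "G (r * real N) \<le> 1"
      using assms powr_mono2[of "1 - b" "r * real N / (1 + r * real N)" 1] by (simp add: G_def)
    then show ?thesis by (simp add: G_def)
  qed
  finally show ?thesis using assms by (simp add: field_simps)
qed

text \<open>By \<open>1 + s \<le> exp s\<close>, and then \<open>q * s\<close> is split by
  completing a square. It lets Gaussians absorb any power of the frequency.\<close>

lemma one_plus_powr_le_exp_square:
  fixes s q t :: real
  assumes "s \<ge> 0" "q \<ge> 0" "t > 0"
  shows "(1 + s) powr q \<le> exp (q\<^sup>2 / (2 * t)) * exp (s\<^sup>2 * t / 2)"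
proof -
  have "(1 + s) powr q \<le> exp s powr q" using assms exp_ge_add_one_self[of s] by (intro powr_mono2) auto
  also have "\<dots> = exp (q * s)" by (simp add: exp_powr_real mult.commute)
  also have "\<dots> \<le> exp (q\<^sup>2 / (2 * t) + s\<^sup>2 * t / 2)"
  proof -
    have "0 \<le> (q - t * s)\<^sup>2 / (2 * t)" using assms by simp
    also have "\<dots> = q\<^sup>2 / (2 * t) + s\<^sup>2 * t / 2 - q * s"
      using assms by (simp add: field_simps power2_eq_square)
    finally show ?thesis by simp
  qed
  finally show ?thesis by (simp add: exp_add)
qed

context bessel
begin

text \<open>The first factor is the amplitude from \<open>Phi_bound\<close> after normalisation, the
  square of \<open>psi_const n\<close> being at most of order \<open>lam n powr a\<close>. The
  second records the zero at 1: within distance \<open>1 / lam n\<close> of 1 the derivative bound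
  is integrated from the endpoint, and farther away the factor is bounded below.\<close>

lemma psi_bound:
  "\<exists>C>0. \<forall>n\<ge>1. \<forall>x. 0 < x \<longrightarrow> x \<le> 1 \<longrightarrow>
     (psi n x)\<^sup>2 \<le> C * (x + 1 / lam n) powr (- a) * ((1 - x) / (1 - x + 1 / lam n))\<^sup>2"
proof -
  obtain B where B: "B > 0" and B': "\<forall>z\<ge>0. (bessel_Phi \<nu> z)\<^sup>2 \<le> B * (1 + z) powr (- a)
      \<and> (z / 2 * bessel_Phi (\<nu> + 1) z)\<^sup>2 \<le> B * (1 + z) powr (- a)"
    using Phi_bound by blast
  obtain c where c: "c > 0" and c': "\<forall>n\<ge>1. c * lam n powr (- a) \<le> (lam n / 2 * bessel_Phi (\<nu> + 1) (lam n))\<^sup>2"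
    using flux_lam_lower by blast
  define K where "K = 2 / c * B"
  have K: "K > 0" using B c by (simp add: K_def)
  have cn2: "(psi_const n)\<^sup>2 \<le> 2 / c * lam n powr a" if n: "n \<ge> 1" for n
  proof -
    have "c * lam n powr (- a) > 0" using c lam_pos[OF n] by simp
    then have "2 / (lam n / 2 * bessel_Phi (\<nu> + 1) (lam n))\<^sup>2 \<le> 2 / (c * lam n powr (- a))"
      using c' n c lam_pos[OF n] flux_lam_nz[OF n] by (intro divide_left_mono mult_pos_pos) (auto intro: less_le_trans)
    then show ?thesis by (simp add: psi_const_def power_divide powr_minus divide_simps)
  qed
  have bound: "(psi_const n)\<^sup>2 * y \<le> K * (x + 1 / lam n) powr (- a)"
    if n: "n \<ge> 1" and x: "x > 0" and y: "y \<le> B * (1 + lam n * x) powr (- a)" for n x y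
  proof -
    have l: "lam n > 0" by (rule lam_pos) fact
    have "(psi_const n)\<^sup>2 * y \<le> (psi_const n)\<^sup>2 * (B * (1 + lam n * x) powr (- a))"
      by (intro mult_left_mono y) auto
    also have "\<dots> \<le> 2 / c * lam n powr a * (B * (1 + lam n * x) powr (- a))"
      using B by (intro mult_right_mono cn2 n) auto
    also have "1 + lam n * x = lam n * (x + 1 / lam n)" using l by (simp add: field_simps)
    also have "\<dots> powr (- a) = lam n powr (- a) * (x + 1 / lam n) powr (- a)"
      using l x by (simp add: powr_mult)
    also have "2 / c * lam n powr a * (B * (lam n powr (- a) * (x + 1 / lam n) powr (- a)))
        = K * (x + 1 / lam n) powr (- a) * (lam n powr a * lam n powr (- a))"
      by (simp add: K_def)
    also have "lam n powr a * lam n powr (- a) = 1" using l by (simp flip: powr_add)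
    finally show ?thesis by simp
  qed
  have b0: "(psi n x)\<^sup>2 \<le> K * (x + 1 / lam n) powr (- a)" if "n \<ge> 1" "x > 0" for n x
    unfolding psi_def power_mult_distrib
    by (rule bound) (use that B' lam_pos[of n] in auto)
  have b1: "(dpsi n x)\<^sup>2 \<le> (lam n)\<^sup>2 * (K * (x + 1 / lam n) powr (- a))" if "n \<ge> 1" "x > 0" for n x
  proof -
    have "dpsi n x = - (lam n * (psi_const n * (lam n * x / 2 * bessel_Phi (\<nu> + 1) (lam n * x))))"
      by (simp add: dpsi_def power2_eq_square)
    then have "(dpsi n x)\<^sup>2 = (lam n)\<^sup>2 * ((psi_const n)\<^sup>2 * (lam n * x / 2 * bessel_Phi (\<nu> + 1) (lam n * x))\<^sup>2)"
      by (simp only: power2_minus power_mult_distrib)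
    also have "\<dots> \<le> (lam n)\<^sup>2 * (K * (x + 1 / lam n) powr (- a))"
      by (intro mult_left_mono bound) (use that B' lam_pos[of n] in auto)
    finally show ?thesis .
  qed
  \<comment> \<open>For \<open>x \<le> 1 / 2\<close> the second factor is at least
    \<open>1 / w\<close>.\<close>
  define w where "w = 2 + 2 / lam 1"
  define M where "M = K * w\<^sup>2 + 4 * K * 2 powr \<bar>a\<bar>"
  have l1: "lam 1 > 0" by (rule lam_pos) simp
  have "(psi n x)\<^sup>2 \<le> M * (x + 1 / lam n) powr (- a) * ((1 - x) / (1 - x + 1 / lam n))\<^sup>2"
    if n: "n \<ge> 1" and x: "0 < x" "x \<le> 1" for n x
  proof -
    define A where "A = (x + 1 / lam n) powr (- a)"
    define R where "R = (1 - x) / (1 - x + 1 / lam n)"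
    have l: "lam n > 0" by (rule lam_pos) fact
    have A: "A \<ge> 0" by (simp add: A_def)
    have R: "R \<ge> 0" using x l by (simp add: R_def)
    have "(psi n x)\<^sup>2 \<le> (K * w\<^sup>2) * A * R\<^sup>2 \<or> (psi n x)\<^sup>2 \<le> (4 * K * 2 powr \<bar>a\<bar>) * A * R\<^sup>2"
    proof (cases "x \<le> 1 / 2")
      case True
      have "lam 1 \<le> lam n" using strict_mono_less_eq[OF strict_mono_lam] n by blast
      then have "1 / lam n \<le> 1 / lam 1" using l1 by (intro divide_left_mono) auto
      also have "\<dots> = 1 * (1 / lam 1)" by simp
      also have "\<dots> \<le> (2 * (1 - x)) * (1 / lam 1)" using True l1 by (intro mult_right_mono) auto
      finally have "1 / lam n \<le> 2 * (1 - x) * (1 / lam 1)" .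
      moreover have "(1 - x) * w = 2 * (1 - x) + 2 * (1 - x) * (1 / lam 1)"
        by (simp add: w_def distrib_left)
      moreover have "1 - x \<le> 2 * (1 - x)" using True by simp
      ultimately have "1 - x + 1 / lam n \<le> (1 - x) * w" by simp
      moreover have "1 - x + 1 / lam n > 0" using x l by (intro add_nonneg_pos) auto
      ultimately have "1 \<le> R * w" by (simp add: R_def le_divide_eq)
      then have "1\<^sup>2 \<le> (R * w)\<^sup>2" by (intro power_mono) auto
      then have "K * A * 1 \<le> K * A * (R * w)\<^sup>2" using K A by (intro mult_left_mono) auto
      then show ?thesis using b0[OF n x(1)] by (simp add: A_def power_mult_distrib mult_ac)
    next
      case False
      \<comment> \<open>Mean value theorem from the zero at 1. The intermediate point and
        \<open>x\<close> both exceed 1/2, so the amplitudes there are comparable.\<close>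
      have D: "(psi n x)\<^sup>2 \<le> K * 2 powr \<bar>a\<bar> * A * (lam n * (1 - x))\<^sup>2"
      proof (cases "x = 1")
        case False
        then have "x < 1" using x by simp
        then have "\<exists>z>x. z < 1 \<and> psi n 1 - psi n x = (1 - x) * dpsi n z"
          by (rule MVT2) (auto intro: DERIV_psi)
        then obtain z where z: "x < z" "z < 1" "psi n 1 - psi n x = (1 - x) * dpsi n z" by blast
        have "(psi n x)\<^sup>2 = (1 - x)\<^sup>2 * (dpsi n z)\<^sup>2"
          using z(3) by (simp add: psi_1[OF n]) (metis power2_minus power_mult_distrib minus_minus)
        also have "\<dots> \<le> (1 - x)\<^sup>2 * ((lam n)\<^sup>2 * (K * (z + 1 / lam n) powr (- a)))"
          by (intro mult_left_mono b1[OF n]) (use z x in auto)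
        finally have 1: "(psi n x)\<^sup>2 \<le> (1 - x)\<^sup>2 * ((lam n)\<^sup>2 * (K * (z + 1 / lam n) powr (- a)))" .
        have 2: "(z + 1 / lam n) powr (- a) \<le> 2 powr \<bar>- a\<bar> * (x + 1 / lam n) powr (- a)"
        proof -
          define h where "h = 1 / lam n"
          have "h > 0" using l by (simp add: h_def)
          then show ?thesis using z(1,2) \<open>\<not> x \<le> 1 / 2\<close> unfolding h_def[symmetric]
            by (intro powr_comparable) auto
        qed
        have "(1 - x)\<^sup>2 * ((lam n)\<^sup>2 * (K * (z + 1 / lam n) powr (- a)))
            \<le> (1 - x)\<^sup>2 * ((lam n)\<^sup>2 * (K * (2 powr \<bar>- a\<bar> * (x + 1 / lam n) powr (- a))))"
          using K 2 by (intro mult_left_mono) auto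
        with 1 show ?thesis by (simp add: A_def power_mult_distrib mult_ac)
      qed (simp add: psi_1[OF n])
      show ?thesis
      proof (cases "lam n * (1 - x) \<le> 1")
        case True
        define S where "S = lam n * (1 - x)"
        have S: "0 \<le> S" "S \<le> 1" using True l x by (simp_all add: S_def)
        have "1 - x + 1 / lam n = (1 + S) / lam n" using l by (simp add: S_def field_simps)
        then have RS: "R = S / (1 + S)" using l by (simp add: R_def S_def mult.commute)
        have "S * (1 + S) \<le> S * 2" using S by (intro mult_left_mono) auto
        then have "S \<le> 2 * R" using S by (simp add: RS le_divide_eq mult.commute)
        then have "lam n * (1 - x) \<le> 2 * R" by (simp add: S_def)
        then have "(lam n * (1 - x))\<^sup>2 \<le> (2 * R)\<^sup>2" using l x by (intro power_mono) auto
        then have "K * 2 powr \<bar>a\<bar> * A * (lam n * (1 - x))\<^sup>2 \<le> K * 2 powr \<bar>a\<bar> * A * (2 * R)\<^sup>2"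
          using K A by (intro mult_left_mono) auto
        then show ?thesis using D by (simp add: power_mult_distrib mult_ac)
      next
        case False
        have "1 \<le> 2 * R" using False l x by (simp add: R_def field_simps)
        then have "1\<^sup>2 \<le> (2 * R)\<^sup>2" by (intro power_mono) auto
        then have "K * A * 1 \<le> K * A * (2 * R)\<^sup>2" using K A by (intro mult_left_mono) auto
        also have "\<dots> \<le> K * A * (2 * R)\<^sup>2 * 2 powr \<bar>a\<bar>"
          using K A ge_one_powr_ge_zero[of 2 "\<bar>a\<bar>"] by (intro mult_left_mono[of 1 "2 powr _", simplified]) auto
        finally show ?thesis using b0[OF n x(1)] by (simp add: A_def power_mult_distrib mult_ac)
      qed
    qed
    moreover have "0 \<le> (K * w\<^sup>2) * A * R\<^sup>2" "0 \<le> (4 * K * 2 powr \<bar>a\<bar>) * A * R\<^sup>2"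
      using K A by auto
    ultimately have "(psi n x)\<^sup>2 \<le> (K * w\<^sup>2) * A * R\<^sup>2 + (4 * K * 2 powr \<bar>a\<bar>) * A * R\<^sup>2" by linarith
    then show ?thesis by (simp add: M_def A_def R_def distrib_right)
  qed
  moreover have "M > 0" unfolding M_def using K by (intro add_nonneg_pos) auto
  ultimately show ?thesis by blast
qed

text \<open>There is no node before 1, and \<open>psi 1 x / (1 - x)\<close> extends continuously to
  1 by minus the derivative there, which is positive because the zero is simple. The extension
  attains a positive minimum.\<close>

lemma psi_1_lower: "\<exists>c>0. \<forall>x. 0 < x \<longrightarrow> x < 1 \<longrightarrow> c * (1 - x) \<le> psi 1 x"
proof -
  have l1: "lam 1 > 0" by (rule lam_pos) simp
  have c1: "psi_const 1 > 0" by (rule psi_const_pos) simp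
  have pos: "psi 1 x > 0" if "0 \<le> x" "x < 1" for x
  proof (rule ccontr)
    assume "\<not> psi 1 x > 0"
    moreover have "psi 1 0 > 0" using c1 nu by (simp add: psi_def bessel_Phi_0 Gamma_real_pos)
    ultimately obtain z where z: "0 \<le> z" "z \<le> x" "psi 1 z = 0"
      using IVT2'[of "psi 1" x 0 0] \<open>0 \<le> x\<close> continuous_on_psi[OF continuous_on_id] by auto
    then have "z > 0" using \<open>psi 1 0 > 0\<close> by (cases "z = 0") auto
    then show False using psi_nodes[of 1 z] z that l1 by auto
  qed
  define h where "h = (\<lambda>x. if x = 1 then - dpsi 1 1 else psi 1 x / (1 - x))"
  have lim: "((\<lambda>x. psi 1 x / (1 - x)) \<longlongrightarrow> - dpsi 1 1) (at 1 within {0..1})"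
  proof -
    have "((\<lambda>x. - ((psi 1 x - psi 1 1) / (x - 1))) \<longlongrightarrow> - dpsi 1 1) (at 1 within {0..1})"
      using DERIV_psi[of 1 1 "{0..1}"] by (intro tendsto_minus) (simp add: has_field_derivative_iff)
    moreover have "- ((psi 1 x - psi 1 1) / (x - 1)) = psi 1 x / (1 - x)" for x :: real
      by (cases "x = 1") (auto simp: psi_1 field_simps)
    ultimately show ?thesis by simp
  qed
  have ch: "continuous_on {0..1} h"
    unfolding continuous_on_def
  proof
    fix x :: real assume x: "x \<in> {0..1}"
    show "(h \<longlongrightarrow> h x) (at x within {0..1})"
    proof (cases "x = 1")
      case True
      have "(h \<longlongrightarrow> - dpsi 1 1) (at 1 within {0..1})"
        by (rule Lim_transform_eventually[OF lim]) (auto simp: h_def eventually_at_filter)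
      then show ?thesis using True by (simp add: h_def)
    next
      case False
      have "((\<lambda>x. psi 1 x / (1 - x)) \<longlongrightarrow> psi 1 x / (1 - x)) (at x within {0..1})"
        using False DERIV_continuous[OF DERIV_psi[of 1 x "{0..1}"]]
        by (intro tendsto_intros) (auto simp: continuous_within)
      moreover have "\<forall>\<^sub>F y in at x within {0..1}. psi 1 y / (1 - y) = h y"
        using eventually_neq_at_within[of 1 x "{0..1}"] by eventually_elim (simp add: h_def)
      ultimately show ?thesis using False Lim_transform_eventually by (force simp: h_def)
    qed
  qed
  have "- dpsi 1 1 \<ge> 0"
  proof (rule tendsto_lowerbound[OF lim])
    have "0 \<le> psi 1 x / (1 - x)" if "x \<noteq> 1" "x \<in> {0..1}" for x
      using pos[of x] that by auto
    then show "\<forall>\<^sub>F x in at 1 within {0..1}. 0 \<le> psi 1 x / (1 - x)"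
      unfolding eventually_at_filter by (intro always_eventually) blast
    show "at (1::real) within {0..1} \<noteq> bot"
      by (simp add: at_within_Icc_at_left)
  qed
  moreover have "dpsi 1 1 \<noteq> 0" by (rule dpsi_nz) (auto simp: psi_1)
  ultimately have hpos: "h x > 0" if "x \<in> {0..1}" for x
    using that pos by (auto simp: h_def)
  obtain m where m: "m \<in> {0..1}" "\<And>x. x \<in> {0..1} \<Longrightarrow> h m \<le> h x"
    using continuous_attains_inf[OF _ _ ch] by auto
  have "h m * (1 - x) \<le> psi 1 x" if "0 < x" "x < 1" for x
    using m(2)[of x] that by (simp add: h_def field_simps split: if_splits)
  then show ?thesis using hpos[OF m(1)] by blast
qed

text \<open>Models the \<open>eta\<close> measure of the interval of radius \<open>r\<close> around
  \<open>x\<close>: the density of \<open>eta\<close> is of order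
  \<open>y powr a * (1 - y)^2\<close>, and the shift of both factors by \<open>r\<close> accounts
  for the endpoints.\<close>

definition vol :: "real \<Rightarrow> real \<Rightarrow> real" where
  "vol x r = r * (x + r) powr a * (1 - x + r)\<^sup>2"

lemma vol_pos: "0 < x \<Longrightarrow> x < 1 \<Longrightarrow> r > 0 \<Longrightarrow> vol x r > 0"
  by (simp add: vol_def)

text \<open>The bound for \<open>\<psi>\<^sub>n\<^sup>2\<close> is \<open>(1 - x)\<^sup>2 / (\<lambda>\<^sub>n vol x (1 / \<lambda>\<^sub>n))\<close>; passing from the scale
  \<open>1 / \<lambda>\<^sub>n\<close> to the scale \<open>\<rho> = sqrt t\<close> costs powers of \<open>s = \<rho> \<lambda>\<^sub>n\<close>, which the Gaussian absorbs.\<close>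

lemma on_diagonal_bound:
  "\<exists>C>0. \<forall>t>0. \<forall>x. 0 < x \<longrightarrow> x < 1 \<longrightarrow> (\<forall>N. (\<Sum>n<N. exp (- (lam (Suc n))\<^sup>2 * t) * (psi (Suc n) x)\<^sup>2)
      \<le> C * (1 - x)\<^sup>2 / vol x (sqrt t))"
proof -
  obtain B where B: "B > 0" and B': "\<forall>n\<ge>1. \<forall>x. 0 < x \<longrightarrow> x \<le> 1 \<longrightarrow>
     (psi n x)\<^sup>2 \<le> B * (x + 1 / lam n) powr (- a) * ((1 - x) / (1 - x + 1 / lam n))\<^sup>2"
    using psi_bound by blast
  obtain d where d: "d > 0" "\<And>n. d * real n \<le> lam n" using lam_ge by blast
  \<comment> \<open>Depending on the sign of \<open>a\<close>, the change of scale costs either a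
    power \<open>m\<close> of \<open>1 + s\<close> or a power \<open>b\<close> of
    \<open>1 + 1 / s\<close>; \<open>b < 1\<close> keeps the sum over \<open>n\<close>
    bounded.\<close>
  define b m where "b = max 0 (- a)" and "m = max 0 a"
  have b: "0 \<le> b" "b < 1" using a_gt by (auto simp: b_def)
  have m: "0 \<le> m" by (simp add: m_def)
  \<comment> \<open>\<open>m\<close> and \<open>b\<close> from the weight, 2 from the boundary
    factor, and 2 more to create the denominator \<open>(1 + s)^2\<close>.\<close>
  define q where "q = m + b + 4"
  \<comment> \<open>From \<open>one_plus_powr_le_exp_square\<close> at \<open>t = 2\<close>, where
    the Gaussian is \<open>exp (s^2)\<close> and cancels the heat factor.\<close>
  define E where "E = exp (q\<^sup>2 / (2 * 2))"
  define C where "C = B * E / (d * (1 - b))"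
  have "(\<Sum>n<N. exp (- (lam (Suc n))\<^sup>2 * t) * (psi (Suc n) x)\<^sup>2) \<le> C * (1 - x)\<^sup>2 / vol x (sqrt t)"
    if t: "t > 0" and x: "0 < x" "x < 1" for t x N
  proof -
    define \<rho> where "\<rho> = sqrt t"
    have \<rho>: "\<rho> > 0" using t by (simp add: \<rho>_def)
    define V where "V = (x + \<rho>) powr (- a) * ((1 - x) / (1 - x + \<rho>))\<^sup>2"
    have V: "V \<ge> 0" by (simp add: V_def)
    define r where "r = \<rho> * d"
    have r: "r > 0" using \<rho> d by (simp add: r_def)
    have term_le: "exp (- (lam (Suc n))\<^sup>2 * t) * (psi (Suc n) x)\<^sup>2
        \<le> B * E * V / r * (r * (r * real (Suc n)) powr (- b) / (1 + r * real (Suc n))\<^sup>2)" for n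
    proof -
      define l where "l = lam (Suc n)"
      have l: "l > 0" unfolding l_def by (rule lam_pos) simp
      define s where "s = \<rho> * l"
      have s: "s > 0" using l \<rho> by (simp add: s_def)
      have s_ge: "s \<ge> r * real (Suc n)"
        using mult_left_mono[OF d(2)[of "Suc n"], of \<rho>] \<rho> by (simp add: s_def r_def l_def mult.assoc)
      have rho_l: "\<rho> = s / l" "1 / l = \<rho> / s" using l \<rho> by (simp_all add: s_def)
      have 1: "(x + 1 / l) powr (- a) \<le> (x + \<rho>) powr (- a) * ((1 + s) powr m * (1 + 1 / s) powr b)"
      proof (cases "a \<ge> 0")
        case True
        have "x + \<rho> \<le> (1 + s) * (x + 1 / l)"
        proof -
          have "0 \<le> s * x + 1 / l" using x s l by simp
          then show ?thesis using l by (simp add: rho_l(1) algebra_simps add_divide_distrib)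
        qed
        then have "((1 + s) * (x + 1 / l)) powr (- a) \<le> (x + \<rho>) powr (- a)"
          using True x \<rho> by (intro powr_mono2') auto
        then have "(1 + s) powr a * ((1 + s) * (x + 1 / l)) powr (- a) \<le> (1 + s) powr a * (x + \<rho>) powr (- a)"
          by (intro mult_left_mono) auto
        moreover have "(1 + s) powr a * ((1 + s) * (x + 1 / l)) powr (- a)
            = ((1 + s) powr a * (1 + s) powr (- a)) * (x + 1 / l) powr (- a)"
          using s x l by (simp add: powr_mult)
        moreover have "(1 + s) powr a * (1 + s) powr (- a) = 1" using s by (simp flip: powr_add)
        moreover have "1 + 1 / s \<noteq> 0" using s add_pos_pos[of 1 "1 / s"] by simp
        ultimately show ?thesis using True s by (simp add: b_def m_def mult.commute)
      next
        case False
        have "x + 1 / l \<le> (1 + 1 / s) * (x + \<rho>)"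
          using x s \<rho> unfolding rho_l(2) by (simp add: distrib_left distrib_right)
        then have "(x + 1 / l) powr (- a) \<le> ((1 + 1 / s) * (x + \<rho>)) powr (- a)"
          using False x l by (intro powr_mono2) auto
        also have "\<dots> = (1 + 1 / s) powr (- a) * (x + \<rho>) powr (- a)"
          using s x \<rho> by (simp add: powr_mult)
        finally show ?thesis using False s by (simp add: b_def m_def mult.commute)
      qed
      have 2: "((1 - x) / (1 - x + 1 / l))\<^sup>2 \<le> ((1 - x) / (1 - x + \<rho>))\<^sup>2 * (1 + s)\<^sup>2"
      proof -
        have "1 - x + \<rho> \<le> (1 + s) * (1 - x + 1 / l)"
        proof -
          have "0 \<le> s * (1 - x) + 1 / l" using x s l by auto
          then show ?thesis using l by (simp add: rho_l(1) algebra_simps add_divide_distrib)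
        qed
        then have "(1 - x) / (1 - x + 1 / l) \<le> (1 - x) / (1 - x + \<rho>) * (1 + s)"
        proof -
          assume *: "1 - x + \<rho> \<le> (1 + s) * (1 - x + 1 / l)"
          have p: "1 - x + \<rho> > 0" "1 - x + 1 / l > 0" using x \<rho> l by (auto intro: add_pos_pos)
          have "(1 - x) * (1 - x + \<rho>) \<le> (1 - x) * ((1 + s) * (1 - x + 1 / l))"
            using * x by (intro mult_left_mono) auto
          then show ?thesis using p by (simp add: divide_le_eq le_divide_eq mult_ac)
        qed
        then show ?thesis unfolding power_mult_distrib[symmetric]
          using x l by (intro power_mono divide_nonneg_nonneg) auto
      qed
      have 3: "exp (- s\<^sup>2) * ((1 + s) powr m * (1 + 1 / s) powr b * (1 + s)\<^sup>2)
          \<le> E * (s powr (- b) / (1 + s)\<^sup>2)"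
      proof -
        have "1 + 1 / s = (1 + s) / s" using s by (simp add: field_simps)
        then have e1: "(1 + 1 / s) powr b = (1 + s) powr b * s powr (- b)"
          using s by (simp add: powr_divide powr_minus field_simps)
        have e2: "(1 + s) powr q = (1 + s) powr m * (1 + s) powr b * ((1 + s)\<^sup>2 * (1 + s)\<^sup>2)"
          using s powr_realpow[of "1 + s" 4] unfolding q_def powr_add by (simp flip: power_add)
        have aux: "X * (Y * S) * D = X * Y * (D * D) * (S / D)" if "D \<noteq> 0" for X Y S D :: real
          using that by simp
        have "(1 + s) powr m * (1 + 1 / s) powr b * (1 + s)\<^sup>2
            = (1 + s) powr q * (s powr (- b) / (1 + s)\<^sup>2)"
          unfolding e1 e2 using s by (intro aux) simp
        also have "\<dots> \<le> (E * exp (s\<^sup>2 * 2 / 2)) * (s powr (- b) / (1 + s)\<^sup>2)"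
          unfolding E_def using s b m
          by (intro mult_right_mono one_plus_powr_le_exp_square) (auto simp: q_def)
        finally have "exp (- s\<^sup>2) * ((1 + s) powr m * (1 + 1 / s) powr b * (1 + s)\<^sup>2)
            \<le> exp (- s\<^sup>2) * ((E * exp (s\<^sup>2 * 2 / 2)) * (s powr (- b) / (1 + s)\<^sup>2))"
          by (intro mult_left_mono) auto
        also have "\<dots> = (exp (- s\<^sup>2) * exp (s\<^sup>2)) * (E * (s powr (- b) / (1 + s)\<^sup>2))"
          by (simp add: mult_ac)
        also have "exp (- s\<^sup>2) * exp (s\<^sup>2) = 1" by (simp flip: exp_add)
        finally show ?thesis by simp
      qed
      have 4: "s powr (- b) / (1 + s)\<^sup>2 \<le> (r * real (Suc n)) powr (- b) / (1 + r * real (Suc n))\<^sup>2"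
      proof -
        define u where "u = r * real (Suc n)"
        have "u > 0" "u \<le> s" using r s_ge by (auto simp: u_def)
        then show ?thesis unfolding u_def[symmetric]
          using b by (intro frac_le powr_mono2' power_mono) auto
      qed
      have "exp (- l\<^sup>2 * t) * (psi (Suc n) x)\<^sup>2
          \<le> exp (- s\<^sup>2) * (B * (x + 1 / l) powr (- a) * ((1 - x) / (1 - x + 1 / l))\<^sup>2)"
      proof -
        have "l\<^sup>2 * t = s\<^sup>2" using t by (simp add: s_def \<rho>_def power_mult_distrib)
        then show ?thesis using B' x unfolding l_def by (intro mult_mono) auto
      qed
      also have "\<dots> \<le> exp (- s\<^sup>2) * (B * ((x + \<rho>) powr (- a) * ((1 + s) powr m * (1 + 1 / s) powr b))
            * (((1 - x) / (1 - x + \<rho>))\<^sup>2 * (1 + s)\<^sup>2))"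
        using B by (intro mult_left_mono mult_mono 1 2) auto
      also have "\<dots> = B * V * (exp (- s\<^sup>2) * ((1 + s) powr m * (1 + 1 / s) powr b * (1 + s)\<^sup>2))"
        by (simp add: V_def mult_ac)
      also have "\<dots> \<le> B * V * (E * ((r * real (Suc n)) powr (- b) / (1 + r * real (Suc n))\<^sup>2))"
        using B V by (intro mult_left_mono order_trans[OF 3] 4) (auto simp: E_def)
      also have "\<dots> = B * E * V / r * (r * (r * real (Suc n)) powr (- b) / (1 + r * real (Suc n))\<^sup>2)"
        using r by simp
      finally show ?thesis by (simp add: l_def)
    qed
    have "(\<Sum>n<N. exp (- (lam (Suc n))\<^sup>2 * t) * (psi (Suc n) x)\<^sup>2)
        \<le> (\<Sum>n<N. B * E * V / r * (r * (r * real (Suc n)) powr (- b) / (1 + r * real (Suc n))\<^sup>2))"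
      by (intro sum_mono term_le)
    also have "\<dots> \<le> B * E * V / r * (1 / (1 - b))"
      unfolding sum_distrib_left[symmetric] using B V r b
      by (intro mult_left_mono sum_weight_bound) (auto simp: E_def)
    also have "\<dots> = C * (1 - x)\<^sup>2 / vol x (sqrt t)"
      using \<rho> x d unfolding vol_def \<rho>_def[symmetric]
      by (simp add: C_def V_def r_def powr_minus power_divide divide_simps)
    finally show ?thesis .
  qed
  moreover have "C > 0" using B d b by (simp add: C_def E_def)
  ultimately show ?thesis by blast
qed

section \<open>Weighted energy estimates\<close>

text \<open>A partial sum of the flow started from \<open>g\<close>. The truncation \<open>N\<close>
  stays finite so that time derivatives, sums and integrals commute; it is removed only in the
  passage to the kernel.\<close>

definition heat_sum :: "(real \<Rightarrow> real) \<Rightarrow> nat \<Rightarrow> real \<Rightarrow> real \<Rightarrow> real" where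
  "heat_sum g N t y = (\<Sum>n<N. exp (- (lam (Suc n))\<^sup>2 * t) * coef g (Suc n) * psi (Suc n) y)"

lemma continuous_on_heat_sum [continuous_intros]: "continuous_on S f \<Longrightarrow> continuous_on S (\<lambda>y. heat_sum g N t (f y))"
  unfolding heat_sum_def by (intro continuous_intros)

lemma wint_double_sum:
  assumes "continuous_on {0..1} \<omega>"
  shows "wint (\<lambda>y. (\<Sum>i<N. c i * psi (Suc i) y) * (\<Sum>j<N. d j * psi (Suc j) y) * \<omega> y)
    = (\<Sum>i<N. \<Sum>j<N. c i * d j * wint (\<lambda>y. psi (Suc i) y * psi (Suc j) y * \<omega> y))"
proof -
  have "wint (\<lambda>y. (\<Sum>i<N. c i * psi (Suc i) y) * (\<Sum>j<N. d j * psi (Suc j) y) * \<omega> y)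
      = wint (\<lambda>y. \<Sum>i<N. \<Sum>j<N. c i * d j * (psi (Suc i) y * psi (Suc j) y * \<omega> y))"
    by (subst sum_product, subst sum_distrib_right, subst sum_distrib_right) (simp add: mult_ac)
  also have "\<dots> = (\<Sum>i<N. wint (\<lambda>y. \<Sum>j<N. c i * d j * (psi (Suc i) y * psi (Suc j) y * \<omega> y)))"
    by (intro wint_sum continuous_intros assms) auto
  also have "\<dots> = (\<Sum>i<N. \<Sum>j<N. c i * d j * wint (\<lambda>y. psi (Suc i) y * psi (Suc j) y * \<omega> y))"
    unfolding wint_cmult[symmetric] by (intro sum.cong refl wint_sum continuous_intros assms) auto
  finally show ?thesis .
qed

lemma wint_heat_sum_heat_sum:
  "wint (\<lambda>y. heat_sum g N t y * heat_sum h N t y)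
    = (\<Sum>n<N. exp (- (lam (Suc n))\<^sup>2 * (2 * t)) * coef g (Suc n) * coef h (Suc n))"
proof -
  have "wint (\<lambda>y. heat_sum g N t y * heat_sum h N t y * 1)
      = (\<Sum>i<N. \<Sum>j<N. (exp (- (lam (Suc i))\<^sup>2 * t) * coef g (Suc i)) * (exp (- (lam (Suc j))\<^sup>2 * t) * coef h (Suc j))
          * wint (\<lambda>y. psi (Suc i) y * psi (Suc j) y * 1))"
    unfolding heat_sum_def by (rule wint_double_sum) simp
  also have "\<dots> = (\<Sum>i<N. \<Sum>j<N. if j = i then exp (- (lam (Suc i))\<^sup>2 * (2 * t)) * coef g (Suc i) * coef h (Suc i) else 0)"
  proof (intro sum.cong refl)
    fix i j
    have "exp (- (lam (Suc i))\<^sup>2 * t) * exp (- (lam (Suc i))\<^sup>2 * t) = exp (- (lam (Suc i))\<^sup>2 * (2 * t))"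
      by (simp flip: exp_add)
    then show "(exp (- (lam (Suc i))\<^sup>2 * t) * coef g (Suc i)) * (exp (- (lam (Suc j))\<^sup>2 * t) * coef h (Suc j))
          * wint (\<lambda>y. psi (Suc i) y * psi (Suc j) y * 1)
        = (if j = i then exp (- (lam (Suc i))\<^sup>2 * (2 * t)) * coef g (Suc i) * coef h (Suc i) else 0)"
      using psi_orthogonal[of "Suc j" "Suc i"] psi_normalized[of "Suc i"] 
      by (auto simp flip: power2_eq_square)
  qed
  also have "\<dots> = (\<Sum>n<N. exp (- (lam (Suc n))\<^sup>2 * (2 * t)) * coef g (Suc n) * coef h (Suc n))"
    by simp
  finally show ?thesis by simp
qed

definition moment :: "(real \<Rightarrow> real) \<Rightarrow> nat \<Rightarrow> real \<Rightarrow> nat \<Rightarrow> real \<Rightarrow> real" where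
  "moment g N x k t = wint (\<lambda>y. (heat_sum g N t y)\<^sup>2 * (y - x) ^ (2 * k))"

lemma moment_nonneg: "moment g N x k t \<ge> 0"
  unfolding moment_def by (intro wint_nonneg continuous_intros) auto

text \<open>With \<open>u\<close> the flow and \<open>e = y - x\<close>, the derivative is -2 times
  the integral of \<open>u' (u e^(2k))'\<close>; the Dirichlet condition at 1 removes the boundary
  term. Completing the square,
  \<open>- u' (u e^(2k))' = e^(2k-2) (k^2 u^2 - (u' e + k u)^2)\<close>, and the negative square is
  dropped.\<close>

lemma DERIV_moment:
  assumes k: "k \<ge> 1"
  shows "\<exists>D. (moment g N x k has_real_derivative D) (at t) \<and> D \<le> 2 * (real k)\<^sup>2 * moment g N x (k - 1) t"
proof -
  define \<omega> where "\<omega> = (\<lambda>y::real. (y - x) ^ (2 * k))"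
  define E where "E = (\<lambda>i t. exp (- (lam (Suc i))\<^sup>2 * t) * coef g (Suc i))"
  define M where "M = (\<lambda>i j. wint (\<lambda>y. psi (Suc i) y * psi (Suc j) y * \<omega> y))"
  have c\<omega>: "continuous_on {0..1} \<omega>" unfolding \<omega>_def by (intro continuous_intros)
  have heat_sum_E: "heat_sum g N t y = (\<Sum>i<N. E i t * psi (Suc i) y)" for t y
    by (simp add: heat_sum_def E_def)
  have mom: "moment g N x k t = (\<Sum>i<N. \<Sum>j<N. E i t * E j t * M i j)" for t
    using wint_double_sum[OF c\<omega>, of "\<lambda>i. E i t" N "\<lambda>i. E i t"]
    by (simp add: moment_def heat_sum_E M_def \<omega>_def power2_eq_square)
  have dE: "(E i has_real_derivative - (lam (Suc i))\<^sup>2 * E i t) (at t)" for i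
    unfolding E_def by (auto intro!: derivative_eq_intros)
  define D where "D = (\<Sum>i<N. \<Sum>j<N. (- (lam (Suc i))\<^sup>2 * E i t * E j t + - (lam (Suc j))\<^sup>2 * E j t * E i t) * M i j)"
  have DM: "(moment g N x k has_real_derivative D) (at t)"
  proof -
    have "((\<lambda>t. \<Sum>i<N. \<Sum>j<N. E i t * E j t * M i j) has_real_derivative D) (at t)"
      unfolding D_def
      by (intro DERIV_sum DERIV_cmult_right DERIV_mult[OF dE dE])
    then show ?thesis by (simp add: mom[abs_def])
  qed
  define f where "f = (\<lambda>y. heat_sum g N t y * \<omega> y)"
  define hy where "hy = (\<lambda>y. \<Sum>i<N. E i t * dpsi (Suc i) y)"
  define f' where "f' = (\<lambda>y. hy y * \<omega> y + heat_sum g N t y * (real (2 * k) * (y - x) ^ (2 * k - 1)))"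
  have cf: "continuous_on {0..1} f" "continuous_on {0..1} f'" "continuous_on {0..1} hy"
    unfolding f_def f'_def hy_def by (intro continuous_intros c\<omega>)+
  have df: "(f has_real_derivative f' y) (at y)" for y
    unfolding f_def f'_def heat_sum_E hy_def \<omega>_def
    by (auto intro!: derivative_eq_intros DERIV_psi simp: sum_distrib_left sum.distrib distrib_left mult_ac)
  have f1: "f 1 = 0" by (simp add: f_def heat_sum_def psi_1)
  have "D = 2 * (\<Sum>i<N. \<Sum>j<N. - (lam (Suc i))\<^sup>2 * E i t * E j t * M i j)"
  proof -
    have "(\<Sum>i<N. \<Sum>j<N. - (lam (Suc j))\<^sup>2 * E j t * E i t * M i j)
        = (\<Sum>i<N. \<Sum>j<N. - (lam (Suc i))\<^sup>2 * E i t * E j t * M i j)"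
      by (subst sum.swap) (simp add: M_def mult_ac)
    then show ?thesis unfolding D_def distrib_right sum.distrib by simp
  qed
  also have "(\<Sum>i<N. \<Sum>j<N. - (lam (Suc i))\<^sup>2 * E i t * E j t * M i j)
      = (\<Sum>i<N. - E i t * ((lam (Suc i))\<^sup>2 * wint (\<lambda>y. psi (Suc i) y * f y)))"
  proof (rule sum.cong[OF refl])
    fix i
    have "wint (\<lambda>y. psi (Suc i) y * f y) = wint (\<lambda>y. \<Sum>j<N. E j t * (psi (Suc i) y * psi (Suc j) y * \<omega> y))"
      by (intro wint_cong) (simp add: f_def heat_sum_E sum_distrib_left sum_distrib_right mult_ac)
    also have "\<dots> = (\<Sum>j<N. E j t * M i j)"
      unfolding M_def wint_cmult[symmetric] by (intro wint_sum continuous_intros c\<omega>) auto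
    finally show "(\<Sum>j<N. - (lam (Suc i))\<^sup>2 * E i t * E j t * M i j)
        = - E i t * ((lam (Suc i))\<^sup>2 * wint (\<lambda>y. psi (Suc i) y * f y))"
      by (simp add: sum_distrib_left mult_ac sum_negf)
  qed
  also have "\<dots> = (\<Sum>i<N. - E i t * wint (\<lambda>y. dpsi (Suc i) y * f' y))"
    using wint_green[OF df cf(1,2) f1] by simp
  also have "\<dots> = - wint (\<lambda>y. hy y * f' y)"
  proof -
    have "wint (\<lambda>y. hy y * f' y) = wint (\<lambda>y. \<Sum>i<N. E i t * (dpsi (Suc i) y * f' y))"
      unfolding hy_def sum_distrib_right by (intro wint_cong) (simp add: mult.assoc)
    also have "\<dots> = (\<Sum>i<N. E i t * wint (\<lambda>y. dpsi (Suc i) y * f' y))"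
      unfolding wint_cmult[symmetric] by (intro wint_sum continuous_intros cf) auto
    finally show ?thesis by (simp add: sum_negf)
  qed
  also have "- wint (\<lambda>y. hy y * f' y) \<le> (real k)\<^sup>2 * moment g N x (k - 1) t"
  proof -
    have "wint (\<lambda>y. - (hy y * f' y)) \<le> wint (\<lambda>y. (real k)\<^sup>2 * ((heat_sum g N t y)\<^sup>2 * (y - x) ^ (2 * (k - 1))))"
    proof (intro wint_mono continuous_intros cf)
      fix y :: real
      define e where "e = y - x"
      obtain m where m: "k = Suc m" using k by (cases k) auto
      have p: "e ^ (2 * k) = e ^ (2 * m) * e\<^sup>2" "e ^ (2 * k - 1) = e ^ (2 * m) * e"
        by (simp_all add: m power2_eq_square)
      have "0 \<le> e ^ (2 * m) * (hy y * e + real k * heat_sum g N t y)\<^sup>2"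
        by (simp add: power_mult)
      also have "\<dots> = hy y * f' y + (real k)\<^sup>2 * ((heat_sum g N t y)\<^sup>2 * e ^ (2 * m))"
        unfolding f'_def \<omega>_def e_def[symmetric] p by (simp add: power2_eq_square algebra_simps)
      finally show "- (hy y * f' y) \<le> (real k)\<^sup>2 * ((heat_sum g N t y)\<^sup>2 * (y - x) ^ (2 * (k - 1)))"
        by (simp add: m e_def)
    qed
    moreover have "wint (\<lambda>y. - (hy y * f' y)) = - wint (\<lambda>y. hy y * f' y)"
      using wint_cmult[of "-1" "\<lambda>y. hy y * f' y"] by simp
    ultimately show ?thesis by (simp add: moment_def wint_cmult)
  qed
  finally show ?thesis using DM by (intro exI[of _ D]) auto
qed

text \<open>Where \<open>(y - x)^2 \<le> M\<close>, the lower power is at most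
  \<open>M ^ (k - 1)\<close>; elsewhere a further factor \<open>(y - x)^2 / M\<close> only enlarges
  it. This closes the differential inequality in terms of the moments of order \<open>k\<close> and
  0.\<close>

lemma moment_step:
  assumes "k \<ge> 1" "M > 0"
  shows "moment g N x (k - 1) t \<le> moment g N x k t / M + M ^ (k - 1) * moment g N x 0 t"
proof -
  obtain m where m: "k = Suc m" using assms by (cases k) auto
  have "moment g N x (k - 1) t
      \<le> wint (\<lambda>y. (1 / M) * ((heat_sum g N t y)\<^sup>2 * (y - x) ^ (2 * k)) + M ^ m * (heat_sum g N t y)\<^sup>2)"
    unfolding moment_def
  proof (intro wint_mono continuous_intros)
    fix y :: real
    define e where "e = (y - x)\<^sup>2"
    have e: "e \<ge> 0" by (simp add: e_def)
    have "e ^ m \<le> (1 / M) * e ^ Suc m + M ^ m"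
    proof (cases "e \<le> M")
      case True
      then have "e ^ m \<le> M ^ m" using e by (intro power_mono) auto
      then show ?thesis using e assms by (simp add: add_increasing)
    next
      case False
      have "e ^ m * 1 \<le> e ^ m * (e / M)" using False assms e by (intro mult_left_mono) auto
      then show ?thesis using assms by (simp add: mult.commute add_increasing2)
    qed
    then have "(heat_sum g N t y)\<^sup>2 * e ^ m \<le> (heat_sum g N t y)\<^sup>2 * ((1 / M) * e ^ Suc m + M ^ m)"
      by (intro mult_left_mono) auto
    then show "(heat_sum g N t y)\<^sup>2 * (y - x) ^ (2 * (k - 1))
        \<le> (1 / M) * ((heat_sum g N t y)\<^sup>2 * (y - x) ^ (2 * k)) + M ^ m * (heat_sum g N t y)\<^sup>2"
      unfolding power_mult e_def[symmetric] m by (simp add: algebra_simps)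
  qed
  also have "\<dots> = 1 / M * moment g N x k t + M ^ m * moment g N x 0 t"
    by (subst wint_add, (intro continuous_intros)+) (simp only: moment_def wint_cmult mult_0_right power_0 mult_1_right)
  finally show ?thesis by (simp add: m)
qed

text \<open>With \<open>M = 2 k\<^sup>2 (t + \<sigma>)\<close> in the previous lemma, \<open>moment / (t + \<sigma>)\<close> grows at most at the rate
  of \<open>(t + \<sigma>)\<^bsup>k-2\<^esup>\<close> times the \<open>L\<^sup>2\<close> norm squared, which is controlled by \<open>B\<close> before time \<open>\<sigma>\<close> and
  by \<open>D\<close> afterwards.\<close>

lemma moment_bound:
  assumes k: "k \<ge> 2" and \<sigma>: "\<sigma> > 0" "\<sigma> \<le> T" and B: "B \<ge> 0"
    and early: "\<And>t. 0 \<le> t \<Longrightarrow> moment g N x 0 t \<le> B"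
    and late: "\<And>t. \<sigma> \<le> t \<Longrightarrow> t \<le> T \<Longrightarrow> (t + \<sigma>) ^ (k - 2) * moment g N x 0 t \<le> D"
  shows "moment g N x k T \<le> (T + \<sigma>) * (moment g N x k 0 / \<sigma>
     + (2 * (real k)\<^sup>2) ^ k * (\<sigma> * (2 * \<sigma>) ^ (k - 2) * B + T * D))"
proof -
  define F where "F = moment g N x k"
  define A where "A = (2 * (real k)\<^sup>2) ^ k"
  define H where "H = (\<lambda>t. F t / (t + \<sigma>))"
  have A: "A \<ge> 0" by (simp add: A_def)
  have k1: "k - 1 = Suc (k - 2)" using k by simp
  have DH: "\<exists>y. (H has_real_derivative y) (at t) \<and> y \<le> A * ((t + \<sigma>) ^ (k - 2) * moment g N x 0 t)" if t: "t \<ge> 0" for t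
  proof -
    define s where "s = t + \<sigma>"
    have s: "s > 0" using t \<sigma> by (simp add: s_def)
    have "k \<ge> 1" using k by simp
    then obtain d where d: "(F has_real_derivative d) (at t)" "d \<le> 2 * (real k)\<^sup>2 * moment g N x (k - 1) t"
      using DERIV_moment unfolding F_def by blast
    \<comment> \<open>Makes the coefficient of \<open>F t\<close> equal to \<open>1 / s\<close>,
      which is exactly what differentiating the quotient \<open>F t / s\<close> cancels.\<close>
    define M where "M = 2 * (real k)\<^sup>2 * s"
    have M: "M > 0" using s k by (simp add: M_def)
    have "d \<le> 2 * (real k)\<^sup>2 * (F t / M + M ^ (k - 1) * moment g N x 0 t)"
      unfolding F_def using moment_step[OF \<open>k \<ge> 1\<close> M]
      by (intro order_trans[OF d(2)] mult_left_mono) auto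
    also have "\<dots> = F t / s + A * (s ^ (k - 1) * moment g N x 0 t)"
    proof -
      have "A = 2 * (real k)\<^sup>2 * (2 * (real k)\<^sup>2) ^ (k - 1)"
        unfolding A_def power_Suc[symmetric] using k by simp
      then show ?thesis using s k by (simp add: M_def power_mult_distrib distrib_left)
    qed
    finally have d': "d \<le> F t / s + A * (s ^ (k - 1) * moment g N x 0 t)" .
    have "(H has_real_derivative (d * s - F t) / (s * s)) (at t)"
      unfolding H_def s_def using s by (auto intro!: derivative_eq_intros d(1) simp: s_def)
    moreover have "(d * s - F t) / (s * s) \<le> A * (s ^ (k - 2) * moment g N x 0 t)"
    proof -
      have "(d * s - F t) / (s * s) = (d - F t / s) / s" using s by (simp add: field_simps)
      also have "\<dots> \<le> (A * (s ^ (k - 1) * moment g N x 0 t)) / s"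
        using d' s by (intro divide_right_mono) auto
      also have "s ^ (k - 1) = s ^ (k - 2) * s" unfolding k1 by simp
      finally show ?thesis using s by simp
    qed
    ultimately show ?thesis unfolding s_def by blast
  qed
  have lin: "H v - H u \<le> (v - u) * L" if "0 \<le> u" "u \<le> v"
    and "\<And>t. u \<le> t \<Longrightarrow> t \<le> v \<Longrightarrow> A * ((t + \<sigma>) ^ (k - 2) * moment g N x 0 t) \<le> L" for u v L
  proof -
    have "H v - v * L \<le> H u - u * L"
    proof (rule DERIV_nonpos_imp_nonincreasing[OF that(2)])
      fix t assume t: "u \<le> t" "t \<le> v"
      then obtain y where y: "(H has_real_derivative y) (at t)" "y \<le> A * ((t + \<sigma>) ^ (k - 2) * moment g N x 0 t)"
        using DH[of t] \<open>0 \<le> u\<close> by auto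
      have "((\<lambda>t. H t - t * L) has_real_derivative y - L) (at t)"
        by (auto intro!: derivative_eq_intros y(1))
      then show "\<exists>y. ((\<lambda>t. H t - t * L) has_real_derivative y) (at t) \<and> y \<le> 0"
        using y(2) that(3)[OF t] by auto
    qed
    then show ?thesis by (simp add: algebra_simps)
  qed
  have "H \<sigma> - H 0 \<le> (\<sigma> - 0) * (A * ((2 * \<sigma>) ^ (k - 2) * B))"
  proof (rule lin)
    fix t assume t: "0 \<le> t" "t \<le> \<sigma>"
    have "(t + \<sigma>) ^ (k - 2) \<le> (2 * \<sigma>) ^ (k - 2)" using t \<sigma> by (intro power_mono) auto
    then show "A * ((t + \<sigma>) ^ (k - 2) * moment g N x 0 t) \<le> A * ((2 * \<sigma>) ^ (k - 2) * B)"
      using A early[OF t(1)] \<sigma> B by (intro mult_left_mono mult_mono moment_nonneg) auto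
  qed (use \<sigma> in auto)
  moreover have "H T - H \<sigma> \<le> (T - \<sigma>) * (A * D)"
    by (rule lin[OF _ \<sigma>(2)]) (use \<sigma> in simp, rule mult_left_mono[OF late A])
  moreover have "(T - \<sigma>) * (A * D) \<le> T * (A * D)"
  proof -
    have "0 \<le> (T + \<sigma>) ^ (k - 2) * moment g N x 0 T" using \<sigma> moment_nonneg by simp
    then have "0 \<le> D" using late[of T] \<sigma> by simp
    then show ?thesis using A \<sigma> by (intro mult_right_mono) auto
  qed
  ultimately have "H T \<le> H 0 + \<sigma> * (A * ((2 * \<sigma>) ^ (k - 2) * B)) + T * (A * D)" by simp
  then have "F T \<le> (T + \<sigma>) * (H 0 + \<sigma> * (A * ((2 * \<sigma>) ^ (k - 2) * B)) + T * (A * D))"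
    using \<sigma> by (simp add: H_def divide_le_eq mult.commute)
  also have "H 0 = moment g N x k 0 / \<sigma>" by (simp add: H_def F_def)
  finally show ?thesis by (simp add: F_def A_def algebra_simps)
qed

end

section \<open>Approximate identities and volume comparison\<close>

lemma DERIV_from_quadratic_remainder:
  fixes f :: "real \<Rightarrow> real"
  assumes "\<And>y. \<bar>f y - f x - D * (y - x)\<bar> \<le> C * (y - x)\<^sup>2"
  shows "(f has_real_derivative D) (at x within S)"
  unfolding has_field_derivative_iff
proof (rule LIM_zero_cancel, rule Lim_null_comparison)
  show "\<forall>\<^sub>F y in at x within S. norm ((f y - f x) / (y - x) - D) \<le> C * \<bar>y - x\<bar>"
    unfolding eventually_at_filter
  proof (intro always_eventually allI impI)
    fix y assume "y \<noteq> x"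
    then have "(f y - f x) / (y - x) - D = (f y - f x - D * (y - x)) / (y - x)"
      by (simp add: field_simps)
    then have "norm ((f y - f x) / (y - x) - D) \<le> C * (y - x)\<^sup>2 / \<bar>y - x\<bar>"
      using assms[of y] by (simp add: divide_right_mono)
    also have "C * (y - x)\<^sup>2 / \<bar>y - x\<bar> = C * (\<bar>y - x\<bar> * \<bar>y - x\<bar>) / \<bar>y - x\<bar>"
      unfolding power2_eq_square abs_mult_self_eq ..
    also have "\<dots> = C * \<bar>y - x\<bar>" using \<open>y \<noteq> x\<close> by (simp del: abs_mult_self_eq)
    finally show "norm ((f y - f x) / (y - x) - D) \<le> C * \<bar>y - x\<bar>" .
  qed
  show "((\<lambda>y. C * \<bar>y - x\<bar>) \<longlongrightarrow> 0) (at x within S)"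
    by (auto intro!: tendsto_eq_intros)
qed

text \<open>Gives bumps with an explicit continuous derivative, as the expansion theorem requires.
  In every combination of signs the remainder is at most \<open>(y - z)^2\<close>.\<close>

lemma DERIV_pos_part_square:
  "((\<lambda>z::real. (max 0 z)\<^sup>2) has_real_derivative 2 * max 0 z) (at z)"
proof (rule DERIV_from_quadratic_remainder[where C = 1])
  fix y :: real
  consider "y \<ge> 0" "z \<ge> 0" | "y < 0" "z < 0" | "y < 0" "z \<ge> 0" | "y \<ge> 0" "z < 0" by linarith
  then show "\<bar>(max 0 y)\<^sup>2 - (max 0 z)\<^sup>2 - 2 * max 0 z * (y - z)\<bar> \<le> 1 * (y - z)\<^sup>2"
  proof cases
    case 3
    have "y * z \<le> 0" using 3 by (simp add: mult_le_0_iff)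
    moreover have "0 \<le> z\<^sup>2" "0 \<le> y\<^sup>2" by simp_all
    ultimately have "0 \<le> z\<^sup>2 - 2 * (y * z)" "z\<^sup>2 - 2 * (y * z) \<le> (y - z)\<^sup>2"
      unfolding power2_diff by linarith+
    moreover have "(max 0 y)\<^sup>2 - (max 0 z)\<^sup>2 - 2 * max 0 z * (y - z) = z\<^sup>2 - 2 * (y * z)"
      using 3 by (simp add: power2_eq_square algebra_simps)
    ultimately show ?thesis by simp
  next
    case 4
    then have "y\<^sup>2 \<le> (y - z)\<^sup>2" by (intro power_mono) auto
    then show ?thesis using 4 by simp
  next
    case 1
    then have "(max 0 y)\<^sup>2 - (max 0 z)\<^sup>2 - 2 * max 0 z * (y - z) = (y - z)\<^sup>2"
      by (simp add: power2_eq_square algebra_simps)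
    then show ?thesis by simp
  qed auto
qed

context bessel
begin

text \<open>Uniform in \<open>x\<close> with polynomial growth in \<open>lam n\<close>: the majorant
  for passing to limits under the series.\<close>

lemma psi_crude:
  "\<exists>C>0. \<forall>n\<ge>1. \<forall>x. 0 < x \<longrightarrow> x \<le> 1 \<longrightarrow> (psi n x)\<^sup>2 \<le> C * (1 + lam n) powr \<bar>a\<bar>"
proof -
  obtain B where B: "B > 0" and B': "\<forall>n\<ge>1. \<forall>x. 0 < x \<longrightarrow> x \<le> 1 \<longrightarrow>
     (psi n x)\<^sup>2 \<le> B * (x + 1 / lam n) powr (- a) * ((1 - x) / (1 - x + 1 / lam n))\<^sup>2"
    using psi_bound by blast
  have l1: "lam 1 > 0" by (rule lam_pos) simp
  define w where "w = (1 + 1 / lam 1) powr \<bar>a\<bar>"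
  have w: "w \<ge> 1" unfolding w_def using l1 by (intro ge_one_powr_ge_zero) auto
  have "(psi n x)\<^sup>2 \<le> (B * w) * (1 + lam n) powr \<bar>a\<bar>" if n: "n \<ge> 1" and x: "0 < x" "x \<le> 1" for n x
  proof -
    have l: "lam n > 0" by (rule lam_pos) fact
    have "lam 1 \<le> lam n" using strict_mono_less_eq[OF strict_mono_lam] n by blast
    then have inv: "1 / lam n \<le> 1 / lam 1" using l1 by (intro divide_left_mono) auto
    have one: "(1 + lam n) powr \<bar>a\<bar> \<ge> 1" using l by (intro ge_one_powr_ge_zero) auto
    have "(x + 1 / lam n) powr (- a) \<le> w * (1 + lam n) powr \<bar>a\<bar>"
    proof (cases "a \<ge> 0")
      case True
      have "(x + 1 / lam n) powr (- a) \<le> (1 / lam n) powr (- a)"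
        using True x l by (intro powr_mono2') auto
      also have "\<dots> = lam n powr a" using l by (simp add: powr_minus powr_divide)
      also have "\<dots> \<le> (1 + lam n) powr a" using True l by (intro powr_mono2) auto
      also have "\<dots> \<le> w * (1 + lam n) powr a" using w mult_right_mono[of 1 w "(1 + lam n) powr a"] by simp
      finally show ?thesis using True by simp
    next
      case False
      have "(x + 1 / lam n) powr (- a) \<le> (1 + 1 / lam 1) powr (- a)"
        using False x l inv by (intro powr_mono2) auto
      then have "(x + 1 / lam n) powr (- a) \<le> w * 1" using False by (simp add: w_def)
      also have "\<dots> \<le> w * (1 + lam n) powr \<bar>a\<bar>" using w one by (intro mult_left_mono) auto
      finally show ?thesis .
    qed
    moreover have "((1 - x) / (1 - x + 1 / lam n))\<^sup>2 \<le> 1"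
    proof -
      have "1 - x + 1 / lam n > 0" using x l by (intro add_nonneg_pos) auto
      then have "(1 - x) / (1 - x + 1 / lam n) \<le> 1" using l by simp
      then show ?thesis using x l by (intro power_le_one) auto
    qed
    ultimately have "B * (x + 1 / lam n) powr (- a) * ((1 - x) / (1 - x + 1 / lam n))\<^sup>2
        \<le> B * (w * (1 + lam n) powr \<bar>a\<bar>) * 1"
      using B w by (intro mult_mono mult_left_mono) auto
    then show ?thesis using B' n x by (fastforce simp: mult.assoc)
  qed
  then show ?thesis using B w by (intro exI[of _ "B * w"]) auto
qed

text \<open>Half of the exponent absorbs the power of \<open>1 + lam (Suc n)\<close>; the other half
  is dominated by a geometric series, since \<open>lam (Suc n) \<ge> d * (n + 1)\<close> and
  \<open>(n + 1)^2 \<ge> n\<close>.\<close>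

lemma summable_heat_weights:
  assumes "t > 0" "q \<ge> 0"
  shows "summable (\<lambda>n. exp (- (lam (Suc n))\<^sup>2 * t) * (1 + lam (Suc n)) powr q)"
proof -
  obtain d where d: "d > 0" "\<And>n. d * real n \<le> lam n" using lam_ge by blast
  define \<theta> where "\<theta> = exp (- (d\<^sup>2 * t / 2))"
  have \<theta>: "0 \<le> \<theta>" "\<theta> < 1" using d assms by (auto simp: \<theta>_def)
  have "exp (- (lam (Suc n))\<^sup>2 * t) * (1 + lam (Suc n)) powr q \<le> exp (q\<^sup>2 / (2 * t)) * \<theta> ^ n" for n
  proof -
    define l where "l = lam (Suc n)"
    have l: "l > 0" unfolding l_def by (rule lam_pos) simp
    have "exp (- l\<^sup>2 * t) * (1 + l) powr q \<le> exp (- l\<^sup>2 * t) * (exp (q\<^sup>2 / (2 * t)) * exp (l\<^sup>2 * t / 2))"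
      using l assms by (intro mult_left_mono one_plus_powr_le_exp_square) auto
    also have "\<dots> = exp (q\<^sup>2 / (2 * t)) * exp (- (l\<^sup>2 * t / 2))"
      by (simp flip: exp_add)
    also have "\<dots> \<le> exp (q\<^sup>2 / (2 * t)) * \<theta> ^ n"
    proof -
      have "real n * d\<^sup>2 \<le> (real (Suc n))\<^sup>2 * d\<^sup>2"
        using d(1) by (intro mult_right_mono) (auto simp: power2_eq_square algebra_simps)
      also have "\<dots> \<le> l\<^sup>2"
        using power_mono[OF d(2)[of "Suc n"], of 2] d(1) by (simp add: l_def power_mult_distrib mult.commute)
      finally have "real n * d\<^sup>2 * (t / 2) \<le> l\<^sup>2 * (t / 2)" using assms by (intro mult_right_mono) auto
      then show ?thesis unfolding \<theta>_def exp_of_nat_mult[symmetric] by simp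
    qed
    finally show ?thesis by (simp add: l_def)
  qed
  then have "norm (exp (- (lam (Suc n))\<^sup>2 * t) * (1 + lam (Suc n)) powr q) \<le> exp (q\<^sup>2 / (2 * t)) * \<theta> ^ n" for n
    by simp
  moreover have "summable (\<lambda>n. exp (q\<^sup>2 / (2 * t)) * \<theta> ^ n)"
    using \<theta> by (intro summable_mult summable_geometric) simp
  ultimately show ?thesis by (rule summable_comparison_test'[rotated])
qed

text \<open>The Dirichlet heat kernel with respect to \<open>x powr a dx\<close>, before division by
  the ground states.\<close>

definition dkern :: "real \<Rightarrow> real \<Rightarrow> real \<Rightarrow> real" where
  "dkern t x y = (\<Sum>n. exp (- (lam (Suc n))\<^sup>2 * t) * (psi (Suc n) x * psi (Suc n) y))"

text \<open>The square of the positive part of \<open>e^2 - (y - x)^2\<close> has height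
  \<open>e^4\<close> and mass at least of order \<open>e^5\<close>. The constant \<open>c\<close>
  depends on \<open>x\<close> through the weight; it enters only error terms that vanish with
  \<open>e\<close>.\<close>

lemma bump_exists:
  assumes x: "0 < x" "x < 1"
  shows "\<exists>c>0. \<forall>e. 0 < e \<longrightarrow> e \<le> x \<longrightarrow> e \<le> 1 - x \<longrightarrow> (\<exists>g g'.
     (\<forall>y. (g has_real_derivative g' y) (at y)) \<and> continuous_on UNIV g' \<and> (\<forall>y. 0 \<le> g y \<and> g y \<le> c / e)
     \<and> wint g = 1 \<and> (\<forall>y. e \<le> \<bar>y - x\<bar> \<longrightarrow> g y = 0))"
proof -
  \<comment> \<open>A lower bound for the weight at distance at most \<open>e / 2\<close> from
    \<open>x\<close>, times \<open>(3/4)^2\<close> from the bump there.\<close>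
  define w where "w = (x / 2) powr \<bar>a\<bar> * (9 / 16)"
  have w: "w > 0" using x by (simp add: w_def)
  have "\<exists>g g'.
     (\<forall>y. (g has_real_derivative g' y) (at y)) \<and> continuous_on UNIV g' \<and> (\<forall>y. 0 \<le> g y \<and> g y \<le> (1 / w) / e)
     \<and> wint g = 1 \<and> (\<forall>y. e \<le> \<bar>y - x\<bar> \<longrightarrow> g y = 0)" if e: "0 < e" "e \<le> x" "e \<le> 1 - x" for e
  proof -
    define h where "h = (\<lambda>y. (max 0 (e\<^sup>2 - (y - x)\<^sup>2))\<^sup>2)"
    define h' where "h' = (\<lambda>y. 2 * max 0 (e\<^sup>2 - (y - x)\<^sup>2) * (- 2 * (y - x)))"
    have dh: "(h has_real_derivative h' y) (at y)" for y
      unfolding h_def h'_def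
      by (rule DERIV_chain2[OF DERIV_pos_part_square]) (auto intro!: derivative_eq_intros)
    have ch': "continuous_on UNIV h'" unfolding h'_def by (intro continuous_intros)
    have ch: "continuous_on S h" for S unfolding h_def by (intro continuous_intros)
    have h0: "h y = 0" if "e \<le> \<bar>y - x\<bar>" for y
    proof -
      have "e\<^sup>2 \<le> \<bar>y - x\<bar>\<^sup>2" using that e by (intro power_mono) auto
      then show ?thesis by (simp add: h_def)
    qed
    have hle: "0 \<le> h y" "h y \<le> e ^ 4" for y
    proof -
      have "h y \<le> (e\<^sup>2)\<^sup>2" unfolding h_def by (intro power_mono) auto
      then show "h y \<le> e ^ 4" by (simp flip: power_mult)
    qed (simp add: h_def)
    define Z where "Z = wint h"
    have Z: "w * e ^ 5 \<le> Z"
    proof -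
      let ?I = "{x - e / 2..x + e / 2}"
      have sub: "?I \<subseteq> {0..1}" using e x by auto
      have int: "(\<lambda>y. y powr a * h y) integrable_on {0..1}" by (rule wint_integrable[OF ch])
      have "w * e ^ 5 = integral ?I (\<lambda>y. w * e ^ 4)"
        using e by (simp add: power_eq_if)
      also have "\<dots> \<le> integral ?I (\<lambda>y. y powr a * h y)"
      proof (rule integral_le)
        show "(\<lambda>y. y powr a * h y) integrable_on ?I"
          using integrable_on_subinterval[OF int sub] .
        fix y assume y: "y \<in> ?I"
        have y01: "x / 2 \<le> y" "0 < y" "y \<le> 1" using y e x by auto
        have "(x / 2) powr \<bar>a\<bar> \<le> y powr \<bar>a\<bar>" using y01 x by (intro powr_mono2) auto
        also have "\<dots> \<le> y powr a" using y01 by (intro powr_mono') auto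
        finally have 1: "(x / 2) powr \<bar>a\<bar> \<le> y powr a" .
        have "\<bar>y - x\<bar> \<le> e / 2" using y unfolding atLeastAtMost_iff by linarith
        then have "\<bar>y - x\<bar>\<^sup>2 \<le> (e / 2)\<^sup>2" by (intro power_mono) auto
        then have "3 / 4 * e\<^sup>2 \<le> e\<^sup>2 - (y - x)\<^sup>2" by (simp add: power_divide)
        then have "3 / 4 * e\<^sup>2 \<le> max 0 (e\<^sup>2 - (y - x)\<^sup>2)" by (rule max.coboundedI2)
        then have "(3 / 4 * e\<^sup>2)\<^sup>2 \<le> h y" unfolding h_def by (intro power_mono) auto
        then have 2: "9 / 16 * e ^ 4 \<le> h y" by (simp add: power_mult_distrib power_divide flip: power_mult)
        show "w * e ^ 4 \<le> y powr a * h y"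
          using mult_mono[OF 1 2] by (simp add: w_def mult.assoc)
      qed auto
      also have "\<dots> \<le> Z"
        unfolding Z_def wint_def
        by (rule integral_subset_le[OF sub integrable_on_subinterval[OF int sub] int])
           (use hle in auto)
      finally show ?thesis .
    qed
    have "w * e ^ 5 > 0" using w e by simp
    then have Zpos: "Z > 0" using Z by linarith
    show ?thesis
    proof (intro exI conjI allI impI)
      show "((\<lambda>y. h y / Z) has_real_derivative h' y / Z) (at y)" for y
        by (intro DERIV_cdivide dh)
      show "continuous_on UNIV (\<lambda>y. h' y / Z)" using Zpos by (intro continuous_intros ch') auto
      show "0 \<le> h y / Z" for y using hle Zpos by simp
      show "h y / Z \<le> 1 / w / e" for y
      proof -
        have "h y / Z \<le> e ^ 4 / (w * e ^ 5)"
          using hle[of y] Z Zpos w e by (intro frac_le) auto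
        also have "\<dots> = 1 / w / e" using e by (simp add: power_eq_if)
        finally show ?thesis .
      qed
      show "wint (\<lambda>y. h y / Z) = 1" using wint_cmult[of "1 / Z" h] Zpos by (simp add: Z_def)
      show "h y / Z = 0" if "e \<le> \<bar>y - x\<bar>" for y using h0[OF that] by simp
    qed
  qed
  then show ?thesis using w by (intro exI[of _ "1 / w"]) auto
qed

lemma bump_average_le:
  assumes "continuous_on {0..1} f" "continuous_on {0..1} g" "\<And>y. 0 \<le> g y" "wint g = 1"
    and "\<And>y. 0 < y \<Longrightarrow> y \<le> 1 \<Longrightarrow> g y \<noteq> 0 \<Longrightarrow> f y \<le> D"
  shows "wint (\<lambda>y. f y * g y) \<le> D"
proof -
  have "wint (\<lambda>y. f y * g y) \<le> wint (\<lambda>y. D * g y)"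
  proof (intro wint_mono continuous_intros assms(1,2))
    fix y :: real assume "0 < y" "y \<le> 1"
    then show "f y * g y \<le> D * g y" using assms(3)[of y] assms(5)[of y]
      by (cases "g y = 0") (auto intro: mult_right_mono)
  qed
  then show ?thesis using assms(4) by (simp add: wint_cmult)
qed

text \<open>The variance of \<open>psi n\<close> under the probability density \<open>g\<close> is
  nonnegative. Summed over \<open>n\<close>, this bounds the squared norm of the flow by an average
  of the kernel on the diagonal.\<close>

lemma coef_sq_le:
  assumes "continuous_on {0..1} g" "\<And>y. 0 \<le> g y" "wint g = 1"
  shows "(coef g n)\<^sup>2 \<le> wint (\<lambda>y. (psi n y)\<^sup>2 * g y)"
proof -
  have "0 \<le> wint (\<lambda>y. (psi n y - coef g n)\<^sup>2 * g y)"
    by (intro wint_nonneg continuous_intros assms(1) mult_nonneg_nonneg assms(2)) auto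
  also have "\<dots> = wint (\<lambda>y. (psi n y)\<^sup>2 * g y + ((- 2 * coef g n) * (psi n y * g y) + (coef g n)\<^sup>2 * g y))"
    by (intro wint_cong) (simp add: power2_eq_square algebra_simps)
  also have "\<dots> = wint (\<lambda>y. (psi n y)\<^sup>2 * g y) + ((- 2 * coef g n) * coef g n + (coef g n)\<^sup>2 * wint g)"
  proof -
    have c: "continuous_on {0..1} (\<lambda>y. (psi n y)\<^sup>2 * g y)" "continuous_on {0..1} (\<lambda>y. (- 2 * coef g n) * (psi n y * g y))"
        "continuous_on {0..1} (\<lambda>y. (coef g n)\<^sup>2 * g y)"
      by (intro continuous_intros assms(1))+
    show ?thesis using wint_add[OF c(1) continuous_on_add[OF c(2,3)]] wint_add[OF c(2,3)]
      by (simp only: wint_cmult coef_def)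
  qed
  finally show ?thesis using assms(3) by (simp add: power2_eq_square)
qed

lemma coef_bessel_inequality:
  assumes "continuous_on {0..1} g"
  shows "(\<Sum>n<N. (coef g (Suc n))\<^sup>2) \<le> wint (\<lambda>y. (g y)\<^sup>2)"
proof -
  define A where "A = {1..<Suc N}"
  define r where "r = (\<lambda>y. g y - (\<Sum>k\<in>A. coef g k * psi k y))"
  have cr: "continuous_on {0..1} r" unfolding r_def by (intro continuous_intros assms)
  have "wint (\<lambda>y. (r y + (\<Sum>k\<in>A. coef g k * psi k y))\<^sup>2)
      = wint (\<lambda>y. (r y)\<^sup>2) + (\<Sum>k\<in>A. (coef g k)\<^sup>2 * wint (\<lambda>x. (psi k x)\<^sup>2))"
  proof (rule wint_pythagoras)
    show "wint (\<lambda>x. psi k x * r x) = 0" if "k \<in> A" for k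
      unfolding r_def by (rule coef_remainder[OF assms _ that]) (auto simp: A_def)
  qed (use cr psi_orthogonal in \<open>auto simp: A_def intro!: continuous_intros\<close>)
  also have "(\<Sum>k\<in>A. (coef g k)\<^sup>2 * wint (\<lambda>x. (psi k x)\<^sup>2)) = (\<Sum>n<N. (coef g (Suc n))\<^sup>2)"
    unfolding A_def atLeastLessThanSuc_atLeastAtMost
    by (simp add: psi_normalized sum.atLeast1_atMost_eq)
  finally show ?thesis
    using wint_nonneg[of "\<lambda>y. (r y)\<^sup>2"] cr by (simp add: r_def continuous_intros)
qed

section \<open>Moments of order 0 and moments at time 0\<close>

lemma moment_0: "moment g N x 0 t = (\<Sum>n<N. exp (- (lam (Suc n))\<^sup>2 * (2 * t)) * (coef g (Suc n))\<^sup>2)"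
  using wint_heat_sum_heat_sum[of g N t g] by (simp add: moment_def power2_eq_square mult.assoc)

text \<open>A truncated expansion of \<open>g\<close> is not supported near \<open>x\<close>, but by
  the expansion theorem its weighted \<open>L^2\<close> distance to \<open>g\<close> becomes as
  small as desired for large \<open>N\<close>; the moment of \<open>g\<close> itself is at most
  \<open>B * e ^ (2 * k)\<close>.\<close>

lemma moment_initial:
  assumes g: "\<And>y. (g has_real_derivative g' y) (at y)" and cg': "continuous_on UNIV g'"
    and gB: "\<And>y. 0 \<le> g y" "\<And>y. g y \<le> B" and int: "wint g = 1"
    and supp: "\<And>y. e \<le> \<bar>y - x\<bar> \<Longrightarrow> g y = 0" and e: "0 < e" "e \<le> x" "e \<le> 1 - x"
  shows "\<exists>N0. \<forall>N\<ge>N0. moment g N x k 0 \<le> 4 * B * e ^ (2 * k)"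
proof -
  have cg: "continuous_on S g" for S
    by (rule continuous_at_imp_continuous_on) (auto intro: DERIV_isCont g)
  have x: "0 < x" "x < 1" using e by auto
  have g1: "g 1 = 0" by (rule supp) (use e in auto)
  have "B > 0"
  proof (rule ccontr)
    assume "\<not> B > 0"
    then have "g y = 0" for y using gB[of y] by linarith
    then show False using int by (simp add: wint_def)
  qed
  \<comment> \<open>The bound for the moment of \<open>g\<close>, reused as the tolerance for the
    truncation error.\<close>
  define \<kappa> where "\<kappa> = B * e ^ (2 * k)"
  have \<kappa>: "\<kappa> > 0" using \<open>B > 0\<close> e by (simp add: \<kappa>_def)
  define W where "W = wint (\<lambda>y. (g' y)\<^sup>2)"
  have "\<forall>\<^sub>F n in sequentially. lam n \<ge> max 1 (W / \<kappa>)"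
    using filterlim_lam unfolding filterlim_at_top by blast
  then obtain N0 where N0: "\<And>n. n \<ge> N0 \<Longrightarrow> lam n \<ge> max 1 (W / \<kappa>)"
    by (auto simp: eventually_sequentially)
  have "moment g N x k 0 \<le> 4 * B * e ^ (2 * k)" if N: "N \<ge> N0" for N
  proof -
    define r where "r = (\<lambda>y. g y - heat_sum g N 0 y)"
    have cr: "continuous_on S r" for S unfolding r_def by (intro continuous_intros cg)
    have heat_sum_sum: "heat_sum g N 0 y = (\<Sum>k\<in>{1..<Suc N}. coef g k * psi k y)" for y
      unfolding atLeastLessThanSuc_atLeastAtMost
      by (simp add: heat_sum_def sum.atLeast1_atMost_eq)
    have l: "lam (Suc N) \<ge> 1" "lam (Suc N) \<ge> W / \<kappa>" using N0[of "Suc N"] N by auto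
    have "(lam (Suc N))\<^sup>2 * wint (\<lambda>y. (r y)\<^sup>2) \<le> W"
      unfolding r_def heat_sum_sum W_def
      by (rule eigenfunction_expansion_remainder)
         (use g g1 cg' in \<open>auto intro: has_field_derivative_at_within continuous_on_subset\<close>)
    also have "W \<le> \<kappa> * (lam (Suc N))\<^sup>2"
    proof -
      have "W \<le> \<kappa> * lam (Suc N)" using l(2) \<kappa> by (simp add: divide_le_eq mult.commute)
      also have "\<dots> \<le> \<kappa> * (lam (Suc N))\<^sup>2"
        using l(1) \<kappa> by (intro mult_left_mono) (auto simp: power2_eq_square)
      finally show ?thesis .
    qed
    finally have wr: "wint (\<lambda>y. (r y)\<^sup>2) \<le> \<kappa>" using l(1) by (simp add: mult.commute)
    have wg: "wint (\<lambda>y. (g y * (y - x) ^ (2 * k)) * g y) \<le> \<kappa>"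
    proof (rule bump_average_le)
      fix y assume "g y \<noteq> 0"
      then have "\<bar>y - x\<bar> \<le> e" using supp[of y] by force
      then have "\<bar>y - x\<bar> ^ (2 * k) \<le> e ^ (2 * k)" by (intro power_mono) auto
      then show "g y * (y - x) ^ (2 * k) \<le> \<kappa>" unfolding \<kappa>_def using gB[of y] e
        by (intro mult_mono) (auto simp: power_mult)
    qed (use gB int cg in \<open>auto intro!: continuous_intros\<close>)
    have "moment g N x k 0 \<le> wint (\<lambda>y. 2 * ((g y * (y - x) ^ (2 * k)) * g y) + 2 * (r y)\<^sup>2)"
      unfolding moment_def
    proof (intro wint_mono continuous_intros cg cr)
      fix y :: real assume y: "0 < y" "y \<le> 1"
      have "\<bar>y - x\<bar> \<le> 1" using y x by auto
      then have p: "0 \<le> (y - x) ^ (2 * k)" "(y - x) ^ (2 * k) \<le> 1"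
        using power_le_one[of "\<bar>y - x\<bar>" "2 * k"] by (auto simp: power_mult)
      have "(heat_sum g N 0 y)\<^sup>2 = (g y - r y)\<^sup>2" by (simp add: r_def)
      also have "\<dots> \<le> 2 * (g y)\<^sup>2 + 2 * (r y)\<^sup>2"
        using sum_squares_bound[of "g y" "- r y"] by (simp add: power2_eq_square algebra_simps)
      finally have "(heat_sum g N 0 y)\<^sup>2 * (y - x) ^ (2 * k) \<le> (2 * (g y)\<^sup>2 + 2 * (r y)\<^sup>2) * (y - x) ^ (2 * k)"
        using p by (intro mult_right_mono) auto
      also have "\<dots> = 2 * ((g y * (y - x) ^ (2 * k)) * g y) + 2 * (r y)\<^sup>2 * (y - x) ^ (2 * k)"
        by (simp add: power2_eq_square algebra_simps)
      also have "2 * (r y)\<^sup>2 * (y - x) ^ (2 * k) \<le> 2 * (r y)\<^sup>2 * 1"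
        using p by (intro mult_left_mono) auto
      finally show "(heat_sum g N 0 y)\<^sup>2 * (y - x) ^ (2 * k) \<le> 2 * ((g y * (y - x) ^ (2 * k)) * g y) + 2 * (r y)\<^sup>2"
        by simp
    qed
    also have "\<dots> = 2 * wint (\<lambda>y. (g y * (y - x) ^ (2 * k)) * g y) + 2 * wint (\<lambda>y. (r y)\<^sup>2)"
      unfolding wint_cmult[symmetric] by (intro wint_add continuous_intros cg cr)
    also have "\<dots> \<le> 4 * \<kappa>" using wr wg by simp
    finally show ?thesis by (simp add: \<kappa>_def mult_ac)
  qed
  then show ?thesis by blast
qed

text \<open>Of the exponent, 1 comes from the factor \<open>r\<close>, 2 from the boundary factor
  and \<open>|a|\<close> from the weight.\<close>

lemma vol_mono_scale:
  assumes x: "0 < x" "x < 1" and r: "0 < r1" "r1 \<le> r2"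
  shows "vol x r2 \<le> (r2 / r1) powr (3 + \<bar>a\<bar>) * vol x r1"
proof -
  define \<theta> where "\<theta> = r2 / r1"
  have \<theta>: "\<theta> \<ge> 1" "r2 = \<theta> * r1" using r by (simp_all add: \<theta>_def)
  have le: "u + r2 \<le> \<theta> * (u + r1)" if "u \<ge> 0" for u
    using \<theta> mult_right_mono[OF \<theta>(1) that] by (simp add: distrib_left)
  have "(x + r2) powr a \<le> \<theta> powr \<bar>a\<bar> * (x + r1) powr a"
  proof (rule powr_comparable)
    show "x + r1 \<le> \<theta> * (x + r2)" using mult_mono[of 1 \<theta> "x + r1" "x + r2"] x r \<theta> by simp
    show "x + r2 \<le> \<theta> * (x + r1)" using le x by simp
  qed (use x r \<theta>(1) in auto)
  moreover have "(1 - x + r2)\<^sup>2 \<le> (\<theta> * (1 - x + r1))\<^sup>2"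
    using x r by (intro power_mono le) auto
  ultimately have "(x + r2) powr a * (1 - x + r2)\<^sup>2 \<le> (\<theta> powr \<bar>a\<bar> * (x + r1) powr a) * (\<theta> * (1 - x + r1))\<^sup>2"
    by (intro mult_mono) auto
  then have "r2 * ((x + r2) powr a * (1 - x + r2)\<^sup>2) \<le> r2 * ((\<theta> powr \<bar>a\<bar> * (x + r1) powr a) * (\<theta> * (1 - x + r1))\<^sup>2)"
    using r by (intro mult_left_mono) auto
  also have "\<dots> = (\<theta> ^ 3 * \<theta> powr \<bar>a\<bar>) * vol x r1"
    by (simp add: vol_def \<theta>(2) power_mult_distrib power3_eq_cube power2_eq_square)
  also have "\<theta> ^ 3 * \<theta> powr \<bar>a\<bar> = \<theta> powr (3 + \<bar>a\<bar>)"
    using \<theta>(1) powr_realpow[of \<theta> 3] by (simp add: powr_add)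
  finally show ?thesis by (simp add: vol_def \<theta>_def mult.assoc)
qed

text \<open>The factor \<open>sqrt 2\<close> appears because the squared norm of the flow at time
  \<open>t\<close> involves the diagonal at time \<open>2 t\<close>. The restriction on
  \<open>y\<close> lets \<open>x\<close> and \<open>1 - x\<close> each change by at most a factor of
  2.\<close>

lemma vol_nearby:
  assumes x: "0 < x" "x < 1" and r: "r > 0" and y: "2 * \<bar>y - x\<bar> \<le> x" "2 * \<bar>y - x\<bar> \<le> 1 - x"
  shows "(1 - y)\<^sup>2 / vol y (sqrt 2 * r) \<le> 16 * 2 powr \<bar>a\<bar> * ((1 - x)\<^sup>2 / vol x r)"
proof -
  obtain D where D: "y - x \<le> D" "x - y \<le> D" "2 * D \<le> x" "2 * D \<le> 1 - x"
    using y that[of "\<bar>y - x\<bar>"] by auto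
  have y01: "0 < y" "y < 1" using D x by linarith+
  have yx: "x \<le> 2 * y" "y \<le> 2 * x" "1 - x \<le> 2 * (1 - y)" "1 - y \<le> 2 * (1 - x)"
    using D x by auto
  have s2: "1 \<le> sqrt 2" "sqrt 2 \<le> 2" by (simp_all add: real_le_lsqrt)
  define R where "R = sqrt 2 * r"
  have rr: "r \<le> R" "R \<le> 2 * r" using r s2 by (auto simp: R_def)
  have "(x + r) powr a \<le> 2 powr \<bar>a\<bar> * (y + R) powr a"
    by (rule powr_comparable) (use x y01 yx rr r in auto)
  moreover have "(1 - x + r)\<^sup>2 \<le> (2 * (1 - y + R))\<^sup>2"
    using x yx rr r by (intro power_mono) auto
  ultimately have "r * ((x + r) powr a * (1 - x + r)\<^sup>2)
      \<le> R * ((2 powr \<bar>a\<bar> * (y + R) powr a) * (2 * (1 - y + R))\<^sup>2)"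
    using r rr by (intro mult_mono) auto
  then have v: "vol x r \<le> 4 * 2 powr \<bar>a\<bar> * vol y R"
    unfolding vol_def power_mult_distrib by (simp only: mult_ac) simp
  have "(1 - y)\<^sup>2 \<le> (2 * (1 - x))\<^sup>2" using yx y01 by (intro power_mono) auto
  then have "(1 - y)\<^sup>2 \<le> 4 * (1 - x)\<^sup>2" unfolding power_mult_distrib by simp
  then have "(1 - y)\<^sup>2 * vol x r \<le> (4 * (1 - x)\<^sup>2) * (4 * 2 powr \<bar>a\<bar> * vol y R)"
    using v vol_pos[OF x r] by (intro mult_mono) auto
  moreover have "vol x r > 0" "vol y R > 0" using vol_pos x y01 r rr by auto
  ultimately show ?thesis unfolding R_def[symmetric] by (simp add: divide_simps) (simp add: mult_ac)
qed

definition dens :: "real \<Rightarrow> real \<Rightarrow> real" where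
  "dens x T = (1 - x)\<^sup>2 / vol x (sqrt T)"

lemma dens_pos: "0 < x \<Longrightarrow> x < 1 \<Longrightarrow> T > 0 \<Longrightarrow> dens x T > 0"
  by (simp add: dens_def vol_pos)

text \<open>By the scaling of \<open>vol\<close>, shrinking the time from \<open>T\<close> to
  \<open>t\<close> raises \<open>dens\<close> by at most \<open>T / t\<close> to the power
  \<open>(3 + |a|) / 2\<close>; the power of \<open>t\<close> compensates for it.\<close>

lemma dens_time:
  assumes x: "0 < x" "x < 1" and t: "0 < t" "t \<le> T" and k: "3 + \<bar>a\<bar> \<le> 2 * real m"
  shows "t ^ m * dens x t \<le> T ^ m * dens x T"
proof -
  have "vol x (sqrt T) \<le> (sqrt T / sqrt t) powr (3 + \<bar>a\<bar>) * vol x (sqrt t)"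
    using x t by (intro vol_mono_scale) auto
  also have "\<dots> \<le> (T / t) ^ m * vol x (sqrt t)"
  proof (rule mult_right_mono)
    have "(sqrt T / sqrt t) powr (3 + \<bar>a\<bar>) \<le> (sqrt T / sqrt t) powr (real (2 * m))"
      using t k by (intro powr_mono) auto
    also have "\<dots> = (sqrt T / sqrt t) ^ (2 * m)" using t by (intro powr_realpow) auto
    also have "\<dots> = (T / t) ^ m" using t by (simp add: power_mult power_divide)
    finally show "(sqrt T / sqrt t) powr (3 + \<bar>a\<bar>) \<le> (T / t) ^ m" .
  qed (use vol_pos[OF x, of "sqrt t"] t in auto)
  finally have "t ^ m * vol x (sqrt T) \<le> T ^ m * vol x (sqrt t)"
    using t by (simp add: power_divide field_simps)
  then have "(1 - x)\<^sup>2 * (t ^ m * vol x (sqrt T)) \<le> (1 - x)\<^sup>2 * (T ^ m * vol x (sqrt t))"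
    by (intro mult_left_mono) auto
  then show ?thesis
    using vol_pos[OF x, of "sqrt t"] vol_pos[OF x, of "sqrt T"] t
    by (simp add: dens_def divide_simps mult_ac)
qed

text \<open>The point is uniformity: \<open>C\<close> serves all \<open>T\<close> and
  \<open>x\<close>, whereas bumps, truncations and errors may depend on them. The last two clauses
  provide the termwise limits and the majorant for replacing the bumps by the point
  \<open>x\<close>.\<close>

lemma heat_approximation:
  assumes k: "k \<ge> 2" "3 + \<bar>a\<bar> \<le> 2 * real (k - 2)"
  shows "\<exists>C>0. \<forall>T x. 0 < T \<longrightarrow> 0 < x \<longrightarrow> x < 1 \<longrightarrow> (\<exists>g N0 \<delta>. \<delta> \<longlonglongrightarrow> 0
     \<and> (\<forall>j. \<forall>N\<ge>N0 j. moment (g j) N x k T \<le> C * (T ^ k * dens x T) + \<delta> j \<and> moment (g j) N x 0 T \<le> C * dens x T)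
     \<and> (\<forall>n\<ge>1. (\<lambda>j. coef (g j) n) \<longlonglongrightarrow> psi n x)
     \<and> (\<forall>j. \<forall>n\<ge>1. (coef (g j) n)\<^sup>2 \<le> C * (1 + lam n) powr \<bar>a\<bar>))"
proof -
  obtain C0 where C0: "C0 > 0" and C0': "\<forall>t>0. \<forall>x. 0 < x \<longrightarrow> x < 1 \<longrightarrow>
      (\<forall>N. (\<Sum>n<N. exp (- (lam (Suc n))\<^sup>2 * t) * (psi (Suc n) x)\<^sup>2) \<le> C0 * (1 - x)\<^sup>2 / vol x (sqrt t))"
    using on_diagonal_bound by blast
  obtain C2 where C2: "C2 > 0" and C2': "\<forall>n\<ge>1. \<forall>x. 0 < x \<longrightarrow> x \<le> 1 \<longrightarrow> (psi n x)\<^sup>2 \<le> C2 * (1 + lam n) powr \<bar>a\<bar>"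
    using psi_crude by blast
  define C1 where "C1 = C0 * (16 * 2 powr \<bar>a\<bar>)"
  define A where "A = (2 * (real k)\<^sup>2) ^ k"
  define C where "C = C1 + C2 + A * 2 ^ (k - 2) * C1"
  have pos: "C1 > 0" "A \<ge> 0" using C0 by (simp_all add: C1_def A_def)
  then have Cge: "C > 0" "C1 \<le> C" "C2 \<le> C" "A * 2 ^ (k - 2) * C1 \<le> C"
    using C2 by (auto simp: C_def intro!: add_pos_nonneg)
  have "\<exists>g N0 \<delta>. \<delta> \<longlonglongrightarrow> 0
     \<and> (\<forall>j. \<forall>N\<ge>N0 j. moment (g j) N x k T \<le> C * (T ^ k * dens x T) + \<delta> j \<and> moment (g j) N x 0 T \<le> C * dens x T)
     \<and> (\<forall>n\<ge>1. (\<lambda>j. coef (g j) n) \<longlonglongrightarrow> psi n x)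
     \<and> (\<forall>j. \<forall>n\<ge>1. (coef (g j) n)\<^sup>2 \<le> C * (1 + lam n) powr \<bar>a\<bar>)"
    if T: "0 < T" and x: "0 < x" "x < 1" for T x
  proof -
    obtain c where c: "c > 0" and c': "\<forall>e. 0 < e \<longrightarrow> e \<le> x \<longrightarrow> e \<le> 1 - x \<longrightarrow> (\<exists>g g'.
       (\<forall>y. (g has_real_derivative g' y) (at y)) \<and> continuous_on UNIV g' \<and> (\<forall>y. 0 \<le> g y \<and> g y \<le> c / e)
       \<and> wint g = 1 \<and> (\<forall>y. e \<le> \<bar>y - x\<bar> \<longrightarrow> g y = 0))"
      using bump_exists[OF x] by blast
    \<comment> \<open>Half the distance to the endpoints is what \<open>vol_nearby\<close> needs;
      \<open>sqrt T\<close> makes the early phase of length \<open>e^2\<close> end by time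
      \<open>T\<close>.\<close>
    define e0 where "e0 = min (min (x / 2) ((1 - x) / 2)) (sqrt T)"
    have e0: "0 < e0" "2 * e0 \<le> x" "2 * e0 \<le> 1 - x" "e0 \<le> sqrt T"
      using x T by (auto simp: e0_def min_def)
    define e where "e = (\<lambda>j. e0 / real (Suc j))"
    have e: "0 < e j" "e j \<le> e0" for j
      using e0 by (auto simp: e_def divide_le_eq mult_le_cancel_left1)
    have elim: "e \<longlonglongrightarrow> 0" unfolding e_def by (rule lim_const_over_n[THEN LIMSEQ_Suc])
    have ej: "0 < e j" "e j \<le> x" "e j \<le> 1 - x" for j using e[of j] e0 by linarith+
    obtain g g' where g: "\<And>j y. (g j has_real_derivative g' j y) (at y)" "\<And>j. continuous_on UNIV (g' j)"
      "\<And>j y. 0 \<le> g j y" "\<And>j y. g j y \<le> c / e j" "\<And>j. wint (g j) = 1" "\<And>j y. e j \<le> \<bar>y - x\<bar> \<Longrightarrow> g j y = 0"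
    proof -
      have "\<forall>j. \<exists>g g'. (\<forall>y. (g has_real_derivative g' y) (at y)) \<and> continuous_on UNIV g' \<and> (\<forall>y. 0 \<le> g y \<and> g y \<le> c / e j)
       \<and> wint g = 1 \<and> (\<forall>y. e j \<le> \<bar>y - x\<bar> \<longrightarrow> g y = 0)"
        using c' ej by blast
      from choice[OF this] obtain g where "\<forall>j. \<exists>g'. (\<forall>y. (g j has_real_derivative g' y) (at y)) \<and> continuous_on UNIV g'
        \<and> (\<forall>y. 0 \<le> g j y \<and> g j y \<le> c / e j) \<and> wint (g j) = 1 \<and> (\<forall>y. e j \<le> \<bar>y - x\<bar> \<longrightarrow> g j y = 0)" by blast
      from choice[OF this] obtain g' where "\<forall>j. (\<forall>y. (g j has_real_derivative g' j y) (at y)) \<and> continuous_on UNIV (g' j)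
        \<and> (\<forall>y. 0 \<le> g j y \<and> g j y \<le> c / e j) \<and> wint (g j) = 1 \<and> (\<forall>y. e j \<le> \<bar>y - x\<bar> \<longrightarrow> g j y = 0)" by blast
      then show ?thesis by (intro that[of g g']) auto
    qed
    have cg: "continuous_on S (g j)" for S j
      by (rule continuous_at_imp_continuous_on) (auto intro: DERIV_isCont g)
    have near: "\<bar>y - x\<bar> < e j" if "g j y \<noteq> 0" for j y
      using g(6)[of j y] that by force
    have "\<forall>j. \<exists>N0. \<forall>N\<ge>N0. moment (g j) N x k 0 \<le> 4 * (c / e j) * e j ^ (2 * k)"
      using moment_initial[OF g(1,2,3,4,5,6) ej] by blast
    then obtain N0 where N0: "\<And>j N. N \<ge> N0 j \<Longrightarrow> moment (g j) N x k 0 \<le> 4 * (c / e j) * e j ^ (2 * k)"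
      by (auto dest!: choice)
    have m0: "moment (g j) N x 0 t \<le> C1 * dens x t" if t: "t > 0" for j N t
    proof -
      have "moment (g j) N x 0 t \<le> (\<Sum>n<N. exp (- (lam (Suc n))\<^sup>2 * (2 * t)) * wint (\<lambda>y. (psi (Suc n) y)\<^sup>2 * g j y))"
        unfolding moment_0 by (intro sum_mono mult_left_mono coef_sq_le cg g) auto
      also have "\<dots> = wint (\<lambda>y. \<Sum>n<N. exp (- (lam (Suc n))\<^sup>2 * (2 * t)) * ((psi (Suc n) y)\<^sup>2 * g j y))"
        unfolding wint_cmult[symmetric] by (intro wint_sum[symmetric] continuous_intros cg) auto
      also have "\<dots> = wint (\<lambda>y. (\<Sum>n<N. exp (- (lam (Suc n))\<^sup>2 * (2 * t)) * (psi (Suc n) y)\<^sup>2) * g j y)"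
        unfolding sum_distrib_right by (intro wint_cong sum.cong refl) simp
      also have "\<dots> \<le> C1 * dens x t"
      proof (rule bump_average_le)
        fix y assume "0 < y" "y \<le> 1" "g j y \<noteq> 0"
        then have "\<bar>y - x\<bar> \<le> e0" using near[of j y] e(2)[of j] by simp
        then have "2 * \<bar>y - x\<bar> \<le> 2 * e0" by simp
        then have y: "2 * \<bar>y - x\<bar> \<le> x" "2 * \<bar>y - x\<bar> \<le> 1 - x"
          using e0(2,3) by (blast intro: order_trans)+
        have "y \<noteq> 1" using y(2) x by auto
        then have y1: "0 < y" "y < 1" using \<open>0 < y\<close> \<open>y \<le> 1\<close> by auto
        have "(\<Sum>n<N. exp (- (lam (Suc n))\<^sup>2 * (2 * t)) * (psi (Suc n) y)\<^sup>2) \<le> C0 * ((1 - y)\<^sup>2 / vol y (sqrt 2 * sqrt t))"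
          using C0'[rule_format, of "2 * t" y N] t y1 by (simp add: real_sqrt_mult)
        also have "\<dots> \<le> C0 * (16 * 2 powr \<bar>a\<bar> * ((1 - x)\<^sup>2 / vol x (sqrt t)))"
          using C0 t x y by (intro mult_left_mono vol_nearby) auto
        also have "\<dots> = C1 * dens x t" by (simp add: C1_def dens_def)
        finally show "(\<Sum>n<N. exp (- (lam (Suc n))\<^sup>2 * (2 * t)) * (psi (Suc n) y)\<^sup>2) \<le> C1 * dens x t" .
      qed (intro continuous_intros cg g)+
      finally show ?thesis .
    qed
    \<comment> \<open>Bessel's inequality covers the times down to 0, where the diagonal bound
      fails. Its blow-up as \<open>j\<close> grows is harmless because it is used only up to time
      \<open>(e j)^2\<close>.\<close>
    have early: "moment (g j) N x 0 t \<le> c / e j" if "t \<ge> 0" for j N t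
    proof -
      have "moment (g j) N x 0 t \<le> (\<Sum>n<N. (coef (g j) (Suc n))\<^sup>2)"
        unfolding moment_0 using that by (intro sum_mono mult_left_le_one_le) auto
      also have "\<dots> \<le> wint (\<lambda>y. (g j y)\<^sup>2)" by (rule coef_bessel_inequality) (rule cg)
      also have "\<dots> = wint (\<lambda>y. g j y * g j y)" by (simp add: power2_eq_square)
      also have "\<dots> \<le> c / e j" by (rule bump_average_le) (rule cg g)+
      finally show ?thesis .
    qed
    define D where "D = 2 ^ (k - 2) * (C1 * (T ^ (k - 2) * dens x T))"
    \<comment> \<open>Everything that carries a positive power of \<open>e j\<close>;
      \<open>k \<ge> 2\<close> makes \<open>2 * k - 3\<close> positive.\<close>
    define \<delta> where "\<delta> = (\<lambda>j. (e j)\<^sup>2 * (A * (T * D)) + (T + (e j)\<^sup>2) * ((4 * c + A * (2 ^ (k - 2) * c)) * e j ^ (2 * k - 3)))"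
    have "moment (g j) N x k T \<le> C * (T ^ k * dens x T) + \<delta> j" if N: "N \<ge> N0 j" for j N
    proof -
      define s where "s = (e j)\<^sup>2"
      have s: "s > 0" "s \<le> T"
        using e[of j] e0(4) T power_mono[of "e j" "sqrt T" 2] by (auto simp: s_def)
      have "moment (g j) N x k T \<le> (T + s) * (moment (g j) N x k 0 / s
          + (2 * (real k)\<^sup>2) ^ k * (s * (2 * s) ^ (k - 2) * (c / e j) + T * D))"
      proof (rule moment_bound[OF k(1) s])
        show "0 \<le> c / e j" using c ej[of j] by simp
        show "moment (g j) N x 0 t \<le> c / e j" if "0 \<le> t" for t by (rule early) fact
        fix t assume t: "s \<le> t" "t \<le> T"
        then have t0: "t > 0" using s by linarith
        have "(t + s) ^ (k - 2) * moment (g j) N x 0 t \<le> (2 * t) ^ (k - 2) * (C1 * dens x t)"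
          using t t0 s by (intro mult_mono power_mono m0 moment_nonneg) auto
        also have "\<dots> = 2 ^ (k - 2) * (C1 * (t ^ (k - 2) * dens x t))" by (simp add: power_mult_distrib)
        also have "\<dots> \<le> D" unfolding D_def
          using pos by (intro mult_left_mono dens_time x t0 t k) auto
        finally show "(t + s) ^ (k - 2) * moment (g j) N x 0 t \<le> D" .
      qed
      also have "\<dots> \<le> (T + s) * (4 * (c / e j) * e j ^ (2 * k) / s + A * (s * (2 * s) ^ (k - 2) * (c / e j) + T * D))"
        unfolding A_def[symmetric] using s T N0[OF N] pos(2) c ej(1)[of j]
        by (intro mult_left_mono add_mono divide_right_mono order_refl) auto
      also have "4 * (c / e j) * e j ^ (2 * k) / s = 4 * c * e j ^ (2 * k - 3)"
      proof -
        have "2 * k = (2 * k - 3) + 3" using k by simp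
        then have "e j ^ (2 * k) = e j ^ (2 * k - 3) * e j ^ 3" by (metis power_add)
        then show ?thesis using ej[of j] by (simp add: s_def power2_eq_square power3_eq_cube)
      qed
      also have "s * (2 * s) ^ (k - 2) * (c / e j) = 2 ^ (k - 2) * c * e j ^ (2 * k - 3)"
      proof -
        have "2 * k - 3 = Suc (2 * (k - 2))" using k by simp
        then have "e j ^ (2 * k - 3) = e j * s ^ (k - 2)" by (simp add: s_def power_mult)
        then show ?thesis using ej[of j] by (simp add: s_def power_mult_distrib power2_eq_square)
      qed
      also have "(T + s) * (4 * c * e j ^ (2 * k - 3) + A * (2 ^ (k - 2) * c * e j ^ (2 * k - 3) + T * D))
          = T * (A * (T * D)) + \<delta> j"
        by (simp add: \<delta>_def s_def algebra_simps)
      also have "T * (A * (T * D)) = A * 2 ^ (k - 2) * C1 * (T ^ k * dens x T)"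
      proof -
        have "k = Suc (Suc (k - 2))" using k by simp
        then have "T ^ k = T * (T * T ^ (k - 2))" by (metis power_Suc)
        then show ?thesis by (simp add: D_def mult_ac)
      qed
      also have "A * 2 ^ (k - 2) * C1 * (T ^ k * dens x T) + \<delta> j \<le> C * (T ^ k * dens x T) + \<delta> j"
        using Cge dens_pos[OF x T] T by (intro add_right_mono mult_right_mono) auto
      finally show ?thesis .
    qed
    moreover have "moment (g j) N x 0 T \<le> C * dens x T" for j N
      using m0[OF T, of j N] Cge(2) dens_pos[OF x T] mult_right_mono[of C1 C "dens x T"] by linarith
    moreover have "\<delta> \<longlonglongrightarrow> 0"
    proof -
      have "\<delta> \<longlonglongrightarrow> 0\<^sup>2 * (A * (T * D)) + (T + 0\<^sup>2) * ((4 * c + A * (2 ^ (k - 2) * c)) * 0 ^ (2 * k - 3))"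
        unfolding \<delta>_def by (intro tendsto_intros elim)
      moreover have "2 * k - 3 > 0" using k by simp
      ultimately show ?thesis by (simp add: power_0_left)
    qed
    moreover have "(\<lambda>j. coef (g j) n) \<longlonglongrightarrow> psi n x" if "n \<ge> 1" for n
    proof (rule LIMSEQ_I)
      fix r :: real assume r: "r > 0"
      have "isCont (psi n) x" by (rule DERIV_isCont) (rule DERIV_psi)
      then obtain d where d: "d > 0" "\<And>y. \<bar>y - x\<bar> < d \<Longrightarrow> \<bar>psi n y - psi n x\<bar> < r / 2"
        using r unfolding continuous_at_eps_delta by (metis dist_real_def half_gt_zero)
      have "\<forall>\<^sub>F j in sequentially. e j < d" using elim d(1) by (rule order_tendstoD(2))
      then obtain J where J: "\<And>j. j \<ge> J \<Longrightarrow> e j < d" by (auto simp: eventually_sequentially)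
      have "norm (coef (g j) n - psi n x) < r" if "j \<ge> J" for j
      proof -
        have *: "psi n y \<le> psi n x + r / 2" "- psi n y \<le> - psi n x + r / 2" if "g j y \<noteq> 0" for y
        proof -
          have "\<bar>psi n y - psi n x\<bar> < r / 2" using near[OF that] J[OF \<open>j \<ge> J\<close>] by (intro d(2)) simp
          then show "psi n y \<le> psi n x + r / 2" "- psi n y \<le> - psi n x + r / 2" by linarith+
        qed
        have "wint (\<lambda>y. psi n y * g j y) \<le> psi n x + r / 2"
          by (rule bump_average_le) (intro continuous_intros cg g | erule *(1))+
        moreover have "wint (\<lambda>y. - psi n y * g j y) \<le> - psi n x + r / 2"
          by (rule bump_average_le) (intro continuous_intros cg g | erule *(2))+
        moreover have "wint (\<lambda>y. - psi n y * g j y) = - wint (\<lambda>y. psi n y * g j y)"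
          using wint_cmult[of "-1" "\<lambda>y. psi n y * g j y"] by simp
        ultimately show ?thesis using r unfolding coef_def by (simp add: abs_less_iff)
      qed
      then show "\<exists>no. \<forall>j\<ge>no. norm (coef (g j) n - psi n x) < r" by blast
    qed
    moreover have "(coef (g j) n)\<^sup>2 \<le> C * (1 + lam n) powr \<bar>a\<bar>" if "n \<ge> 1" for j n
    proof -
      have "(coef (g j) n)\<^sup>2 \<le> wint (\<lambda>y. (psi n y)\<^sup>2 * g j y)" by (rule coef_sq_le) (rule cg g)+
      also have "\<dots> \<le> C2 * (1 + lam n) powr \<bar>a\<bar>"
        by (rule bump_average_le) (use C2' that in \<open>auto intro!: continuous_intros cg g\<close>)
      also have "\<dots> \<le> C * (1 + lam n) powr \<bar>a\<bar>" using Cge by (intro mult_right_mono) auto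
      finally show ?thesis .
    qed
    ultimately show ?thesis by (intro exI[of _ g] exI[of _ N0] exI[of _ \<delta>]) blast
  qed
  then show ?thesis using Cge(1) by (intro exI[of _ C]) blast
qed

end

section \<open>Off-diagonal decay of the heat kernel\<close>

lemma abs_mult_le_of_squares_le:
  fixes p q :: real
  assumes "p\<^sup>2 \<le> B" "q\<^sup>2 \<le> B"
  shows "\<bar>p * q\<bar> \<le> B"
proof -
  have "\<bar>p * q\<bar>\<^sup>2 \<le> B * B" unfolding power2_abs power_mult_distrib
    using assms order_trans[OF zero_le_power2 assms(1)] by (intro mult_mono) auto
  then show ?thesis
    using order_trans[OF zero_le_power2 assms(1)] abs_le_square_iff[of "p * q" B]
    by (simp add: power2_eq_square)
qed

context bessel
begin

lemma wint_abs_le: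
  assumes "continuous_on {0..1} f"
  shows "\<bar>wint f\<bar> \<le> wint (\<lambda>x. \<bar>f x\<bar>)"
proof -
  have "wint f \<le> wint (\<lambda>x. \<bar>f x\<bar>)" by (intro wint_mono continuous_intros assms) auto
  moreover have "wint (\<lambda>x. (-1) * f x) \<le> wint (\<lambda>x. \<bar>f x\<bar>)"
    by (intro wint_mono continuous_intros assms) auto
  ultimately show ?thesis unfolding wint_cmult by simp
qed

lemma summable_dkern_abs:
  assumes "t > 0" "0 < x" "x \<le> 1" "0 < y" "y \<le> 1"
  shows "summable (\<lambda>n. exp (- (lam (Suc n))\<^sup>2 * t) * \<bar>psi (Suc n) x * psi (Suc n) y\<bar>)"
proof -
  obtain C where C: "C > 0" and C': "\<forall>n\<ge>1. \<forall>x. 0 < x \<longrightarrow> x \<le> 1 \<longrightarrow> (psi n x)\<^sup>2 \<le> C * (1 + lam n) powr \<bar>a\<bar>"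
    using psi_crude by blast
  show ?thesis
  proof (rule summable_comparison_test'[of "\<lambda>n. C * (exp (- (lam (Suc n))\<^sup>2 * t) * (1 + lam (Suc n)) powr \<bar>a\<bar>)" 0])
    show "summable (\<lambda>n. C * (exp (- (lam (Suc n))\<^sup>2 * t) * (1 + lam (Suc n)) powr \<bar>a\<bar>))"
      by (intro summable_mult summable_heat_weights assms) auto
    fix n
    have "\<bar>psi (Suc n) x * psi (Suc n) y\<bar> \<le> C * (1 + lam (Suc n)) powr \<bar>a\<bar>"
      by (rule abs_mult_le_of_squares_le) (use C' assms in auto)
    then have "exp (- (lam (Suc n))\<^sup>2 * t) * \<bar>psi (Suc n) x * psi (Suc n) y\<bar>
        \<le> exp (- (lam (Suc n))\<^sup>2 * t) * (C * (1 + lam (Suc n)) powr \<bar>a\<bar>)"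
      by (intro mult_left_mono) auto
    then show "norm (exp (- (lam (Suc n))\<^sup>2 * t) * \<bar>psi (Suc n) x * psi (Suc n) y\<bar>)
        \<le> C * (exp (- (lam (Suc n))\<^sup>2 * t) * (1 + lam (Suc n)) powr \<bar>a\<bar>)"
      by (simp add: abs_mult mult_ac)
  qed
qed

lemma summable_dkern:
  assumes "t > 0" "0 < x" "x \<le> 1" "0 < y" "y \<le> 1"
  shows "summable (\<lambda>n. exp (- (lam (Suc n))\<^sup>2 * t) * (psi (Suc n) x * psi (Suc n) y))"
  by (rule summable_norm_cancel) (use summable_dkern_abs[OF assms] in \<open>simp add: abs_mult\<close>)

text \<open>The pairing stands for the kernel at time \<open>2 T\<close>, by the semigroup property.
  As \<open>|x - y|\<close> is at most twice the larger of \<open>|z - x|\<close> and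
  \<open>|z - y|\<close>, its power can be put on one flow at a time, and Cauchy--Schwarz leaves the
  moment of order \<open>k\<close> of that flow and the moment of order 0 of the other.\<close>

lemma heat_sum_pairing_bounds:
  defines "S \<equiv> \<lambda>g h N T. wint (\<lambda>z. heat_sum g N T z * heat_sum h N T z)"
  shows "(S g h N T)\<^sup>2 \<le> moment g N x 0 T * moment h N y 0 T"
    and "(\<bar>x - y\<bar> ^ k * S g h N T)\<^sup>2
      \<le> 2 * 4 ^ k * (moment g N x k T * moment h N y 0 T + moment h N y k T * moment g N x 0 T)"
proof -
  define u v where "u = heat_sum g N T" and "v = heat_sum h N T"
  have c: "continuous_on {0..1} u" "continuous_on {0..1} v"
    unfolding u_def v_def by (intro continuous_intros)+
  show "(S g h N T)\<^sup>2 \<le> moment g N x 0 T * moment h N y 0 T"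
    using wint_Cauchy_Schwarz[OF c] by (simp add: S_def moment_def u_def v_def)
  define P' where "P' = wint (\<lambda>z. (\<bar>u z\<bar> * \<bar>z - x\<bar> ^ k) * \<bar>v z\<bar>)"
  define Q' where "Q' = wint (\<lambda>z. (\<bar>v z\<bar> * \<bar>z - y\<bar> ^ k) * \<bar>u z\<bar>)"
  have ca: "continuous_on {0..1} (\<lambda>z. \<bar>u z\<bar> * \<bar>z - x\<bar> ^ k)" "continuous_on {0..1} (\<lambda>z. \<bar>v z\<bar> * \<bar>z - y\<bar> ^ k)"
      "continuous_on {0..1} (\<lambda>z. \<bar>u z\<bar>)" "continuous_on {0..1} (\<lambda>z. \<bar>v z\<bar>)"
    by (intro continuous_intros c)+
  have pw: "(\<bar>w\<bar> * \<bar>z - b\<bar> ^ k)\<^sup>2 = w\<^sup>2 * (z - b) ^ (2 * k)" for w z b :: real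
    by (simp add: power_mult_distrib power_mult[symmetric] mult.commute[of k] power_even_abs)
  have P2: "P'\<^sup>2 \<le> moment g N x k T * moment h N y 0 T"
    using wint_Cauchy_Schwarz[OF ca(1) ca(4)] unfolding P'_def moment_def u_def v_def pw by simp
  have Q2: "Q'\<^sup>2 \<le> moment h N y k T * moment g N x 0 T"
    using wint_Cauchy_Schwarz[OF ca(2) ca(3)] unfolding Q'_def moment_def u_def v_def pw by simp
  have "\<bar>x - y\<bar> ^ k * \<bar>S g h N T\<bar> \<le> \<bar>x - y\<bar> ^ k * wint (\<lambda>z. \<bar>u z * v z\<bar>)"
    unfolding S_def u_def v_def by (intro mult_left_mono wint_abs_le continuous_intros) auto
  also have "\<dots> = wint (\<lambda>z. \<bar>x - y\<bar> ^ k * \<bar>u z * v z\<bar>)" by (simp add: wint_cmult)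
  also have "\<dots> \<le> wint (\<lambda>z. 2 ^ k * ((\<bar>u z\<bar> * \<bar>z - x\<bar> ^ k) * \<bar>v z\<bar> + (\<bar>v z\<bar> * \<bar>z - y\<bar> ^ k) * \<bar>u z\<bar>))"
  proof (intro wint_mono continuous_intros c)
    fix z :: real
    define m where "m = max \<bar>z - x\<bar> \<bar>z - y\<bar>"
    have "\<bar>z - x\<bar> \<le> m" "\<bar>z - y\<bar> \<le> m" by (simp_all add: m_def)
    then have "\<bar>x - y\<bar> \<le> 2 * m" by linarith
    then have "\<bar>x - y\<bar> ^ k \<le> (2 * m) ^ k" by (intro power_mono) auto
    also have "\<dots> \<le> 2 ^ k * (\<bar>z - x\<bar> ^ k + \<bar>z - y\<bar> ^ k)"
      unfolding power_mult_distrib by (intro mult_left_mono) (auto simp: m_def max_def)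
    finally have "\<bar>x - y\<bar> ^ k * \<bar>u z * v z\<bar> \<le> 2 ^ k * (\<bar>z - x\<bar> ^ k + \<bar>z - y\<bar> ^ k) * \<bar>u z * v z\<bar>"
      by (intro mult_right_mono) auto
    then show "\<bar>x - y\<bar> ^ k * \<bar>u z * v z\<bar>
        \<le> 2 ^ k * ((\<bar>u z\<bar> * \<bar>z - x\<bar> ^ k) * \<bar>v z\<bar> + (\<bar>v z\<bar> * \<bar>z - y\<bar> ^ k) * \<bar>u z\<bar>)"
      by (simp add: abs_mult algebra_simps)
  qed
  also have "\<dots> = 2 ^ k * (P' + Q')"
    unfolding P'_def Q'_def wint_cmult by (subst wint_add) (auto intro!: continuous_intros c)
  finally have "(\<bar>x - y\<bar> ^ k * \<bar>S g h N T\<bar>)\<^sup>2 \<le> (2 ^ k * (P' + Q'))\<^sup>2"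
    by (intro power_mono) auto
  also have "\<dots> \<le> (2 ^ k)\<^sup>2 * (2 * P'\<^sup>2 + 2 * Q'\<^sup>2)"
    unfolding power_mult_distrib using sum_squares_bound[of P' Q']
    by (intro mult_left_mono) (auto simp: power2_sum)
  also have "\<dots> \<le> (2 ^ k)\<^sup>2 * (2 * (moment g N x k T * moment h N y 0 T) + 2 * (moment h N y k T * moment g N x 0 T))"
    using P2 Q2 by (intro mult_left_mono) auto
  also have "(2 ^ k)\<^sup>2 = (2 * 2 :: real) ^ k" by (simp only: power2_eq_square power_mult_distrib)
  finally show "(\<bar>x - y\<bar> ^ k * S g h N T)\<^sup>2
      \<le> 2 * 4 ^ k * (moment g N x k T * moment h N y 0 T + moment h N y k T * moment g N x 0 T)"
    by (simp add: power_mult_distrib algebra_simps)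
qed

text \<open>The limit of the pairing bounds. Truncations and bump widths move along one index
  \<open>j\<close>, so a single use of Tannery's theorem suffices.\<close>

theorem dkern_off_diagonal:
  assumes k: "k \<ge> 2" "3 + \<bar>a\<bar> \<le> 2 * real (k - 2)"
  shows "\<exists>C>0. \<forall>T x y. 0 < T \<longrightarrow> 0 < x \<longrightarrow> x < 1 \<longrightarrow> 0 < y \<longrightarrow> y < 1 \<longrightarrow>
    (dkern (2 * T) x y)\<^sup>2 \<le> C * (dens x T * dens y T)
    \<and> (\<bar>x - y\<bar> ^ k * dkern (2 * T) x y)\<^sup>2 \<le> C * (T ^ k * (dens x T * dens y T))"
proof -
  obtain C where C: "C > 0" and C': "\<forall>T x. 0 < T \<longrightarrow> 0 < x \<longrightarrow> x < 1 \<longrightarrow> (\<exists>g N0 \<delta>. \<delta> \<longlonglongrightarrow> 0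
     \<and> (\<forall>j. \<forall>N\<ge>N0 j. moment (g j) N x k T \<le> C * (T ^ k * dens x T) + \<delta> j \<and> moment (g j) N x 0 T \<le> C * dens x T)
     \<and> (\<forall>n\<ge>1. (\<lambda>j. coef (g j) n) \<longlonglongrightarrow> psi n x)
     \<and> (\<forall>j. \<forall>n\<ge>1. (coef (g j) n)\<^sup>2 \<le> C * (1 + lam n) powr \<bar>a\<bar>))"
    using heat_approximation[OF k] by blast
  define B where "B = C\<^sup>2 + 4 * 4 ^ k * C\<^sup>2"
  have "(dkern (2 * T) x y)\<^sup>2 \<le> B * (dens x T * dens y T)
    \<and> (\<bar>x - y\<bar> ^ k * dkern (2 * T) x y)\<^sup>2 \<le> B * (T ^ k * (dens x T * dens y T))"
    if T: "0 < T" and x: "0 < x" "x < 1" and y: "0 < y" "y < 1" for T x y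
  proof -
    define dx dy where "dx = dens x T" and "dy = dens y T"
    have d: "dx > 0" "dy > 0" using dens_pos x y T by (simp_all add: dx_def dy_def)
    obtain g N1 \<delta> where g: "\<delta> \<longlonglongrightarrow> 0"
      "\<forall>j. \<forall>N\<ge>N1 j. moment (g j) N x k T \<le> C * (T ^ k * dx) + \<delta> j \<and> moment (g j) N x 0 T \<le> C * dx"
      "\<forall>n\<ge>1. (\<lambda>j. coef (g j) n) \<longlonglongrightarrow> psi n x"
      "\<forall>j. \<forall>n\<ge>1. (coef (g j) n)\<^sup>2 \<le> C * (1 + lam n) powr \<bar>a\<bar>"
      using C'[rule_format, OF T x] unfolding dx_def[symmetric] by blast
    obtain h N2 \<epsilon> where h: "\<epsilon> \<longlonglongrightarrow> 0"
      "\<forall>j. \<forall>N\<ge>N2 j. moment (h j) N y k T \<le> C * (T ^ k * dy) + \<epsilon> j \<and> moment (h j) N y 0 T \<le> C * dy"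
      "\<forall>n\<ge>1. (\<lambda>j. coef (h j) n) \<longlonglongrightarrow> psi n y"
      "\<forall>j. \<forall>n\<ge>1. (coef (h j) n)\<^sup>2 \<le> C * (1 + lam n) powr \<bar>a\<bar>"
      using C'[rule_format, OF T y] unfolding dy_def[symmetric] by blast
    \<comment> \<open>At least \<open>j\<close>, so that every fixed term of the series is
      eventually included.\<close>
    define N where "N = (\<lambda>j. max j (max (N1 j) (N2 j)))"
    define t where "t = (\<lambda>n j. if n < N j then exp (- (lam (Suc n))\<^sup>2 * (2 * T)) * (coef (g j) (Suc n) * coef (h j) (Suc n)) else 0)"
    define S where "S = (\<lambda>j. wint (\<lambda>z. heat_sum (g j) (N j) T z * heat_sum (h j) (N j) T z))"
    have S_eq: "S j = (\<Sum>n. t n j)" for j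
    proof -
      have "S j = (\<Sum>n<N j. t n j)" unfolding S_def wint_heat_sum_heat_sum by (intro sum.cong) (auto simp: t_def)
      also have "\<dots> = (\<Sum>n. t n j)" by (rule suminf_finite[symmetric]) (auto simp: t_def)
      finally show ?thesis .
    qed
    have lim: "S \<longlonglongrightarrow> dkern (2 * T) x y"
    proof -
      have "eventually (\<lambda>j. summable (\<lambda>n. norm (t n j))) sequentially \<and>
         summable (\<lambda>n. norm (exp (- (lam (Suc n))\<^sup>2 * (2 * T)) * (psi (Suc n) x * psi (Suc n) y))) \<and>
         ((\<lambda>j. \<Sum>n. t n j) \<longlongrightarrow> (\<Sum>n. exp (- (lam (Suc n))\<^sup>2 * (2 * T)) * (psi (Suc n) x * psi (Suc n) y))) sequentially"
      proof (rule tannerys_theorem)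
        fix n
        have "(\<lambda>j. exp (- (lam (Suc n))\<^sup>2 * (2 * T)) * (coef (g j) (Suc n) * coef (h j) (Suc n)))
            \<longlonglongrightarrow> exp (- (lam (Suc n))\<^sup>2 * (2 * T)) * (psi (Suc n) x * psi (Suc n) y)"
          using g(3) h(3) by (intro tendsto_intros) auto
        moreover have "\<forall>\<^sub>F j in sequentially. exp (- (lam (Suc n))\<^sup>2 * (2 * T)) * (coef (g j) (Suc n) * coef (h j) (Suc n)) = t n j"
          unfolding eventually_sequentially by (intro exI[of _ "Suc n"]) (auto simp: t_def N_def)
        ultimately show "t n \<longlonglongrightarrow> exp (- (lam (Suc n))\<^sup>2 * (2 * T)) * (psi (Suc n) x * psi (Suc n) y)"
          by (rule Lim_transform_eventually)
      next
        have "norm (t n j) \<le> C * (exp (- (lam (Suc n))\<^sup>2 * (2 * T)) * (1 + lam (Suc n)) powr \<bar>a\<bar>)" for n j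
        proof -
          have "\<bar>coef (g j) (Suc n) * coef (h j) (Suc n)\<bar> \<le> C * (1 + lam (Suc n)) powr \<bar>a\<bar>"
            by (rule abs_mult_le_of_squares_le) (use g(4) h(4) in auto)
          then have "exp (- (lam (Suc n))\<^sup>2 * (2 * T)) * \<bar>coef (g j) (Suc n) * coef (h j) (Suc n)\<bar>
              \<le> exp (- (lam (Suc n))\<^sup>2 * (2 * T)) * (C * (1 + lam (Suc n)) powr \<bar>a\<bar>)"
            by (intro mult_left_mono) auto
          moreover have "norm (t n j) \<le> exp (- (lam (Suc n))\<^sup>2 * (2 * T)) * \<bar>coef (g j) (Suc n) * coef (h j) (Suc n)\<bar>"
            by (simp add: t_def abs_mult)
          ultimately have "norm (t n j) \<le> exp (- (lam (Suc n))\<^sup>2 * (2 * T)) * (C * (1 + lam (Suc n)) powr \<bar>a\<bar>)"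
            by (rule order_trans[rotated])
          then show ?thesis by (simp only: mult.left_commute)
        qed
        then show "\<forall>\<^sub>F (n, j) in at_top \<times>\<^sub>F sequentially. norm (t n j)
            \<le> C * (exp (- (lam (Suc n))\<^sup>2 * (2 * T)) * (1 + lam (Suc n)) powr \<bar>a\<bar>)"
          by (intro always_eventually) auto
        show "summable (\<lambda>n. C * (exp (- (lam (Suc n))\<^sup>2 * (2 * T)) * (1 + lam (Suc n)) powr \<bar>a\<bar>))"
          using T by (intro summable_mult summable_heat_weights) auto
      qed simp
      then show ?thesis by (simp add: S_eq[abs_def] dkern_def)
    qed
    have mg: "moment (g j) (N j) x k T \<le> C * (T ^ k * dx) + \<delta> j" "moment (g j) (N j) x 0 T \<le> C * dx" for j
      using g(2) by (auto simp: N_def)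
    have mh: "moment (h j) (N j) y k T \<le> C * (T ^ k * dy) + \<epsilon> j" "moment (h j) (N j) y 0 T \<le> C * dy" for j
      using h(2) by (auto simp: N_def)
    have "(dkern (2 * T) x y)\<^sup>2 \<le> (C * dx) * (C * dy)"
    proof (rule LIMSEQ_le_const2)
      show "(\<lambda>j. (S j)\<^sup>2) \<longlonglongrightarrow> (dkern (2 * T) x y)\<^sup>2" by (intro tendsto_intros lim)
      have "(S j)\<^sup>2 \<le> (C * dx) * (C * dy)" for j
        unfolding S_def using mg(2) mh(2) C d
        by (intro order_trans[OF heat_sum_pairing_bounds(1)] mult_mono moment_nonneg) auto
      then show "\<exists>J. \<forall>j\<ge>J. (S j)\<^sup>2 \<le> (C * dx) * (C * dy)" by blast
    qed
    also have "\<dots> \<le> B * (dx * dy)"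
      using d C by (simp add: B_def distrib_right power2_eq_square mult_ac)
    finally have 1: "(dkern (2 * T) x y)\<^sup>2 \<le> B * (dx * dy)" .
    have "(\<bar>x - y\<bar> ^ k * dkern (2 * T) x y)\<^sup>2
        \<le> 2 * 4 ^ k * ((C * (T ^ k * dx) + 0) * (C * dy) + (C * (T ^ k * dy) + 0) * (C * dx))"
    proof (rule LIMSEQ_le)
      show "(\<lambda>j. (\<bar>x - y\<bar> ^ k * S j)\<^sup>2) \<longlonglongrightarrow> (\<bar>x - y\<bar> ^ k * dkern (2 * T) x y)\<^sup>2"
        by (intro tendsto_intros lim)
      show "(\<lambda>j. 2 * 4 ^ k * ((C * (T ^ k * dx) + \<delta> j) * (C * dy) + (C * (T ^ k * dy) + \<epsilon> j) * (C * dx)))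
        \<longlonglongrightarrow> 2 * 4 ^ k * ((C * (T ^ k * dx) + 0) * (C * dy) + (C * (T ^ k * dy) + 0) * (C * dx))"
        by (intro tendsto_intros g h)
      have "(\<bar>x - y\<bar> ^ k * S j)\<^sup>2 \<le> 2 * 4 ^ k * ((C * (T ^ k * dx) + \<delta> j) * (C * dy) + (C * (T ^ k * dy) + \<epsilon> j) * (C * dx))" for j
      proof -
        have "0 \<le> C * (T ^ k * dx) + \<delta> j" "0 \<le> C * (T ^ k * dy) + \<epsilon> j"
          using order_trans[OF moment_nonneg mg(1)] order_trans[OF moment_nonneg mh(1)] by auto
        then show ?thesis
          unfolding S_def using mg mh C d
          by (intro order_trans[OF heat_sum_pairing_bounds(2)] mult_left_mono add_mono mult_mono moment_nonneg) auto
      qed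
      then show "\<exists>J. \<forall>j\<ge>J. (\<bar>x - y\<bar> ^ k * S j)\<^sup>2
          \<le> 2 * 4 ^ k * ((C * (T ^ k * dx) + \<delta> j) * (C * dy) + (C * (T ^ k * dy) + \<epsilon> j) * (C * dx))" by blast
    qed
    also have "\<dots> = 4 * 4 ^ k * C\<^sup>2 * (T ^ k * (dx * dy))" by (simp add: power2_eq_square algebra_simps)
    also have "\<dots> \<le> B * (T ^ k * (dx * dy))"
      using d T by (intro mult_right_mono) (auto simp: B_def)
    finally show ?thesis using 1 by (simp add: dx_def dy_def)
  qed
  moreover have "B > 0" using C by (auto simp: B_def intro!: add_pos_nonneg)
  ultimately show ?thesis by blast
qed

end

section \<open>Marcinkiewicz interpolation\<close>

lemma nn_integral_powr_Icc:
  fixes r q :: real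
  assumes "r \<ge> 0" "q > -1"
  shows "(\<integral>\<^sup>+ s. ennreal (s powr q) * indicator {0..r} s \<partial>lborel) = ennreal (r powr (q + 1) / (q + 1))"
  by (rule nn_integral_has_integral_lebesgue') (use assms in \<open>auto intro: has_integral_powr_from_0\<close>)

text \<open>For finite \<open>b\<close> this integrates the derivative of \<open>s powr p\<close>;
  for infinite \<open>b\<close> the finite levels \<open>r\<close> already push the right-hand side
  above any finite value.\<close>

lemma ennreal_powr_le_layer_cake:
  assumes "p > 0"
  shows "ennreal_powr b p \<le> (\<integral>\<^sup>+ s. (if 0 < s \<and> ennreal s < b then ennreal (p * s powr (p - 1)) else 0) \<partial>lborel)"
    (is "_ \<le> ?R")
proof -
  have le: "ennreal (r powr p) \<le> ?R" if "r \<ge> 0" "ennreal r \<le> b" for r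
  proof -
    have "ennreal (r powr p) = ennreal p * (\<integral>\<^sup>+ s. ennreal (s powr (p - 1)) * indicator {0..r} s \<partial>lborel)"
      using assms that by (subst nn_integral_powr_Icc) (auto simp flip: ennreal_mult)
    also have "\<dots> = (\<integral>\<^sup>+ s. ennreal p * (ennreal (s powr (p - 1)) * indicator {0..r} s) \<partial>lborel)"
      by (rule nn_integral_cmult[symmetric]) measurable
    also have "\<dots> \<le> ?R"
    proof (rule nn_integral_mono_AE)
      \<comment> \<open>The points 0 and \<open>r\<close> are discarded as null sets, so that the
        strict inequalities on the right can be met.\<close>
      show "AE s in lborel. ennreal p * (ennreal (s powr (p - 1)) * indicator {0..r} s)
          \<le> (if 0 < s \<and> ennreal s < b then ennreal (p * s powr (p - 1)) else 0)"
        using AE_lborel_singleton[of r] AE_lborel_singleton[of 0]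
      proof eventually_elim
        case (elim s)
        show ?case
        proof (cases "0 < s \<and> s < r")
          case True
          then have "ennreal s < ennreal r" by (simp add: ennreal_less_iff)
          then have "ennreal s < b" using that(2) by (rule less_le_trans)
          then show ?thesis using True assms by (simp add: ennreal_mult')
        qed (use elim in \<open>auto split: split_indicator\<close>)
      qed
    qed
    finally show ?thesis .
  qed
  show ?thesis
  proof (cases "b = \<infinity>")
    case True
    have "?R = \<infinity>"
    proof (rule ccontr)
      assume "?R \<noteq> \<infinity>"
      then obtain v where v: "?R = ennreal v" "v \<ge> 0" by (cases ?R) auto
      define r where "r = (v + 1) powr (1 / p)"
      have "r powr p = v + 1" using assms v by (simp add: r_def powr_powr)
      then have "ennreal (v + 1) \<le> ennreal v" using le[of r] True v by (simp add: r_def)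
      then show False using v by simp
    qed
    then show ?thesis by simp
  next
    case False
    then obtain r where "r \<ge> 0" "b = ennreal r" by (cases b) auto
    then show ?thesis using le[of r] by (simp add: ennreal_powr_def)
  qed
qed

text \<open>Marcinkiewicz's argument between the exponents 1 and \<infinity>. The bounded part is
  already removed in \<open>weak\<close>: at level \<open>s\<close> only the part of
  \<open>h\<close> above \<open>c * s\<close> counts. After Fubini the inner integral is that of
  \<open>s powr (p - 2)\<close> up to \<open>h x / c\<close>, finite because
  \<open>p > 1\<close>.\<close>

lemma weak_type_to_strong_type:
  fixes G :: "'a \<Rightarrow> ennreal" and h :: "'a \<Rightarrow> real"
  assumes "sigma_finite_measure M" and G[measurable]: "G \<in> borel_measurable M" and h[measurable]: "h \<in> borel_measurable M"
    and hn: "\<And>x. h x \<ge> 0" and p: "p > 1" and A: "A \<ge> 0" and c: "c > 0"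
    and weak: "\<And>s. s > 0 \<Longrightarrow> emeasure M {x \<in> space M. ennreal s < G x}
       \<le> ennreal (A / s) * (\<integral>\<^sup>+ x. ennreal (h x) * indicator {x. c * s < h x} x \<partial>M)"
  shows "(\<integral>\<^sup>+ x. ennreal_powr (G x) p \<partial>M)
    \<le> ennreal (A * p * (1 / c) powr (p - 1) / (p - 1)) * (\<integral>\<^sup>+ x. ennreal (h x powr p) \<partial>M)"
proof -
  interpret sigma_finite_measure M by fact
  interpret P: pair_sigma_finite M "lborel :: real measure" ..
  define \<phi> where "\<phi> = (\<lambda>s::real. ennreal (p * s powr (p - 1)))"
  have [measurable]: "\<phi> \<in> borel_measurable borel" unfolding \<phi>_def by measurable
  have "(\<integral>\<^sup>+ x. ennreal_powr (G x) p \<partial>M) \<le> (\<integral>\<^sup>+ x. (\<integral>\<^sup>+ s. (if 0 < s \<and> ennreal s < G x then \<phi> s else 0) \<partial>lborel) \<partial>M)"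
    unfolding \<phi>_def using p by (intro nn_integral_mono ennreal_powr_le_layer_cake) auto
  also have "\<dots> = (\<integral>\<^sup>+ s. (\<integral>\<^sup>+ x. (if 0 < s \<and> ennreal s < G x then \<phi> s else 0) \<partial>M) \<partial>lborel)"
    by (rule P.Fubini'[symmetric]) measurable
  also have "\<dots> \<le> (\<integral>\<^sup>+ s. (\<integral>\<^sup>+ x. (if 0 < s \<and> c * s < h x then ennreal (A * p * s powr (p - 2)) * ennreal (h x) else 0) \<partial>M) \<partial>lborel)"
  proof (rule nn_integral_mono)
    fix s :: real
    show "(\<integral>\<^sup>+ x. (if 0 < s \<and> ennreal s < G x then \<phi> s else 0) \<partial>M)
        \<le> (\<integral>\<^sup>+ x. (if 0 < s \<and> c * s < h x then ennreal (A * p * s powr (p - 2)) * ennreal (h x) else 0) \<partial>M)"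
    proof (cases "s > 0")
      case True
      have "(\<integral>\<^sup>+ x. (if 0 < s \<and> ennreal s < G x then \<phi> s else 0) \<partial>M)
          = (\<integral>\<^sup>+ x. \<phi> s * indicator {x \<in> space M. ennreal s < G x} x \<partial>M)"
        using True by (intro nn_integral_cong) (auto split: split_indicator)
      also have "\<dots> = \<phi> s * emeasure M {x \<in> space M. ennreal s < G x}"
        by (rule nn_integral_cmult_indicator) measurable
      also have "\<dots> \<le> \<phi> s * (ennreal (A / s) * (\<integral>\<^sup>+ x. ennreal (h x) * indicator {x. c * s < h x} x \<partial>M))"
        by (intro mult_left_mono weak True) auto
      also have "\<dots> = (\<phi> s * ennreal (A / s)) * (\<integral>\<^sup>+ x. ennreal (h x) * indicator {x. c * s < h x} x \<partial>M)"
        by (simp add: mult.assoc)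
      also have "\<phi> s * ennreal (A / s) = ennreal (A * p * s powr (p - 2))"
      proof -
        have "s powr (p - 1) = s powr (p - 2) * s" using True powr_add[of s "p - 2" 1] by simp
        then have "p * s powr (p - 1) * (A / s) = A * p * s powr (p - 2)" using True by simp
        then show ?thesis unfolding \<phi>_def using p A True by (subst ennreal_mult[symmetric]) auto
      qed
      also have "ennreal (A * p * s powr (p - 2)) * (\<integral>\<^sup>+ x. ennreal (h x) * indicator {x. c * s < h x} x \<partial>M)
          = (\<integral>\<^sup>+ x. ennreal (A * p * s powr (p - 2)) * (ennreal (h x) * indicator {x. c * s < h x} x) \<partial>M)"
        by (rule nn_integral_cmult[symmetric]) measurable
      also have "\<dots> = (\<integral>\<^sup>+ x. (if 0 < s \<and> c * s < h x then ennreal (A * p * s powr (p - 2)) * ennreal (h x) else 0) \<partial>M)"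
        using True by (intro nn_integral_cong) (auto split: split_indicator)
      finally show ?thesis .
    qed simp
  qed
  also have "\<dots> = (\<integral>\<^sup>+ x. (\<integral>\<^sup>+ s. (if 0 < s \<and> c * s < h x then ennreal (A * p * s powr (p - 2)) * ennreal (h x) else 0) \<partial>lborel) \<partial>M)"
    by (rule P.Fubini') measurable
  also have "\<dots> \<le> (\<integral>\<^sup>+ x. ennreal (A * p * (1 / c) powr (p - 1) / (p - 1)) * ennreal (h x powr p) \<partial>M)"
  proof (rule nn_integral_mono)
    fix x
    have "(\<integral>\<^sup>+ s. (if 0 < s \<and> c * s < h x then ennreal (A * p * s powr (p - 2)) * ennreal (h x) else 0) \<partial>lborel)
        \<le> (\<integral>\<^sup>+ s. ennreal (A * p * h x) * (ennreal (s powr (p - 2)) * indicator {0..h x / c} s) \<partial>lborel)"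
    proof (rule nn_integral_mono)
      fix s :: real
      have "s \<le> h x / c" if "c * s < h x" using that c by (simp add: field_simps)
      then show "(if 0 < s \<and> c * s < h x then ennreal (A * p * s powr (p - 2)) * ennreal (h x) else 0)
          \<le> ennreal (A * p * h x) * (ennreal (s powr (p - 2)) * indicator {0..h x / c} s)"
        using A p hn[of x] by (auto split: split_indicator simp: mult_ac simp flip: ennreal_mult)
    qed
    also have "\<dots> = ennreal (A * p * h x) * (\<integral>\<^sup>+ s. ennreal (s powr (p - 2)) * indicator {0..h x / c} s \<partial>lborel)"
      by (rule nn_integral_cmult) measurable
    also have "\<dots> = ennreal (A * p * h x) * ennreal ((h x / c) powr (p - 2 + 1) / (p - 2 + 1))"
      using hn[of x] c p by (subst nn_integral_powr_Icc) auto
    also have "\<dots> = ennreal (A * p * (1 / c) powr (p - 1) / (p - 1)) * ennreal (h x powr p)"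
    proof -
      have "(h x / c) powr (p - 1) = h x powr (p - 1) * (1 / c) powr (p - 1)"
        using powr_mult[of "h x" "1 / c" "p - 1"] hn[of x] c by simp
      moreover have "h x * h x powr (p - 1) = h x powr p"
        using powr_add[of "h x" 1 "p - 1"] hn[of x] by (cases "h x = 0") auto
      ultimately have "A * p * h x * ((h x / c) powr (p - 1) / (p - 1))
          = A * p * (1 / c) powr (p - 1) / (p - 1) * h x powr p"
        by (simp add: mult_ac)
      then show ?thesis using A p hn[of x] by (simp flip: ennreal_mult)
    qed
    finally show "(\<integral>\<^sup>+ s. (if 0 < s \<and> c * s < h x then ennreal (A * p * s powr (p - 2)) * ennreal (h x) else 0) \<partial>lborel)
        \<le> ennreal (A * p * (1 / c) powr (p - 1) / (p - 1)) * ennreal (h x powr p)" .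
  qed
  also have "\<dots> = ennreal (A * p * (1 / c) powr (p - 1) / (p - 1)) * (\<integral>\<^sup>+ x. ennreal (h x powr p) \<partial>M)"
    by (rule nn_integral_cmult) measurable
  finally show ?thesis .
qed

section \<open>The Hardy--Littlewood maximal function\<close>

context bessel
begin

section \<open>The measure \<open>eta\<close> and its balls\<close>

lemma space_eta [simp]: "space (eta \<nu>) = {0<..<1}"
  by (simp add: eta_def space_restrict_space)

lemma sets_eta: "sets (eta \<nu>) = sets (restrict_space borel {0<..<1})"
  by (simp add: eta_def sets_restrict_space)

lemma borel_measurable_eta: "f \<in> borel_measurable borel \<Longrightarrow> f \<in> borel_measurable (eta \<nu>)"
  using measurable_restrict_space1[of f borel borel "{0<..<1}"] measurable_cong_sets[OF sets_eta refl]
  by blast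

lemma phi_1_measurable: "(\<lambda>x. ennreal (x powr a * (psi 1 x)\<^sup>2)) \<in> borel_measurable borel"
proof -
  have "psi 1 \<in> borel_measurable borel"
    by (intro borel_measurable_continuous_onI continuous_on_psi continuous_on_id)
  then show ?thesis by measurable
qed

text \<open>The density of \<open>eta\<close> is expressed through \<open>phi\<close>; on the unit
  interval it agrees with the one built from the continuous function \<open>psi 1\<close>, which
  supplies its measurability.\<close>

lemma nn_integral_eta:
  assumes "f \<in> borel_measurable borel"
  shows "(\<integral>\<^sup>+ y. f y \<partial>eta \<nu>) = (\<integral>\<^sup>+ y. ennreal (y powr a * (psi 1 y)\<^sup>2) * f y * indicator {0<..<1} y \<partial>lborel)"
proof -
  have "eta \<nu> = density (restrict_space lborel {0<..<1}) (\<lambda>x. ennreal (x powr a * (psi 1 x)\<^sup>2))"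
    unfolding eta_def
  proof (rule density_cong)
    show 1: "(\<lambda>x. ennreal (x powr a * (psi 1 x)\<^sup>2)) \<in> borel_measurable (restrict_space lborel {0<..<1})"
      using phi_1_measurable by (intro measurable_restrict_space1) simp
    show "AE x in restrict_space lborel {0<..<1}. ennreal (x powr (2 * \<nu> + 1) * (phi \<nu> 1 x)\<^sup>2) = ennreal (x powr a * (psi 1 x)\<^sup>2)"
      by (rule AE_I2) (auto simp: a_def phi_eq_psi space_restrict_space)
    have "(\<lambda>x. ennreal (x powr (2 * \<nu> + 1) * (phi \<nu> 1 x)\<^sup>2)) \<in> borel_measurable (restrict_space lborel {0<..<1})
        \<longleftrightarrow> (\<lambda>x. ennreal (x powr a * (psi 1 x)\<^sup>2)) \<in> borel_measurable (restrict_space lborel {0<..<1})"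
      by (rule measurable_cong) (auto simp: a_def phi_eq_psi space_restrict_space)
    then show "(\<lambda>x. ennreal (x powr (2 * \<nu> + 1) * (phi \<nu> 1 x)\<^sup>2)) \<in> borel_measurable (restrict_space lborel {0<..<1})"
      using 1 by blast
  qed
  moreover have "f \<in> borel_measurable (restrict_space lborel {0<..<1})"
    using assms by (intro measurable_restrict_space1) simp
  moreover have "(\<lambda>x. ennreal (x powr a * (psi 1 x)\<^sup>2)) \<in> borel_measurable (restrict_space lborel {0<..<1})"
    using phi_1_measurable by (intro measurable_restrict_space1) simp
  ultimately show ?thesis
    by (simp add: nn_integral_density nn_integral_restrict_space)
qed

lemma psi_1_upper: "\<exists>C>0. \<forall>x. 0 < x \<longrightarrow> x < 1 \<longrightarrow> (psi 1 x)\<^sup>2 \<le> C * (1 - x)\<^sup>2"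
proof -
  obtain B where B: "B > 0" and B': "\<forall>n\<ge>1. \<forall>x. 0 < x \<longrightarrow> x \<le> 1 \<longrightarrow>
     (psi n x)\<^sup>2 \<le> B * (x + 1 / lam n) powr (- a) * ((1 - x) / (1 - x + 1 / lam n))\<^sup>2"
    using psi_bound by blast
  define l where "l = 1 / lam 1"
  have l: "l > 0" using lam_pos[of 1] by (simp add: l_def)
  define c where "c = (1 + l) / l"
  have c: "c \<ge> 1" using l by (simp add: c_def)
  have "(psi 1 x)\<^sup>2 \<le> (B * (c powr \<bar>a\<bar> * l powr (- a)) / l\<^sup>2) * (1 - x)\<^sup>2" if x: "0 < x" "x < 1" for x
  proof -
    have "(x + l) powr (- a) \<le> c powr \<bar>- a\<bar> * l powr (- a)"
    proof (rule powr_comparable)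
      have "x + l \<le> 1 + l" using x by simp
      then show "x + l \<le> c * l" using l by (simp add: c_def)
      show "l \<le> c * (x + l)" using c l x mult_mono[of 1 c l "x + l"] by simp
    qed (use x l c in auto)
    moreover have "((1 - x) / (1 - x + l))\<^sup>2 \<le> (1 - x)\<^sup>2 / l\<^sup>2"
      unfolding power_divide using x l by (intro divide_left_mono power_mono) auto
    ultimately have "B * (x + l) powr (- a) * ((1 - x) / (1 - x + l))\<^sup>2
        \<le> B * (c powr \<bar>a\<bar> * l powr (- a)) * ((1 - x)\<^sup>2 / l\<^sup>2)"
      using B by (intro mult_mono mult_left_mono) auto
    then show ?thesis using B'[rule_format, of 1 x] x by (simp add: l_def)
  qed
  moreover have "B * (c powr \<bar>a\<bar> * l powr (- a)) / l\<^sup>2 > 0" using B l c by simp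
  ultimately show ?thesis by blast
qed

text \<open>If \<open>x \<le> 2 * R\<close>, the weight is integrated from 0 on, where
  \<open>a > -1\<close> makes it integrable; otherwise all points of the ball are comparable to
  \<open>x + R\<close> with ratio at most 3. The ground state contributes
  \<open>(1 - x + R)^2\<close>.\<close>

lemma emeasure_eta_ball:
  "\<exists>C>0. \<forall>x R. 0 < x \<longrightarrow> x < 1 \<longrightarrow> 0 < R \<longrightarrow> emeasure (eta \<nu>) (ball x R \<inter> {0<..<1}) \<le> ennreal (C * vol x R)"
proof -
  obtain B where B: "B > 0" and B': "\<forall>x. 0 < x \<longrightarrow> x < 1 \<longrightarrow> (psi 1 x)\<^sup>2 \<le> B * (1 - x)\<^sup>2"
    using psi_1_upper by blast
  define K where "K = 3 / (a + 1) + 2 * 3 powr \<bar>a\<bar>"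
  have K: "K > 0" using a_gt by (auto simp: K_def intro!: add_pos_nonneg)
  have "emeasure (eta \<nu>) (ball x R \<inter> {0<..<1}) \<le> ennreal ((B * K) * vol x R)"
    if x: "0 < x" "x < 1" and R: "0 < R" for x R
  proof -
    define I where "I = {y. \<bar>y - x\<bar> < R \<and> 0 < y \<and> y < 1}"
    have I_eq: "ball x R \<inter> {0<..<1} = I" by (auto simp: I_def dist_real_def)
    have Im[measurable]: "I \<in> sets borel" unfolding I_eq[symmetric] by auto
    define w where "w = (\<integral>\<^sup>+ y. ennreal (y powr a) * indicator I y \<partial>lborel)"
    have w: "w \<le> ennreal (K * (R * (x + R) powr a))"
    proof (cases "x \<le> 2 * R")
      case True
      have "w \<le> (\<integral>\<^sup>+ y. ennreal (y powr a) * indicator {0..x + R} y \<partial>lborel)"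
        unfolding w_def by (intro nn_integral_mono) (auto split: split_indicator simp: I_def)
      also have "\<dots> = ennreal ((x + R) powr (a + 1) / (a + 1))"
        using x R a_gt by (intro nn_integral_powr_Icc) auto
      also have "\<dots> \<le> ennreal (K * (R * (x + R) powr a))"
      proof (rule ennreal_leI)
        have "(x + R) powr (a + 1) / (a + 1) = (x + R) * (x + R) powr a / (a + 1)"
          using x R by (simp add: powr_add)
        also have "\<dots> \<le> (3 * R) * (x + R) powr a / (a + 1)"
          using True a_gt by (intro divide_right_mono mult_right_mono) auto
        also have "\<dots> = 3 / (a + 1) * (R * (x + R) powr a)" by simp
        also have "\<dots> \<le> K * (R * (x + R) powr a)"
          using R by (intro mult_right_mono) (auto simp: K_def)
        finally show "(x + R) powr (a + 1) / (a + 1) \<le> K * (R * (x + R) powr a)" .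
      qed
      finally show ?thesis .
    next
      case False
      have "w \<le> (\<integral>\<^sup>+ y. ennreal (3 powr \<bar>a\<bar> * (x + R) powr a) * indicator {x - R..x + R} y \<partial>lborel)"
        unfolding w_def
      proof (rule nn_integral_mono)
        fix y
        show "ennreal (y powr a) * indicator I y \<le> ennreal (3 powr \<bar>a\<bar> * (x + R) powr a) * indicator {x - R..x + R} y"
        proof (cases "y \<in> I")
          case True
          then have y: "x - R < y" "y < x + R" "0 < y" by (auto simp: I_def abs_less_iff)
          have "y powr a \<le> 3 powr \<bar>a\<bar> * (x + R) powr a"
            by (rule powr_comparable) (use y False x R in auto)
          then show ?thesis using y by (auto split: split_indicator intro: ennreal_leI)
        qed simp
      qed
      also have "\<dots> = ennreal (3 powr \<bar>a\<bar> * (x + R) powr a) * ennreal (2 * R)"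
        using R by (subst nn_integral_cmult_indicator) auto
      also have "\<dots> = ennreal (2 * 3 powr \<bar>a\<bar> * (R * (x + R) powr a))"
        using R by (subst ennreal_mult[symmetric]) (auto simp: mult_ac)
      also have "\<dots> \<le> ennreal (K * (R * (x + R) powr a))"
        using R a_gt by (intro ennreal_leI mult_right_mono) (auto simp: K_def)
      finally show ?thesis .
    qed
    have "emeasure (eta \<nu>) (ball x R \<inter> {0<..<1}) = (\<integral>\<^sup>+ y. indicator I y \<partial>eta \<nu>)"
      unfolding I_eq using Im by (subst nn_integral_indicator)
        (auto simp: sets_eta sets_restrict_space_iff I_def)
    also have "\<dots> = (\<integral>\<^sup>+ y. ennreal (y powr a * (psi 1 y)\<^sup>2) * indicator I y * indicator {0<..<1} y \<partial>lborel)"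
      using Im by (intro nn_integral_eta) auto
    also have "\<dots> \<le> (\<integral>\<^sup>+ y. ennreal (B * (1 - x + R)\<^sup>2) * (ennreal (y powr a) * indicator I y) \<partial>lborel)"
    proof (rule nn_integral_mono)
      fix y
      show "ennreal (y powr a * (psi 1 y)\<^sup>2) * indicator I y * indicator {0<..<1} y
          \<le> ennreal (B * (1 - x + R)\<^sup>2) * (ennreal (y powr a) * indicator I y)"
      proof (cases "y \<in> I")
        case True
        then have y: "0 < y" "y < 1" "x - R < y" by (auto simp: I_def abs_less_iff)
        have "(psi 1 y)\<^sup>2 \<le> B * (1 - y)\<^sup>2" using B' y by blast
        also have "\<dots> \<le> B * (1 - x + R)\<^sup>2" using y B by (intro mult_left_mono power_mono) auto
        finally have "y powr a * (psi 1 y)\<^sup>2 \<le> y powr a * (B * (1 - x + R)\<^sup>2)" by (intro mult_left_mono) auto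
        then show ?thesis using True y B
          by (simp add: ennreal_leI mult.commute flip: ennreal_mult)
      qed simp
    qed
    also have "\<dots> = ennreal (B * (1 - x + R)\<^sup>2) * w"
      unfolding w_def using Im by (intro nn_integral_cmult) measurable
    also have "\<dots> \<le> ennreal (B * (1 - x + R)\<^sup>2) * ennreal (K * (R * (x + R) powr a))"
      by (intro mult_left_mono w) auto
    also have "\<dots> = ennreal ((B * K) * vol x R)"
      using B K R by (simp add: vol_def mult_ac flip: ennreal_mult)
    finally show ?thesis .
  qed
  then show ?thesis using B K by (intro exI[of _ "B * K"]) auto
qed

text \<open>Averages are normalised by \<open>vol\<close>, which obeys explicit scaling laws, in
  place of the measure of the ball; \<open>emeasure_eta_ball\<close> links the two. Radii up to 1
  suffice because the unit interval has diameter 1.\<close>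

definition HL :: "(real \<Rightarrow> ennreal) \<Rightarrow> real \<Rightarrow> ennreal" where
  "HL h x = (SUP R\<in>{0<..1}. ennreal (1 / vol x R) * (\<integral>\<^sup>+ y. h y * indicator (ball x R) y \<partial>eta \<nu>))"

lemma nn_integral_ball_le_HL:
  assumes "0 < x" "x < 1" "0 < R" "R \<le> 1"
  shows "(\<integral>\<^sup>+ y. h y * indicator (ball x R) y \<partial>eta \<nu>) \<le> ennreal (vol x R) * HL h x"
proof -
  have v: "vol x R > 0" using assms by (intro vol_pos)
  have "ennreal (1 / vol x R) * (\<integral>\<^sup>+ y. h y * indicator (ball x R) y \<partial>eta \<nu>) \<le> HL h x"
    unfolding HL_def using assms by (intro SUP_upper) auto
  then have "ennreal (vol x R) * (ennreal (1 / vol x R) * (\<integral>\<^sup>+ y. h y * indicator (ball x R) y \<partial>eta \<nu>))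
      \<le> ennreal (vol x R) * HL h x" by (rule mult_left_mono) simp
  moreover have "ennreal (vol x R) * ennreal (1 / vol x R) = 1"
    using v by (subst ennreal_mult[symmetric]) auto
  ultimately show ?thesis by (simp flip: mult.assoc)
qed

lemma HL_leI:
  assumes x: "0 < x" "x < 1" and "\<And>R. 0 < R \<Longrightarrow> R \<le> 1 \<Longrightarrow>
    (\<integral>\<^sup>+ y. h y * indicator (ball x R) y \<partial>eta \<nu>) \<le> ennreal (vol x R) * B"
  shows "HL h x \<le> B"
  unfolding HL_def
proof (rule SUP_least)
  fix R :: real assume R: "R \<in> {0<..1}"
  have v: "vol x R > 0" using x R by (intro vol_pos) auto
  have "ennreal (1 / vol x R) * (\<integral>\<^sup>+ y. h y * indicator (ball x R) y \<partial>eta \<nu>) \<le> ennreal (1 / vol x R) * (ennreal (vol x R) * B)"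
    using assms(3) R by (intro mult_left_mono) auto
  also have "\<dots> = B"
    using v by (simp add: mult.assoc[symmetric] ennreal_mult[symmetric])
  finally show "ennreal (1 / vol x R) * (\<integral>\<^sup>+ y. h y * indicator (ball x R) y \<partial>eta \<nu>) \<le> B" .
qed

lemma indicator_ball_measurable: "(indicator (ball x R) :: real \<Rightarrow> ennreal) \<in> borel_measurable (eta \<nu>)"
  by (intro borel_measurable_eta borel_measurable_indicator borel_open open_ball)

lemma HL_add:
  assumes h: "h1 \<in> borel_measurable (eta \<nu>)" "h2 \<in> borel_measurable (eta \<nu>)" and x: "0 < x" "x < 1"
  shows "HL (\<lambda>y. h1 y + h2 y) x \<le> HL h1 x + HL h2 x"
proof (rule HL_leI[OF x])
  fix R :: real assume R: "0 < R" "R \<le> 1"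
  note [measurable] = h indicator_ball_measurable
  have "(\<integral>\<^sup>+ y. (h1 y + h2 y) * indicator (ball x R) y \<partial>eta \<nu>)
      = (\<integral>\<^sup>+ y. h1 y * indicator (ball x R) y \<partial>eta \<nu>) + (\<integral>\<^sup>+ y. h2 y * indicator (ball x R) y \<partial>eta \<nu>)"
    unfolding distrib_right by (rule nn_integral_add) measurable
  also have "\<dots> \<le> ennreal (vol x R) * HL h1 x + ennreal (vol x R) * HL h2 x"
    by (intro add_mono nn_integral_ball_le_HL x R)
  finally show "(\<integral>\<^sup>+ y. (h1 y + h2 y) * indicator (ball x R) y \<partial>eta \<nu>) \<le> ennreal (vol x R) * (HL h1 x + HL h2 x)"
    by (simp add: distrib_left)
qed

lemma HL_bounded:
  "\<exists>C>0. \<forall>h b x. (AE y in eta \<nu>. h y \<le> b) \<longrightarrow> 0 < x \<longrightarrow> x < 1 \<longrightarrow> HL h x \<le> ennreal C * b"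
proof -
  obtain C where C: "C > 0" and C': "\<forall>x R. 0 < x \<longrightarrow> x < 1 \<longrightarrow> 0 < R \<longrightarrow>
      emeasure (eta \<nu>) (ball x R \<inter> {0<..<1}) \<le> ennreal (C * vol x R)"
    using emeasure_eta_ball by blast
  have "HL h x \<le> ennreal C * b" if h: "AE y in eta \<nu>. h y \<le> b" and x: "0 < x" "x < 1" for h b x
  proof (rule HL_leI[OF x])
    fix R :: real assume R: "0 < R" "R \<le> 1"
    have B: "ball x R \<inter> {0<..<1} \<in> sets (eta \<nu>)"
      by (auto simp: sets_eta sets_restrict_space_iff)
    have "(\<integral>\<^sup>+ y. h y * indicator (ball x R) y \<partial>eta \<nu>) \<le> (\<integral>\<^sup>+ y. b * indicator (ball x R \<inter> {0<..<1}) y \<partial>eta \<nu>)"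
    proof (rule nn_integral_mono_AE)
      show "AE y in eta \<nu>. h y * indicator (ball x R) y \<le> b * indicator (ball x R \<inter> {0<..<1}) y"
        using h AE_space by eventually_elim (auto split: split_indicator)
    qed
    also have "\<dots> = b * emeasure (eta \<nu>) (ball x R \<inter> {0<..<1})" using B by (rule nn_integral_cmult_indicator)
    also have "\<dots> \<le> b * ennreal (C * vol x R)" using C' x R by (intro mult_left_mono) auto
    also have "\<dots> = ennreal (vol x R) * (ennreal C * b)"
      using C by (simp add: ennreal_mult' mult_ac)
    finally show "(\<integral>\<^sup>+ y. h y * indicator (ball x R) y \<partial>eta \<nu>) \<le> ennreal (vol x R) * (ennreal C * b)" .
  qed
  then show ?thesis using C by blast
qed

text \<open>An enclosing measurable set \<open>A\<close> takes the place of measurability of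
  \<open>HL h\<close>. Vitali's lemma selects disjoint balls whose fivefold enlargements cover the
  level set; enlarging costs a factor \<open>5 powr (3 + |a|)\<close> in \<open>vol\<close>.\<close>

theorem HL_weak_type:
  "\<exists>C>0. \<forall>h\<in>borel_measurable (eta \<nu>). \<forall>s>0. \<exists>A\<in>sets (eta \<nu>).
     {x \<in> {0<..<1}. ennreal s < HL h x} \<subseteq> A \<and> emeasure (eta \<nu>) A \<le> ennreal (C / s) * (\<integral>\<^sup>+ y. h y \<partial>eta \<nu>)"
proof -
  obtain B where B: "B > 0" and B': "\<forall>x R. 0 < x \<longrightarrow> x < 1 \<longrightarrow> 0 < R \<longrightarrow>
      emeasure (eta \<nu>) (ball x R \<inter> {0<..<1}) \<le> ennreal (B * vol x R)"
    using emeasure_eta_ball by blast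
  define D where "D = B * 5 powr (3 + \<bar>a\<bar>)"
  have D: "D > 0" using B by (simp add: D_def)
  have "\<exists>A\<in>sets (eta \<nu>). {x \<in> {0<..<1}. ennreal s < HL h x} \<subseteq> A
      \<and> emeasure (eta \<nu>) A \<le> ennreal (D / s) * (\<integral>\<^sup>+ y. h y \<partial>eta \<nu>)"
    if h[measurable]: "h \<in> borel_measurable (eta \<nu>)" and s: "s > 0" for h s
  proof -
    note [measurable] = indicator_ball_measurable
    define K where "K = {x \<in> {0<..<1}. ennreal s < HL h x}"
    have "\<forall>x\<in>K. \<exists>R. 0 < R \<and> R \<le> 1 \<and> ennreal (s * vol x R) \<le> (\<integral>\<^sup>+ y. h y * indicator (ball x R) y \<partial>eta \<nu>)"
    proof
      fix x assume "x \<in> K"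
      then have x: "0 < x" "x < 1" and less: "ennreal s < HL h x" by (auto simp: K_def)
      from less obtain R where R: "0 < R" "R \<le> 1"
        "ennreal s < ennreal (1 / vol x R) * (\<integral>\<^sup>+ y. h y * indicator (ball x R) y \<partial>eta \<nu>)"
        unfolding HL_def less_SUP_iff by auto
      have v: "vol x R > 0" using x R by (intro vol_pos) auto
      have "ennreal (vol x R) * ennreal s \<le> ennreal (vol x R) * (ennreal (1 / vol x R) * (\<integral>\<^sup>+ y. h y * indicator (ball x R) y \<partial>eta \<nu>))"
        using R(3) by (intro mult_left_mono) auto
      also have "\<dots> = (\<integral>\<^sup>+ y. h y * indicator (ball x R) y \<partial>eta \<nu>)"
        using v by (simp add: mult.assoc[symmetric] ennreal_mult[symmetric])
      finally have "ennreal (s * vol x R) \<le> (\<integral>\<^sup>+ y. h y * indicator (ball x R) y \<partial>eta \<nu>)"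
        using v s by (simp add: ennreal_mult' mult.commute)
      then show "\<exists>R. 0 < R \<and> R \<le> 1 \<and> ennreal (s * vol x R) \<le> (\<integral>\<^sup>+ y. h y * indicator (ball x R) y \<partial>eta \<nu>)"
        using R by blast
    qed
    then obtain r where r: "\<And>x. x \<in> K \<Longrightarrow> 0 < r x \<and> r x \<le> 1"
      "\<And>x. x \<in> K \<Longrightarrow> ennreal (s * vol x (r x)) \<le> (\<integral>\<^sup>+ y. h y * indicator (ball x (r x)) y \<partial>eta \<nu>)"
      by (auto dest!: bchoice)
    have "K \<subseteq> (\<Union>x\<in>K. ball x (r x))" using r(1) by force
    from Vitali_covering_lemma_balls[where a = "\<lambda>x. x", OF this r(1)]
    obtain C where C: "countable C" "C \<subseteq> K" "pairwise (\<lambda>i j. disjnt (ball i (r i)) (ball j (r j))) C"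
      "K \<subseteq> (\<Union>i\<in>C. ball i (5 * r i))" by blast
    define E where "E = (\<lambda>i. ball i (5 * r i) \<inter> {0<..<1})"
    have Em[measurable]: "E i \<in> sets (eta \<nu>)" for i
      unfolding E_def by (auto simp: sets_eta sets_restrict_space_iff)
    define A where "A = (\<Union>i\<in>C. E i)"
    have Am: "A \<in> sets (eta \<nu>)" unfolding A_def using C(1) by (intro sets.countable_UN'') auto
    \<comment> \<open>Sums over the countable set \<open>C\<close> are written as integrals for
      counting measure, so that both exchanges below are one theorem.\<close>
    have "emeasure (eta \<nu>) A = (\<integral>\<^sup>+ y. indicator A y \<partial>eta \<nu>)" using Am by simp
    also have "\<dots> \<le> (\<integral>\<^sup>+ y. (\<integral>\<^sup>+ i. indicator (E i) y \<partial>count_space C) \<partial>eta \<nu>)"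
    proof (rule nn_integral_mono)
      fix y
      show "indicator A y \<le> (\<integral>\<^sup>+ i. indicator (E i) y \<partial>count_space C)"
      proof (cases "y \<in> A")
        case True
        then obtain i where "i \<in> C" "y \<in> E i" by (auto simp: A_def)
        then show ?thesis using nn_integral_ge_point[of i C "\<lambda>i. indicator (E i) y"] True by simp
      qed simp
    qed
    also have "\<dots> = (\<integral>\<^sup>+ i. (\<integral>\<^sup>+ y. indicator (E i) y \<partial>eta \<nu>) \<partial>count_space C)"
      by (rule nn_integral_count_space_nn_integral[OF C(1)]) measurable
    also have "\<dots> \<le> (\<integral>\<^sup>+ i. (\<integral>\<^sup>+ y. ennreal (D / s) * (h y * indicator (ball i (r i)) y) \<partial>eta \<nu>) \<partial>count_space C)"
    proof (rule nn_integral_mono)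
      fix i assume "i \<in> space (count_space C)"
      then have i: "i \<in> K" "0 < i" "i < 1" using C(2) by (auto simp: K_def)
      have ri: "0 < r i" "r i \<le> 1" using r(1)[OF i(1)] by auto
      have "(\<integral>\<^sup>+ y. indicator (E i) y \<partial>eta \<nu>) = emeasure (eta \<nu>) (E i)" by simp
      also have "\<dots> \<le> ennreal (B * vol i (5 * r i))" unfolding E_def using B' i ri by simp
      also have "\<dots> \<le> ennreal (D * vol i (r i))"
      proof (rule ennreal_leI)
        have "vol i (5 * r i) \<le> (5 * r i / r i) powr (3 + \<bar>a\<bar>) * vol i (r i)"
          using i ri by (intro vol_mono_scale) auto
        then show "B * vol i (5 * r i) \<le> D * vol i (r i)"
          using B ri by (simp add: D_def mult.assoc)
      qed
      also have "\<dots> = ennreal (D / s) * ennreal (s * vol i (r i))"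
        using D s vol_pos[OF i(2,3) ri(1)] by (simp flip: ennreal_mult)
      also have "\<dots> \<le> ennreal (D / s) * (\<integral>\<^sup>+ y. h y * indicator (ball i (r i)) y \<partial>eta \<nu>)"
        by (intro mult_left_mono r(2) i) auto
      also have "\<dots> = (\<integral>\<^sup>+ y. ennreal (D / s) * (h y * indicator (ball i (r i)) y) \<partial>eta \<nu>)"
        by (rule nn_integral_cmult[symmetric]) measurable
      finally show "(\<integral>\<^sup>+ y. indicator (E i) y \<partial>eta \<nu>)
          \<le> (\<integral>\<^sup>+ y. ennreal (D / s) * (h y * indicator (ball i (r i)) y) \<partial>eta \<nu>)" .
    qed
    also have "\<dots> = (\<integral>\<^sup>+ y. (\<integral>\<^sup>+ i. ennreal (D / s) * (h y * indicator (ball i (r i)) y) \<partial>count_space C) \<partial>eta \<nu>)"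
      by (rule nn_integral_count_space_nn_integral[OF C(1), symmetric]) measurable
    \<comment> \<open>By disjointness, \<open>y\<close> lies in at most one of the selected
      balls.\<close>
    also have "\<dots> \<le> (\<integral>\<^sup>+ y. ennreal (D / s) * h y \<partial>eta \<nu>)"
    proof (rule nn_integral_mono)
      fix y
      show "(\<integral>\<^sup>+ i. ennreal (D / s) * (h y * indicator (ball i (r i)) y) \<partial>count_space C) \<le> ennreal (D / s) * h y"
      proof (cases "\<exists>j\<in>C. y \<in> ball j (r j)")
        case True
        then obtain j where j: "j \<in> C" "y \<in> ball j (r j)" by blast
        have only_j: "i = j" if "i \<in> C" "y \<in> ball i (r i)" for i
        proof (rule ccontr)
          assume "i \<noteq> j"
          then have "disjnt (ball i (r i)) (ball j (r j))" using C(3) that(1) j(1) by (simp add: pairwise_def)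
          then show False using that(2) j(2) unfolding disjnt_iff by blast
        qed
        have "(\<integral>\<^sup>+ i. ennreal (D / s) * (h y * indicator (ball i (r i)) y) \<partial>count_space C)
            \<le> (\<integral>\<^sup>+ i. (ennreal (D / s) * h y) * indicator {j} i \<partial>count_space C)"
        proof (rule nn_integral_mono)
          fix i assume "i \<in> space (count_space C)"
          then show "ennreal (D / s) * (h y * indicator (ball i (r i)) y) \<le> (ennreal (D / s) * h y) * indicator {j} i"
            using only_j[of i] by (cases "y \<in> ball i (r i)") (simp_all del: mem_ball)
        qed
        also have "\<dots> = (ennreal (D / s) * h y) * emeasure (count_space C) {j}"
          using j by (intro nn_integral_cmult_indicator) auto
        also have "emeasure (count_space C) {j} = 1" using j by (subst emeasure_count_space) auto
        finally show ?thesis by simp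
      next
        case False
        then have "(\<integral>\<^sup>+ i. ennreal (D / s) * (h y * indicator (ball i (r i)) y) \<partial>count_space C) = (\<integral>\<^sup>+ i. 0 \<partial>count_space C)"
          by (intro nn_integral_cong) (simp del: mem_ball)
        then show ?thesis by simp
      qed
    qed
    also have "\<dots> = ennreal (D / s) * (\<integral>\<^sup>+ y. h y \<partial>eta \<nu>)"
      by (rule nn_integral_cmult) measurable
    finally have "emeasure (eta \<nu>) A \<le> ennreal (D / s) * (\<integral>\<^sup>+ y. h y \<partial>eta \<nu>)" .
    moreover have "K \<subseteq> A" using C(4) by (force simp: A_def E_def K_def)
    ultimately show ?thesis using Am unfolding K_def by blast
  qed
  then show ?thesis using D by blast
qed

text \<open>The interval is cut into shells of width \<rho>. On shell \<open>j\<close> the kernel is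
  at most \<open>1 / (j + 1)^p\<close>, while \<open>vol\<close> has grown by at most
  \<open>(j + 1) powr (3 + |a|)\<close>; the assumption on \<open>p\<close> leaves the summable
  \<open>1 / (j + 1)^2\<close>.\<close>

lemma decaying_kernel_le_HL:
  assumes p: "5 + \<bar>a\<bar> \<le> real p"
  shows "\<exists>C>0. \<forall>x \<rho>. \<forall>h\<in>borel_measurable (eta \<nu>). 0 < x \<longrightarrow> x < 1 \<longrightarrow> 0 < \<rho> \<longrightarrow> \<rho> \<le> 1 \<longrightarrow>
    (\<integral>\<^sup>+ y. ennreal (1 / (1 + \<bar>x - y\<bar> / \<rho>) ^ p) * h y \<partial>eta \<nu>) \<le> ennreal (C * vol x \<rho>) * HL h x"
proof -
  define w where "w = (\<lambda>j::nat. 1 / (real (Suc j))\<^sup>2)"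
  have w: "summable w" unfolding w_def
    using inverse_power_summable[of 2, where 'a = real] summable_Suc_iff[of "\<lambda>i. inverse (real i ^ 2)"]
    by (simp add: inverse_eq_divide)
  define C where "C = suminf w"
  have "w 0 \<le> C" unfolding C_def using sum_le_suminf[OF w, of "{0}"] by (simp add: w_def)
  then have C: "C > 0" by (simp add: w_def)
  have "(\<integral>\<^sup>+ y. ennreal (1 / (1 + \<bar>x - y\<bar> / \<rho>) ^ p) * h y \<partial>eta \<nu>) \<le> ennreal (C * vol x \<rho>) * HL h x"
    if h[measurable]: "h \<in> borel_measurable (eta \<nu>)" and x: "0 < x" "x < 1" and \<rho>: "0 < \<rho>" "\<rho> \<le> 1" for x \<rho> h
  proof -
    note [measurable] = indicator_ball_measurable
    \<comment> \<open>Truncated at 1, the largest radius in \<open>HL\<close>; no two points of the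
      interval are farther apart.\<close>
    define R where "R = (\<lambda>j. min 1 (real (Suc j) * \<rho>))"
    have R: "0 < R j" "R j \<le> 1" "\<rho> \<le> R j" "R j \<le> real (Suc j) * \<rho>" for j
      using \<rho> by (auto simp: R_def)
    define c where "c = (\<lambda>j::nat. ennreal (1 / real (Suc j) ^ p))"
    have "(\<integral>\<^sup>+ y. ennreal (1 / (1 + \<bar>x - y\<bar> / \<rho>) ^ p) * h y \<partial>eta \<nu>)
        \<le> (\<integral>\<^sup>+ y. (\<Sum>j. c j * (h y * indicator (ball x (R j)) y)) \<partial>eta \<nu>)"
    proof (rule nn_integral_mono)
      fix y assume "y \<in> space (eta \<nu>)"
      then have y: "0 < y" "y < 1" by auto
      define j where "j = nat \<lfloor>\<bar>x - y\<bar> / \<rho>\<rfloor>"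
      have q: "0 \<le> \<bar>x - y\<bar> / \<rho>" using \<rho> by simp
      have j: "real j \<le> \<bar>x - y\<bar> / \<rho>" "\<bar>x - y\<bar> / \<rho> < real (Suc j)"
        unfolding j_def using q by linarith+
      have "\<bar>x - y\<bar> < real (Suc j) * \<rho>" using j(2) \<rho> by (simp add: divide_less_eq)
      moreover have "\<bar>x - y\<bar> < 1" using x y by auto
      ultimately have "y \<in> ball x (R j)" by (simp add: R_def dist_real_def)
      moreover have "1 / (1 + \<bar>x - y\<bar> / \<rho>) ^ p \<le> 1 / real (Suc j) ^ p"
        using j(1) by (intro divide_left_mono power_mono mult_pos_pos zero_less_power) auto
      ultimately have "ennreal (1 / (1 + \<bar>x - y\<bar> / \<rho>) ^ p) * h y \<le> c j * (h y * indicator (ball x (R j)) y)"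
        by (auto simp: c_def intro!: mult_right_mono ennreal_leI)
      also have "\<dots> \<le> (\<Sum>j. c j * (h y * indicator (ball x (R j)) y))"
        using sum_le_suminf[of "\<lambda>j. c j * (h y * indicator (ball x (R j)) y)" "{j}"] by simp
      finally show "ennreal (1 / (1 + \<bar>x - y\<bar> / \<rho>) ^ p) * h y \<le> (\<Sum>j. c j * (h y * indicator (ball x (R j)) y))" .
    qed
    also have "\<dots> = (\<Sum>j. \<integral>\<^sup>+ y. c j * (h y * indicator (ball x (R j)) y) \<partial>eta \<nu>)"
      by (rule nn_integral_suminf) measurable
    also have "\<dots> \<le> (\<Sum>j. ennreal (w j) * (ennreal (vol x \<rho>) * HL h x))"
    proof (rule suminf_le)
      fix j
      have "(\<integral>\<^sup>+ y. c j * (h y * indicator (ball x (R j)) y) \<partial>eta \<nu>) = c j * (\<integral>\<^sup>+ y. h y * indicator (ball x (R j)) y \<partial>eta \<nu>)"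
        by (rule nn_integral_cmult) measurable
      also have "\<dots> \<le> c j * (ennreal (vol x (R j)) * HL h x)"
        by (intro mult_left_mono nn_integral_ball_le_HL x R) auto
      also have "\<dots> \<le> ennreal (w j) * (ennreal (vol x \<rho>) * HL h x)"
      proof -
        let ?n = "real (Suc j)"
        have n: "?n \<ge> 1" by simp
        have "vol x (R j) \<le> (R j / \<rho>) powr (3 + \<bar>a\<bar>) * vol x \<rho>"
          using R \<rho> x by (intro vol_mono_scale) auto
        also have "\<dots> \<le> ?n powr (3 + \<bar>a\<bar>) * vol x \<rho>"
          using R[of j] \<rho> vol_pos[OF x \<rho>(1)] by (intro mult_right_mono powr_mono2) (auto simp: divide_le_eq)
        finally have "1 / ?n ^ p * vol x (R j) \<le> 1 / ?n ^ p * (?n powr (3 + \<bar>a\<bar>) * vol x \<rho>)"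
          by (intro mult_left_mono) auto
        also have "\<dots> \<le> w j * vol x \<rho>"
        proof -
          have "?n powr (3 + \<bar>a\<bar>) * ?n\<^sup>2 = ?n powr (5 + \<bar>a\<bar>)"
            using powr_realpow[of ?n 2] powr_add[of ?n "3 + \<bar>a\<bar>" 2] by simp
          also have "\<dots> \<le> ?n powr real p" using p by (intro powr_mono) auto
          also have "\<dots> = ?n ^ p" by (intro powr_realpow) simp
          finally have "?n powr (3 + \<bar>a\<bar>) / ?n ^ p \<le> 1 / ?n\<^sup>2"
            by (simp add: divide_simps del: of_nat_Suc)
          from mult_right_mono[OF this, of "vol x \<rho>"] show ?thesis
            using vol_pos[OF x \<rho>(1)] by (simp add: w_def del: of_nat_Suc)
        qed
        finally have "c j * ennreal (vol x (R j)) \<le> ennreal (w j) * ennreal (vol x \<rho>)"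
          unfolding c_def using vol_pos[OF x R(1)] vol_pos[OF x \<rho>(1)]
          by (simp add: w_def ennreal_leI less_imp_le del: of_nat_Suc flip: ennreal_mult)
        then show ?thesis unfolding mult.assoc[symmetric] by (rule mult_right_mono) simp
      qed
      finally show "(\<integral>\<^sup>+ y. c j * (h y * indicator (ball x (R j)) y) \<partial>eta \<nu>) \<le> ennreal (w j) * (ennreal (vol x \<rho>) * HL h x)" .
    qed auto
    also have "\<dots> = (\<Sum>j. ennreal (w j)) * (ennreal (vol x \<rho>) * HL h x)"
      by (rule ennreal_suminf_multc)
    also have "(\<Sum>j. ennreal (w j)) = ennreal C"
      unfolding C_def using w by (intro suminf_ennreal2) (auto simp: w_def)
    also have "ennreal C * (ennreal (vol x \<rho>) * HL h x) = ennreal (C * vol x \<rho>) * HL h x"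
      using C by (simp add: ennreal_mult' mult.assoc)
    finally show ?thesis .
  qed
  then show ?thesis using C by blast
qed

section \<open>The ground state transformed kernel\<close>

lemma heat_kernel_eq:
  assumes "t > 0" "0 < x" "x < 1" "0 < y" "y < 1"
  shows "heat_kernel \<nu> t x y = dkern t x y / (psi 1 x * psi 1 y)"
proof -
  have "(\<Sum>n. exp (- (lam (Suc n))\<^sup>2 * t) * (psi (Suc n) x * psi (Suc n) y) / (psi 1 x * psi 1 y)) = dkern t x y / (psi 1 x * psi 1 y)"
    unfolding dkern_def using assms by (intro suminf_divide[OF summable_dkern]) auto
  then show ?thesis using assms
    by (simp add: heat_kernel_def varphi_def phi_eq_psi mult.assoc)
qed

text \<open>Moving the centre costs powers of \<open>1 + |x - y| / r\<close>: \<open>|a|\<close> of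
  them from the weight and 2 from the boundary factor.\<close>

lemma vol_nearby_points:
  assumes x: "0 < x" "x < 1" and y: "0 < y" "y < 1" and r: "r > 0"
  shows "vol x r \<le> (1 + \<bar>x - y\<bar> / r) powr (2 + \<bar>a\<bar>) * vol y r"
proof -
  define c where "c = 1 + \<bar>x - y\<bar> / r"
  have c: "c \<ge> 1" using r by (simp add: c_def)
  have le: "u + r \<le> c * (v + r)" if "0 < u" "0 < v" "u \<le> v + \<bar>x - y\<bar>" for u v
  proof -
    have "\<bar>x - y\<bar> = (c - 1) * r" using r by (simp add: c_def)
    also have "\<dots> \<le> (c - 1) * (v + r)" using c that by (intro mult_left_mono) auto
    finally show ?thesis using that by (simp add: algebra_simps)
  qed
  have "(x + r) powr a \<le> c powr \<bar>a\<bar> * (y + r) powr a"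
    by (rule powr_comparable) (use x y r c in \<open>auto intro!: le\<close>)
  moreover have "(1 - x + r)\<^sup>2 \<le> (c * (1 - y + r))\<^sup>2"
    using x y r by (intro power_mono le) auto
  ultimately have "r * ((x + r) powr a * (1 - x + r)\<^sup>2) \<le> r * ((c powr \<bar>a\<bar> * (y + r) powr a) * (c * (1 - y + r))\<^sup>2)"
    using r by (intro mult_left_mono mult_mono) auto
  also have "\<dots> = (c\<^sup>2 * c powr \<bar>a\<bar>) * vol y r" by (simp add: vol_def power_mult_distrib mult_ac)
  also have "c\<^sup>2 * c powr \<bar>a\<bar> = c powr (2 + \<bar>a\<bar>)"
    using c powr_realpow[of c 2] by (simp add: powr_add)
  finally show ?thesis by (simp add: vol_def c_def mult.assoc)
qed

text \<open>The factors \<open>(1 - x)^2\<close> and \<open>(1 - y)^2\<close> of the densities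
  cancel against the lower bound for the ground states, and the exponential is bounded for
  \<open>t \<le> 2\<close>. The remaining bound is symmetric in the two volumes; surplus decay pays
  for replacing \<open>vol y\<close> by \<open>vol x\<close>.\<close>

lemma heat_kernel_M_small_time:
  "\<exists>C>0. \<forall>t x y. 0 < t \<longrightarrow> t \<le> 2 \<longrightarrow> 0 < x \<longrightarrow> x < 1 \<longrightarrow> 0 < y \<longrightarrow> y < 1 \<longrightarrow>
     \<bar>heat_kernel_M \<nu> t x y\<bar> \<le> C / ((1 + \<bar>x - y\<bar> / sqrt (t / 2)) ^ p * vol x (sqrt (t / 2)))"
proof -
  \<comment> \<open>The part of the decay spent on the change of centre. In the inequality for
    squares it provides \<open>2 * m\<close> powers, and at most \<open>2 + |a|\<close> are
    needed.\<close>
  define m where "m = nat \<lceil>\<bar>a\<bar>\<rceil> + 5"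
  have m: "\<bar>a\<bar> + 5 \<le> real m" unfolding m_def by linarith
  define k where "k = p + m"
  have k: "k \<ge> 2" "3 + \<bar>a\<bar> \<le> 2 * real (k - 2)"
  proof -
    show "k \<ge> 2" by (simp add: k_def m_def)
    then have "real (k - 2) = real p + real m - 2" by (simp add: k_def)
    then show "3 + \<bar>a\<bar> \<le> 2 * real (k - 2)" using m by simp
  qed
  obtain B where B: "B > 0" and B': "\<forall>T x y. 0 < T \<longrightarrow> 0 < x \<longrightarrow> x < 1 \<longrightarrow> 0 < y \<longrightarrow> y < 1 \<longrightarrow>
    (dkern (2 * T) x y)\<^sup>2 \<le> B * (dens x T * dens y T)
    \<and> (\<bar>x - y\<bar> ^ k * dkern (2 * T) x y)\<^sup>2 \<le> B * (T ^ k * (dens x T * dens y T))"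
    using dkern_off_diagonal[OF k] by blast
  obtain c where c: "c > 0" and c': "\<forall>x. 0 < x \<longrightarrow> x < 1 \<longrightarrow> c * (1 - x) \<le> psi 1 x"
    using psi_1_lower by blast
  define G where "G = (exp ((lam 1)\<^sup>2 * 2))\<^sup>2 * B / (c\<^sup>2 * c\<^sup>2)"
  have G: "G > 0" using B c by (simp add: G_def)
  define C where "C = sqrt (2 * 4 ^ k * G)"
  have "\<bar>heat_kernel_M \<nu> t x y\<bar> \<le> C / ((1 + \<bar>x - y\<bar> / sqrt (t / 2)) ^ p * vol x (sqrt (t / 2)))"
    if t: "0 < t" "t \<le> 2" and x: "0 < x" "x < 1" and y: "0 < y" "y < 1" for t x y
  proof -
    define T \<rho> where "T = t / 2" and "\<rho> = sqrt (t / 2)"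
    have T: "T > 0" "t = 2 * T" and \<rho>: "\<rho> > 0" "\<rho>\<^sup>2 = T" using t by (simp_all add: T_def \<rho>_def)
    define Vx Vy where "Vx = vol x \<rho>" and "Vy = vol y \<rho>"
    have V: "Vx > 0" "Vy > 0" using vol_pos x y \<rho> by (simp_all add: Vx_def Vy_def)
    have dens: "dens x T = (1 - x)\<^sup>2 / Vx" "dens y T = (1 - y)\<^sup>2 / Vy"
      by (simp_all add: dens_def Vx_def Vy_def \<rho>_def T_def)
    define H where "H = heat_kernel_M \<nu> t x y"
    have px: "c * (1 - x) \<le> psi 1 x" "c * (1 - y) \<le> psi 1 y" "0 < c * (1 - x)" "0 < c * (1 - y)"
      using c c' x y by auto
    have H: "H = exp ((lam 1)\<^sup>2 * t) * dkern t x y / (psi 1 x * psi 1 y)"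
      using t x y by (simp add: H_def heat_kernel_M_def heat_kernel_eq)
    \<comment> \<open>Serves both bounds of \<open>dkern_off_diagonal\<close>: once with
      \<open>z = Z = 1\<close>, once with \<open>z = |x - y|^k\<close> and
      \<open>Z = T^k\<close>.\<close>
    have "(z * H)\<^sup>2 \<le> G * Z / (Vx * Vy)" if Z: "(z * dkern t x y)\<^sup>2 \<le> B * (Z * (dens x T * dens y T))" "Z \<ge> 0" for z Z
    proof -
      have "(z * H)\<^sup>2 = (exp ((lam 1)\<^sup>2 * t))\<^sup>2 * (z * dkern t x y)\<^sup>2 / ((psi 1 x)\<^sup>2 * (psi 1 y)\<^sup>2)"
        by (simp add: H power_mult_distrib power_divide)
      also have "\<dots> \<le> (exp ((lam 1)\<^sup>2 * 2))\<^sup>2 * (B * (Z * (dens x T * dens y T))) / ((c * (1 - x))\<^sup>2 * (c * (1 - y))\<^sup>2)"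
        using px t Z B less_imp_le[OF dens_pos[OF x T(1)]] less_imp_le[OF dens_pos[OF y T(1)]]
        by (intro frac_le mult_mono power_mono) (auto intro!: mult_pos_pos mult_left_mono mult_nonneg_nonneg)
      also have "\<dots> = G * Z / (Vx * Vy)"
        using x y c V by (simp add: G_def dens power_mult_distrib divide_simps)
      finally show ?thesis .
    qed note est = this
    have e1: "H\<^sup>2 \<le> G / (Vx * Vy)"
      using est[of 1 1] B'[rule_format, of T x y] T x y by simp
    define u where "u = \<bar>x - y\<bar> / \<rho>"
    have u: "u \<ge> 0" using \<rho> by (simp add: u_def)
    have e2: "(u ^ k * H)\<^sup>2 \<le> G / (Vx * Vy)"
    proof -
      have "(\<bar>x - y\<bar> ^ k * H)\<^sup>2 \<le> G * T ^ k / (Vx * Vy)"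
        using est[of "\<bar>x - y\<bar> ^ k" "T ^ k"] B'[rule_format, of T x y] T x y by simp
      also have "\<bar>x - y\<bar> ^ k * H = \<rho> ^ k * (u ^ k * H)"
        using \<rho> by (simp add: u_def power_divide)
      also have "(\<rho> ^ k * (u ^ k * H))\<^sup>2 = T ^ k * (u ^ k * H)\<^sup>2"
        unfolding \<rho>(2)[symmetric] by (simp add: power_mult_distrib mult.commute flip: power_mult)
      finally have "T ^ k * (u ^ k * H)\<^sup>2 \<le> T ^ k * (G / (Vx * Vy))" by (simp add: mult.commute)
      moreover have "T ^ k > 0" using T by simp
      ultimately show ?thesis by (simp only: mult_le_cancel_left_pos)
    qed
    \<comment> \<open>From \<open>1 + u \<le> 2 * max 1 u\<close>; the two values of the maximum
      correspond to \<open>e1\<close> and \<open>e2\<close>.\<close>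
    have "((1 + u) ^ k * H)\<^sup>2 \<le> 2 * 4 ^ k * G / (Vx * Vy)"
    proof -
      have "(1 + u) ^ k \<le> (2 * max 1 u) ^ k" using u by (intro power_mono) auto
      also have "\<dots> = 2 ^ k * max 1 u ^ k" by (rule power_mult_distrib)
      finally have "((1 + u) ^ k)\<^sup>2 \<le> (2 ^ k * max 1 u ^ k)\<^sup>2" using u by (intro power_mono) auto
      also have "\<dots> = 4 ^ k * (max 1 u ^ k)\<^sup>2"
      proof -
        have "(2 ^ k)\<^sup>2 = (2 * 2 :: real) ^ k" by (simp only: power2_eq_square power_mult_distrib)
        then show ?thesis by (simp add: power_mult_distrib)
      qed
      also have "(max 1 u ^ k)\<^sup>2 \<le> 1 + (u ^ k)\<^sup>2" using u by (auto simp: max_def)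
      finally have "((1 + u) ^ k)\<^sup>2 \<le> 4 ^ k * (1 + (u ^ k)\<^sup>2)" by simp
      then have "((1 + u) ^ k)\<^sup>2 * H\<^sup>2 \<le> 4 ^ k * (1 + (u ^ k)\<^sup>2) * H\<^sup>2" by (rule mult_right_mono) simp
      also have "\<dots> = 4 ^ k * (H\<^sup>2 + (u ^ k * H)\<^sup>2)" by (simp add: power_mult_distrib algebra_simps)
      also have "\<dots> \<le> 4 ^ k * (G / (Vx * Vy) + G / (Vx * Vy))" by (intro mult_left_mono add_mono e1 e2) auto
      finally show ?thesis by (simp add: power_mult_distrib mult_ac)
    qed
    moreover have "1 / Vy \<le> (1 + u) ^ (2 * m) / Vx"
    proof -
      have "Vx \<le> (1 + u) powr (2 + \<bar>a\<bar>) * Vy"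
        unfolding Vx_def Vy_def u_def by (rule vol_nearby_points[OF x y \<rho>(1)])
      also have "\<dots> \<le> (1 + u) powr (real (2 * m)) * Vy"
        using u m V by (intro mult_right_mono powr_mono) auto
      also have "\<dots> = (1 + u) ^ (2 * m) * Vy" using u by (subst powr_realpow) auto
      finally show ?thesis using V by (simp add: divide_simps mult.commute)
    qed
    ultimately have "((1 + u) ^ k * H)\<^sup>2 \<le> 2 * 4 ^ k * G / Vx * ((1 + u) ^ (2 * m) / Vx)"
      using G V mult_left_mono[of "1 / Vy" "(1 + u) ^ (2 * m) / Vx" "2 * 4 ^ k * G / Vx"] by simp
    moreover have "((1 + u) ^ k * H)\<^sup>2 = (1 + u) ^ (2 * m) * ((1 + u) ^ p * H)\<^sup>2"
      unfolding k_def power_add power_mult_distrib power_even_eq by (simp add: mult_ac)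
    moreover have "2 * 4 ^ k * G / Vx * ((1 + u) ^ (2 * m) / Vx) = (1 + u) ^ (2 * m) * (2 * 4 ^ k * G / Vx\<^sup>2)"
      by (simp add: power2_eq_square)
    ultimately have "(1 + u) ^ (2 * m) * ((1 + u) ^ p * H)\<^sup>2 \<le> (1 + u) ^ (2 * m) * (2 * 4 ^ k * G / Vx\<^sup>2)"
      by (simp only:)
    moreover have "(1 + u) ^ (2 * m) > 0" using u by simp
    ultimately have "((1 + u) ^ p * H)\<^sup>2 \<le> 2 * 4 ^ k * G / Vx\<^sup>2"
      by (simp only: mult_le_cancel_left_pos)
    then have "sqrt (((1 + u) ^ p * H)\<^sup>2) \<le> sqrt (2 * 4 ^ k * G / Vx\<^sup>2)" by (rule real_sqrt_le_mono)
    then have "(1 + u) ^ p * \<bar>H\<bar> \<le> C / Vx"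
      using u V by (simp add: C_def real_sqrt_divide abs_mult)
    moreover have "(1 + u) ^ p > 0" using u by simp
    ultimately have "\<bar>H\<bar> \<le> C / ((1 + u) ^ p * Vx)" using V by (simp add: field_simps)
    then show ?thesis by (simp add: H_def u_def Vx_def \<rho>_def)
  qed
  moreover have "C > 0" using G by (simp add: C_def)
  ultimately show ?thesis by blast
qed

text \<open>The weights \<open>(1 - y) / (1 - x)\<close> and its reciprocal in the
  arithmetic--geometric mean inequality balance the two Dirichlet factors: two diagonal bounds then
  combine to \<open>(1 - x) * (1 - y)\<close>, which the ground states dominate. Bounding absolute
  values term by term prepares the large-time estimate.\<close>

lemma dkern_absolute_bound:
  assumes "t > 0"
  shows "\<exists>B>0. \<forall>x y. 0 < x \<longrightarrow> x < 1 \<longrightarrow> 0 < y \<longrightarrow> y < 1 \<longrightarrow>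
     (\<Sum>n. exp (- (lam (Suc n))\<^sup>2 * t) * \<bar>psi (Suc n) x * psi (Suc n) y\<bar>) \<le> B * (psi 1 x * psi 1 y)"
proof -
  obtain C0 where C0: "C0 > 0" and C0': "\<forall>t>0. \<forall>x. 0 < x \<longrightarrow> x < 1 \<longrightarrow>
      (\<forall>N. (\<Sum>n<N. exp (- (lam (Suc n))\<^sup>2 * t) * (psi (Suc n) x)\<^sup>2) \<le> C0 * (1 - x)\<^sup>2 / vol x (sqrt t))"
    using on_diagonal_bound by blast
  obtain c where c: "c > 0" and c': "\<forall>x. 0 < x \<longrightarrow> x < 1 \<longrightarrow> c * (1 - x) \<le> psi 1 x"
    using psi_1_lower by blast
  define r where "r = sqrt t"
  have r: "r > 0" using assms by (simp add: r_def)
  \<comment> \<open>Large enough to compare \<open>x + r\<close> with 1 in both directions for every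
    \<open>x\<close> in the unit interval.\<close>
  define w where "w = 1 + r + 1 / r"
  have w: "w \<ge> 1" using r by (simp add: w_def)
  define v where "v = r * r\<^sup>2 / w powr \<bar>a\<bar>"
  have v: "v > 0" using r w by (simp add: v_def)
  have vol_ge: "v \<le> vol x r" if x: "0 < x" "x < 1" for x
  proof -
    have "1 powr a \<le> w powr \<bar>a\<bar> * (x + r) powr a"
    proof (rule powr_comparable)
      have "1 \<le> w * r" using r by (simp add: w_def distrib_right)
      also have "\<dots> \<le> w * (x + r)" using w x by (intro mult_left_mono) auto
      finally show "1 \<le> w * (x + r)" .
      have "x + r \<le> 1 + r + 1 / r" using x r add_increasing2[of "1/r" "x + r" "1 + r"] by simp
      then show "x + r \<le> w * 1" by (simp add: w_def)
    qed (use x r w in auto)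
    then have 1: "1 / w powr \<bar>a\<bar> \<le> (x + r) powr a" using w by (simp add: divide_le_eq mult.commute)
    have 2: "r\<^sup>2 \<le> (1 - x + r)\<^sup>2" using x r by (intro power_mono) auto
    have "r * ((1 / w powr \<bar>a\<bar>) * r\<^sup>2) \<le> r * ((x + r) powr a * (1 - x + r)\<^sup>2)"
      using r by (intro mult_left_mono mult_mono 1 2) auto
    then show ?thesis by (simp add: v_def vol_def)
  qed
  define B where "B = C0 / v / c\<^sup>2"
  have "(\<Sum>n. exp (- (lam (Suc n))\<^sup>2 * t) * \<bar>psi (Suc n) x * psi (Suc n) y\<bar>) \<le> B * (psi 1 x * psi 1 y)"
    if x: "0 < x" "x < 1" and y: "0 < y" "y < 1" for x y
  proof (rule suminf_le_const)
    show "summable (\<lambda>n. exp (- (lam (Suc n))\<^sup>2 * t) * \<bar>psi (Suc n) x * psi (Suc n) y\<bar>)"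
      by (rule summable_dkern_abs) (use assms x y in auto)
    fix N
    have xy: "1 - x > 0" "1 - y > 0" using x y by auto
    define S where "S = (\<lambda>z. \<Sum>n<N. exp (- (lam (Suc n))\<^sup>2 * t) * (psi (Suc n) z)\<^sup>2)"
    have S: "S z \<le> (C0 / v) * (1 - z)\<^sup>2" if z: "0 < z" "z < 1" for z
    proof -
      have "S z \<le> C0 * (1 - z)\<^sup>2 / vol z r" using C0' assms z by (simp add: S_def r_def)
      also have "\<dots> \<le> C0 * (1 - z)\<^sup>2 / v"
        using C0 v vol_ge[OF z] by (intro divide_left_mono mult_pos_pos) auto
      finally show ?thesis by simp
    qed
    have "(\<Sum>n<N. exp (- (lam (Suc n))\<^sup>2 * t) * \<bar>psi (Suc n) x * psi (Suc n) y\<bar>)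
        \<le> (\<Sum>n<N. exp (- (lam (Suc n))\<^sup>2 * t) * (((1 - y) / (1 - x) * (psi (Suc n) x)\<^sup>2 + (1 - x) / (1 - y) * (psi (Suc n) y)\<^sup>2) / 2))"
    proof (intro sum_mono mult_left_mono)
      fix n
      define p q b d where "p = \<bar>psi (Suc n) x\<bar>" and "q = \<bar>psi (Suc n) y\<bar>" and "b = 1 - x" and "d = 1 - y"
      have bd: "b > 0" "d > 0" using xy by (simp_all add: b_def d_def)
      then have "0 \<le> (d * p - b * q)\<^sup>2 / (b * d)" by simp
      also have "\<dots> = d / b * p\<^sup>2 + b / d * q\<^sup>2 - 2 * (p * q)"
        using bd by (simp add: power2_eq_square field_simps)
      finally have "0 \<le> (1 - y) / (1 - x) * p\<^sup>2 + (1 - x) / (1 - y) * q\<^sup>2 - 2 * (p * q)"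
        unfolding b_def d_def .
      then show "\<bar>psi (Suc n) x * psi (Suc n) y\<bar> \<le> ((1 - y) / (1 - x) * (psi (Suc n) x)\<^sup>2 + (1 - x) / (1 - y) * (psi (Suc n) y)\<^sup>2) / 2"
        by (simp add: p_def q_def abs_mult)
    qed auto
    also have "\<dots> = ((1 - y) / (1 - x) * S x + (1 - x) / (1 - y) * S y) / 2"
      by (simp add: S_def sum_distrib_left sum_divide_distrib sum.distrib distrib_left add_divide_distrib mult_ac)
    also have "\<dots> \<le> ((1 - y) / (1 - x) * ((C0 / v) * (1 - x)\<^sup>2) + (1 - x) / (1 - y) * ((C0 / v) * (1 - y)\<^sup>2)) / 2"
      using xy by (intro divide_right_mono add_mono mult_left_mono S x y) auto
    also have "\<dots> = C0 / v * ((1 - x) * (1 - y))"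
      using xy by (simp add: power2_eq_square)
    also have "\<dots> = B * ((c * (1 - x)) * (c * (1 - y)))" using c by (simp add: B_def power2_eq_square)
    also have "\<dots> \<le> B * (psi 1 x * psi 1 y)"
      using c' x y c C0 v by (intro mult_left_mono mult_mono) (auto simp: B_def intro: order_trans[rotated])
    finally show "(\<Sum>n<N. exp (- (lam (Suc n))\<^sup>2 * t) * \<bar>psi (Suc n) x * psi (Suc n) y\<bar>) \<le> B * (psi 1 x * psi 1 y)" .
  qed
  moreover have "B > 0" using C0 v c by (simp add: B_def)
  ultimately show ?thesis by blast
qed

end

section \<open>Auxiliary facts on powers, suprema and integrals\<close>

lemma ennreal_powr_mono:
  assumes "b \<le> d" "r > 0"
  shows "ennreal_powr b r \<le> ennreal_powr d r"
proof (cases "d = \<infinity>")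
  case False
  then have "b \<noteq> \<infinity>" using assms(1) by (auto simp: top_unique)
  then show ?thesis using False assms
    by (auto simp: ennreal_powr_def less_top intro!: ennreal_leI powr_mono2 enn2real_mono)
qed (simp add: ennreal_powr_def)

lemma ennreal_powr_1: "ennreal_powr b 1 = b"
  by (cases b) (auto simp: ennreal_powr_def)

text \<open>The supremum runs over uncountably many times, but its superlevel sets are unions of
  open sets, hence open.\<close>

lemma measurable_SUP_continuous:
  fixes F :: "'i \<Rightarrow> real \<Rightarrow> real"
  assumes "\<And>t. t \<in> I \<Longrightarrow> continuous_on S (F t)" "open S" "space M = S" "\<And>A. open A \<Longrightarrow> A \<subseteq> S \<Longrightarrow> A \<in> sets M"
  shows "(\<lambda>x. SUP t\<in>I. ennreal (F t x)) \<in> borel_measurable M"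
proof (rule borel_measurableI_greater)
  fix y :: ennreal
  have "open {x \<in> S. y < ennreal (F t x)}" if "t \<in> I" for t
  proof -
    have "continuous_on S (\<lambda>x. ennreal (F t x))" using assms(1)[OF that] by (intro continuous_on_ennreal)
    then have "open ((\<lambda>x. ennreal (F t x)) -` {y<..} \<inter> S)"
      using continuous_on_open_vimage[OF assms(2)] open_greaterThan by blast
    moreover have "(\<lambda>x. ennreal (F t x)) -` {y<..} \<inter> S = {x \<in> S. y < ennreal (F t x)}" by auto
    ultimately show ?thesis by simp
  qed
  then have "open (\<Union>t\<in>I. {x \<in> S. y < ennreal (F t x)})" by blast
  moreover have "{x \<in> space M. y < (SUP t\<in>I. ennreal (F t x))} = (\<Union>t\<in>I. {x \<in> S. y < ennreal (F t x)})"
    using assms(3) by (auto simp: less_SUP_iff)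
  ultimately show "{x \<in> space M. y < (SUP t\<in>I. ennreal (F t x))} \<in> sets M"
    using assms(4) by (auto simp: UN_least)
qed

text \<open>Holds for every \<open>F\<close>, since the integral of a non-integrable function is 0
  by convention.\<close>

lemma norm_integral_le_nn_integral:
  fixes F :: "'a \<Rightarrow> 'b::{banach, second_countable_topology}"
  shows "ennreal (norm (\<integral>y. F y \<partial>M)) \<le> (\<integral>\<^sup>+ y. ennreal (norm (F y)) \<partial>M)"
  by (cases "integrable M F") (auto simp: integral_norm_bound_ennreal not_integrable_integral_eq)

context bessel
begin

section \<open>Uniform kernel bounds and domination by the maximal function\<close>

lemma psi_1_pos: "0 < x \<Longrightarrow> x < 1 \<Longrightarrow> psi 1 x > 0"
proof -
  assume x: "0 < x" "x < 1"
  obtain c where "c > 0" "\<forall>x. 0 < x \<longrightarrow> x < 1 \<longrightarrow> c * (1 - x) \<le> psi 1 x" using psi_1_lower by blast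
  then show "psi 1 x > 0" using x by (auto intro: less_le_trans[of 0 "c * (1 - x)"])
qed

lemma abs_dkern_le:
  assumes "t > 0" "0 < x" "x < 1" "0 < y" "y < 1"
  shows "summable (\<lambda>n. exp (- (lam (Suc n))\<^sup>2 * t) * \<bar>psi (Suc n) x * psi (Suc n) y\<bar>)"
    and "\<bar>dkern t x y\<bar> \<le> (\<Sum>n. exp (- (lam (Suc n))\<^sup>2 * t) * \<bar>psi (Suc n) x * psi (Suc n) y\<bar>)"
proof -
  show s: "summable (\<lambda>n. exp (- (lam (Suc n))\<^sup>2 * t) * \<bar>psi (Suc n) x * psi (Suc n) y\<bar>)"
    by (rule summable_dkern_abs) (use assms in auto)
  have "norm (dkern t x y) \<le> (\<Sum>n. norm (exp (- (lam (Suc n))\<^sup>2 * t) * (psi (Suc n) x * psi (Suc n) y)))"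
    unfolding dkern_def by (rule summable_norm) (use s in \<open>simp add: abs_mult\<close>)
  then show "\<bar>dkern t x y\<bar> \<le> (\<Sum>n. exp (- (lam (Suc n))\<^sup>2 * t) * \<bar>psi (Suc n) x * psi (Suc n) y\<bar>)"
    by (simp add: abs_mult)
qed

lemma heat_kernel_bounded:
  assumes "t > 0"
  shows "\<exists>B>0. \<forall>x y. 0 < x \<longrightarrow> x < 1 \<longrightarrow> 0 < y \<longrightarrow> y < 1 \<longrightarrow> \<bar>heat_kernel \<nu> t x y\<bar> \<le> B"
proof -
  obtain B where B: "B > 0" and B': "\<forall>x y. 0 < x \<longrightarrow> x < 1 \<longrightarrow> 0 < y \<longrightarrow> y < 1 \<longrightarrow>
     (\<Sum>n. exp (- (lam (Suc n))\<^sup>2 * t) * \<bar>psi (Suc n) x * psi (Suc n) y\<bar>) \<le> B * (psi 1 x * psi 1 y)"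
    using dkern_absolute_bound[OF assms] by blast
  have "\<bar>heat_kernel \<nu> t x y\<bar> \<le> B" if x: "0 < x" "x < 1" and y: "0 < y" "y < 1" for x y
  proof -
    have "\<bar>dkern t x y\<bar> \<le> B * (psi 1 x * psi 1 y)"
      using abs_dkern_le(2)[OF assms x y] B'[rule_format, OF x y] by linarith
    moreover have "psi 1 x * psi 1 y > 0" using psi_1_pos x y by simp
    ultimately have "\<bar>dkern t x y\<bar> / (psi 1 x * psi 1 y) \<le> B" by (simp only: pos_divide_le_eq)
    moreover have "\<bar>heat_kernel \<nu> t x y\<bar> = \<bar>dkern t x y\<bar> / (psi 1 x * psi 1 y)"
      using assms x y psi_1_pos[OF x] psi_1_pos[OF y] by (simp add: heat_kernel_eq abs_mult)
    ultimately show ?thesis by simp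
  qed
  then show ?thesis using B by blast
qed

text \<open>As \<open>lam (Suc n) \<ge> lam 1\<close>, each factor
  \<open>exp (((lam 1)^2 - (lam (Suc n))^2) * t)\<close> is nonincreasing in \<open>t\<close>, so
  the series of absolute values at time 2 dominates all later ones.\<close>

lemma heat_kernel_M_large_time:
  "\<exists>B>0. \<forall>t x y. 2 \<le> t \<longrightarrow> 0 < x \<longrightarrow> x < 1 \<longrightarrow> 0 < y \<longrightarrow> y < 1 \<longrightarrow> \<bar>heat_kernel_M \<nu> t x y\<bar> \<le> B"
proof -
  obtain B where B: "B > 0" and B': "\<forall>x y. 0 < x \<longrightarrow> x < 1 \<longrightarrow> 0 < y \<longrightarrow> y < 1 \<longrightarrow>
     (\<Sum>n. exp (- (lam (Suc n))\<^sup>2 * 2) * \<bar>psi (Suc n) x * psi (Suc n) y\<bar>) \<le> B * (psi 1 x * psi 1 y)"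
    using dkern_absolute_bound[of 2] by auto
  define E where "E = exp ((lam 1)\<^sup>2 * 2)"
  have "\<bar>heat_kernel_M \<nu> t x y\<bar> \<le> E * B" if t: "2 \<le> t" and x: "0 < x" "x < 1" and y: "0 < y" "y < 1" for t x y
  proof -
    have t0: "t > 0" using t by simp
    note s = abs_dkern_le[OF t0 x y] and s2 = abs_dkern_le[of 2, OF _ x y]
    have "exp ((lam 1)\<^sup>2 * t) * \<bar>dkern t x y\<bar>
        \<le> exp ((lam 1)\<^sup>2 * t) * (\<Sum>n. exp (- (lam (Suc n))\<^sup>2 * t) * \<bar>psi (Suc n) x * psi (Suc n) y\<bar>)"
      by (intro mult_left_mono s) auto
    also have "\<dots> = (\<Sum>n. exp ((lam 1)\<^sup>2 * t) * (exp (- (lam (Suc n))\<^sup>2 * t) * \<bar>psi (Suc n) x * psi (Suc n) y\<bar>))"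
      by (rule suminf_mult[symmetric]) (rule s(1))
    also have "\<dots> \<le> (\<Sum>n. E * (exp (- (lam (Suc n))\<^sup>2 * 2) * \<bar>psi (Suc n) x * psi (Suc n) y\<bar>))"
    proof (rule suminf_le)
      fix n
      have "lam 1 \<le> lam (Suc n)" using strict_mono_less_eq[OF strict_mono_lam, of 1 "Suc n"] by simp
      then have "(lam 1)\<^sup>2 \<le> (lam (Suc n))\<^sup>2" using lam_nonneg by (intro power_mono) auto
      then have "(lam 1)\<^sup>2 * (t - 2) \<le> (lam (Suc n))\<^sup>2 * (t - 2)" using t by (intro mult_right_mono) auto
      then have "exp ((lam 1)\<^sup>2 * t + - (lam (Suc n))\<^sup>2 * t) \<le> exp ((lam 1)\<^sup>2 * 2 + - (lam (Suc n))\<^sup>2 * 2)"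
        by (simp add: algebra_simps)
      then have "exp ((lam 1)\<^sup>2 * t) * exp (- (lam (Suc n))\<^sup>2 * t) \<le> E * exp (- (lam (Suc n))\<^sup>2 * 2)"
        by (simp only: exp_add E_def)
      from mult_right_mono[OF this, of "\<bar>psi (Suc n) x * psi (Suc n) y\<bar>"]
      show "exp ((lam 1)\<^sup>2 * t) * (exp (- (lam (Suc n))\<^sup>2 * t) * \<bar>psi (Suc n) x * psi (Suc n) y\<bar>)
          \<le> E * (exp (- (lam (Suc n))\<^sup>2 * 2) * \<bar>psi (Suc n) x * psi (Suc n) y\<bar>)"
        by (simp only: mult.assoc abs_ge_zero)
      show "summable (\<lambda>n. exp ((lam 1)\<^sup>2 * t) * (exp (- (lam (Suc n))\<^sup>2 * t) * \<bar>psi (Suc n) x * psi (Suc n) y\<bar>))"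
        by (rule summable_mult) (rule s(1))
      show "summable (\<lambda>n. E * (exp (- (lam (Suc n))\<^sup>2 * 2) * \<bar>psi (Suc n) x * psi (Suc n) y\<bar>))"
        by (rule summable_mult, rule s2(1)) simp
    qed
    also have "\<dots> = E * (\<Sum>n. exp (- (lam (Suc n))\<^sup>2 * 2) * \<bar>psi (Suc n) x * psi (Suc n) y\<bar>)"
      by (rule suminf_mult) (rule s2(1), simp)
    also have "\<dots> \<le> E * (B * (psi 1 x * psi 1 y))"
      using B' x y by (intro mult_left_mono) (auto simp: E_def)
    finally have "exp ((lam 1)\<^sup>2 * t) * \<bar>dkern t x y\<bar> \<le> (E * B) * (psi 1 x * psi 1 y)" by simp
    moreover have "psi 1 x * psi 1 y > 0" using psi_1_pos x y by simp
    ultimately have "exp ((lam 1)\<^sup>2 * t) * \<bar>dkern t x y\<bar> / (psi 1 x * psi 1 y) \<le> E * B" by (simp only: pos_divide_le_eq)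
    moreover have "\<bar>heat_kernel_M \<nu> t x y\<bar> = exp ((lam 1)\<^sup>2 * t) * \<bar>dkern t x y\<bar> / (psi 1 x * psi 1 y)"
      using t0 x y psi_1_pos[OF x] psi_1_pos[OF y] by (simp add: heat_kernel_M_def heat_kernel_eq abs_mult)
    ultimately show ?thesis by simp
  qed
  moreover have "E * B > 0" using B by (simp add: E_def)
  ultimately show ?thesis by blast
qed

text \<open>Times up to 2 keep the scale \<open>sqrt (t / 2)\<close> among the radii of
  \<open>HL\<close>. For later times the kernel is bounded, and the integral is one over the ball of
  radius 1, which contains the whole interval.\<close>

lemma heat_op_M_le_HL:
  "\<exists>C>0. \<forall>f\<in>borel_measurable (eta \<nu>). \<forall>t>0. \<forall>x. 0 < x \<longrightarrow> x < 1 \<longrightarrow>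
     ennreal (cmod (heat_op_M \<nu> t f x)) \<le> ennreal C * HL (\<lambda>y. ennreal (cmod (f y))) x"
proof -
  define p where "p = nat \<lceil>\<bar>a\<bar>\<rceil> + 5"
  have p: "5 + \<bar>a\<bar> \<le> real p" unfolding p_def by linarith
  obtain C1 where C1: "C1 > 0" and C1': "\<forall>t x y. 0 < t \<longrightarrow> t \<le> 2 \<longrightarrow> 0 < x \<longrightarrow> x < 1 \<longrightarrow> 0 < y \<longrightarrow> y < 1 \<longrightarrow>
     \<bar>heat_kernel_M \<nu> t x y\<bar> \<le> C1 / ((1 + \<bar>x - y\<bar> / sqrt (t / 2)) ^ p * vol x (sqrt (t / 2)))"
    using heat_kernel_M_small_time[of p] by blast
  obtain C2 where C2: "C2 > 0" and C2': "\<forall>x \<rho>. \<forall>h\<in>borel_measurable (eta \<nu>). 0 < x \<longrightarrow> x < 1 \<longrightarrow> 0 < \<rho> \<longrightarrow> \<rho> \<le> 1 \<longrightarrow>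
    (\<integral>\<^sup>+ y. ennreal (1 / (1 + \<bar>x - y\<bar> / \<rho>) ^ p) * h y \<partial>eta \<nu>) \<le> ennreal (C2 * vol x \<rho>) * HL h x"
    using decaying_kernel_le_HL[OF p] by blast
  obtain C3 where C3: "C3 > 0" and C3': "\<forall>t x y. 2 \<le> t \<longrightarrow> 0 < x \<longrightarrow> x < 1 \<longrightarrow> 0 < y \<longrightarrow> y < 1 \<longrightarrow> \<bar>heat_kernel_M \<nu> t x y\<bar> \<le> C3"
    using heat_kernel_M_large_time by blast
  define C where "C = C1 * C2 + C3 * (4 * 2 powr \<bar>a\<bar>)"
  have C: "C > 0" using C1 C2 C3 by (auto simp: C_def intro!: add_pos_pos)
  have "ennreal (cmod (heat_op_M \<nu> t f x)) \<le> ennreal C * HL (\<lambda>y. ennreal (cmod (f y))) x"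
    if f[measurable]: "f \<in> borel_measurable (eta \<nu>)" and t: "t > 0" and x: "0 < x" "x < 1" for f t x
  proof -
    define h where "h = (\<lambda>y. ennreal (cmod (f y)))"
    have h[measurable]: "h \<in> borel_measurable (eta \<nu>)" unfolding h_def by measurable
    have "ennreal (cmod (heat_op_M \<nu> t f x)) \<le> (\<integral>\<^sup>+ y. ennreal \<bar>heat_kernel_M \<nu> t x y\<bar> * h y \<partial>eta \<nu>)"
      unfolding heat_op_M_def
      by (rule order_trans[OF norm_integral_le_nn_integral]) (simp add: h_def norm_mult ennreal_mult')
    also have "\<dots> \<le> ennreal C * HL h x"
    proof (cases "t \<le> 2")
      case True
      define \<rho> where "\<rho> = sqrt (t / 2)"
      have \<rho>: "0 < \<rho>" "\<rho> \<le> 1" using t True by (simp_all add: \<rho>_def)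
      have v: "vol x \<rho> > 0" using x \<rho> by (intro vol_pos)
      have [measurable]: "(\<lambda>y. ennreal (1 / (1 + \<bar>x - y\<bar> / \<rho>) ^ p)) \<in> borel_measurable (eta \<nu>)"
        by (rule borel_measurable_eta) measurable
      have "(\<integral>\<^sup>+ y. ennreal \<bar>heat_kernel_M \<nu> t x y\<bar> * h y \<partial>eta \<nu>)
          \<le> (\<integral>\<^sup>+ y. ennreal (C1 / vol x \<rho>) * (ennreal (1 / (1 + \<bar>x - y\<bar> / \<rho>) ^ p) * h y) \<partial>eta \<nu>)"
      proof (rule nn_integral_mono)
        fix y assume "y \<in> space (eta \<nu>)"
        then have "\<bar>heat_kernel_M \<nu> t x y\<bar> \<le> C1 / ((1 + \<bar>x - y\<bar> / \<rho>) ^ p * vol x \<rho>)"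
          using C1' t True x by (simp add: \<rho>_def)
        also have "\<dots> = C1 / vol x \<rho> * (1 / (1 + \<bar>x - y\<bar> / \<rho>) ^ p)" by simp
        finally have "ennreal \<bar>heat_kernel_M \<nu> t x y\<bar> \<le> ennreal (C1 / vol x \<rho>) * ennreal (1 / (1 + \<bar>x - y\<bar> / \<rho>) ^ p)"
          using C1 v \<rho> by (subst ennreal_mult[symmetric]) (auto intro!: ennreal_leI)
        then show "ennreal \<bar>heat_kernel_M \<nu> t x y\<bar> * h y \<le> ennreal (C1 / vol x \<rho>) * (ennreal (1 / (1 + \<bar>x - y\<bar> / \<rho>) ^ p) * h y)"
          unfolding mult.assoc[symmetric] by (rule mult_right_mono) simp
      qed
      also have "\<dots> = ennreal (C1 / vol x \<rho>) * (\<integral>\<^sup>+ y. ennreal (1 / (1 + \<bar>x - y\<bar> / \<rho>) ^ p) * h y \<partial>eta \<nu>)"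
        by (rule nn_integral_cmult) measurable
      also have "\<dots> \<le> ennreal (C1 / vol x \<rho>) * (ennreal (C2 * vol x \<rho>) * HL h x)"
        using C2' h x \<rho> by (intro mult_left_mono) auto
      also have "\<dots> = ennreal (C1 * C2) * HL h x"
        using C1 C2 v by (simp add: mult.assoc[symmetric] flip: ennreal_mult)
      also have "\<dots> \<le> ennreal C * HL h x"
        using C3 by (intro mult_right_mono ennreal_leI) (auto simp: C_def)
      finally show ?thesis .
    next
      case False
      have "(\<integral>\<^sup>+ y. ennreal \<bar>heat_kernel_M \<nu> t x y\<bar> * h y \<partial>eta \<nu>) \<le> (\<integral>\<^sup>+ y. ennreal C3 * (h y * indicator (ball x 1) y) \<partial>eta \<nu>)"
      proof (rule nn_integral_mono)
        fix y assume "y \<in> space (eta \<nu>)"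
        then have y: "0 < y" "y < 1" by auto
        then have "y \<in> ball x 1" using x by (auto simp: dist_real_def)
        moreover have "\<bar>heat_kernel_M \<nu> t x y\<bar> \<le> C3" using C3' False x y by simp
        ultimately show "ennreal \<bar>heat_kernel_M \<nu> t x y\<bar> * h y \<le> ennreal C3 * (h y * indicator (ball x 1) y)"
          by (auto intro!: mult_right_mono ennreal_leI)
      qed
      also have "\<dots> = ennreal C3 * (\<integral>\<^sup>+ y. h y * indicator (ball x 1) y \<partial>eta \<nu>)"
        by (rule nn_integral_cmult) (use indicator_ball_measurable h in measurable)
      also have "\<dots> \<le> ennreal C3 * (ennreal (vol x 1) * HL h x)"
        using x by (intro mult_left_mono nn_integral_ball_le_HL) auto
      also have "\<dots> \<le> ennreal C3 * (ennreal (4 * 2 powr \<bar>a\<bar>) * HL h x)"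
      proof (intro mult_left_mono mult_right_mono ennreal_leI)
        have "(x + 1) powr a \<le> 2 powr \<bar>a\<bar> * 1 powr a" using x by (intro powr_comparable) auto
        moreover have "(1 - x + 1)\<^sup>2 \<le> 2\<^sup>2" using x by (intro power_mono) auto
        ultimately have "(x + 1) powr a * (1 - x + 1)\<^sup>2 \<le> 2 powr \<bar>a\<bar> * 2\<^sup>2" by (intro mult_mono) auto
        then show "vol x 1 \<le> 4 * 2 powr \<bar>a\<bar>" by (simp add: vol_def)
      qed auto
      also have "\<dots> = ennreal (C3 * (4 * 2 powr \<bar>a\<bar>)) * HL h x"
        using C3 by (simp add: mult.assoc[symmetric] ennreal_mult)
      also have "\<dots> \<le> ennreal C * HL h x"
        using C1 C2 by (intro mult_right_mono ennreal_leI) (auto simp: C_def)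
      finally show ?thesis .
    qed
    finally show ?thesis by (simp add: h_def)
  qed
  then show ?thesis using C by blast
qed

section \<open>Continuity in space and measurability of the maximal functions\<close>

lemma dkern_tendsto:
  assumes t: "t > 0" and y: "0 < y" "y < 1" and xs: "\<And>i. 0 < X i \<and> X i < 1" "X \<longlonglongrightarrow> x"
  shows "(\<lambda>i. dkern t (X i) y) \<longlonglongrightarrow> dkern t x y"
proof -
  obtain C where C: "C > 0" and C': "\<forall>n\<ge>1. \<forall>x. 0 < x \<longrightarrow> x \<le> 1 \<longrightarrow> (psi n x)\<^sup>2 \<le> C * (1 + lam n) powr \<bar>a\<bar>"
    using psi_crude by blast
  have "eventually (\<lambda>i. summable (\<lambda>n. norm (exp (- (lam (Suc n))\<^sup>2 * t) * (psi (Suc n) (X i) * psi (Suc n) y)))) sequentially \<and>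
     summable (\<lambda>n. norm (exp (- (lam (Suc n))\<^sup>2 * t) * (psi (Suc n) x * psi (Suc n) y))) \<and>
     ((\<lambda>i. \<Sum>n. exp (- (lam (Suc n))\<^sup>2 * t) * (psi (Suc n) (X i) * psi (Suc n) y))
        \<longlongrightarrow> (\<Sum>n. exp (- (lam (Suc n))\<^sup>2 * t) * (psi (Suc n) x * psi (Suc n) y))) sequentially"
  proof (rule tannerys_theorem)
    fix n
    have "(\<lambda>i. psi (Suc n) (X i)) \<longlonglongrightarrow> psi (Suc n) x"
      using DERIV_isCont[OF DERIV_psi] xs(2) by (rule isCont_tendsto_compose)
    then show "(\<lambda>i. exp (- (lam (Suc n))\<^sup>2 * t) * (psi (Suc n) (X i) * psi (Suc n) y))
        \<longlonglongrightarrow> exp (- (lam (Suc n))\<^sup>2 * t) * (psi (Suc n) x * psi (Suc n) y)" by (intro tendsto_intros)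
  next
    have "norm (exp (- (lam (Suc n))\<^sup>2 * t) * (psi (Suc n) (X i) * psi (Suc n) y))
        \<le> exp (- (lam (Suc n))\<^sup>2 * t) * (C * (1 + lam (Suc n)) powr \<bar>a\<bar>)" for n i
    proof -
      have "\<bar>psi (Suc n) (X i) * psi (Suc n) y\<bar> \<le> C * (1 + lam (Suc n)) powr \<bar>a\<bar>"
        by (rule abs_mult_le_of_squares_le) (use C' y xs(1)[of i] in auto)
      from mult_left_mono[OF this, of "exp (- (lam (Suc n))\<^sup>2 * t)"] show ?thesis
        by (simp add: abs_mult)
    qed
    then show "\<forall>\<^sub>F (n, i) in at_top \<times>\<^sub>F sequentially. norm (exp (- (lam (Suc n))\<^sup>2 * t) * (psi (Suc n) (X i) * psi (Suc n) y))
        \<le> exp (- (lam (Suc n))\<^sup>2 * t) * (C * (1 + lam (Suc n)) powr \<bar>a\<bar>)"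
      by (intro always_eventually) auto
    show "summable (\<lambda>n. exp (- (lam (Suc n))\<^sup>2 * t) * (C * (1 + lam (Suc n)) powr \<bar>a\<bar>))"
      using summable_mult[OF summable_heat_weights[OF t, of "\<bar>a\<bar>"], of C] by (simp only: mult.left_commute)
  qed simp
  then show ?thesis by (simp add: dkern_def)
qed

lemma heat_kernel_measurable:
  assumes "t > 0" "0 < x" "x < 1"
  shows "heat_kernel \<nu> t x \<in> borel_measurable (eta \<nu>)"
proof -
  have [measurable]: "psi n \<in> borel_measurable borel" for n
    by (intro borel_measurable_continuous_onI continuous_on_psi continuous_on_id)
  have "(\<lambda>y. dkern t x y / (psi 1 x * psi 1 y)) \<in> borel_measurable borel"
    unfolding dkern_def by measurable
  then have "(\<lambda>y. dkern t x y / (psi 1 x * psi 1 y)) \<in> borel_measurable (eta \<nu>)" by (rule borel_measurable_eta)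
  moreover have "heat_kernel \<nu> t x \<in> borel_measurable (eta \<nu>) \<longleftrightarrow> (\<lambda>y. dkern t x y / (psi 1 x * psi 1 y)) \<in> borel_measurable (eta \<nu>)"
    by (rule measurable_cong) (use assms in \<open>simp add: heat_kernel_eq\<close>)
  ultimately show ?thesis by simp
qed

text \<open>Dominated convergence, the kernel at a fixed time being bounded. Continuity is what
  makes the supremum over all times measurable.\<close>

lemma continuous_on_heat_op:
  assumes t: "t > 0" and f: "integrable (eta \<nu>) f"
  shows "continuous_on {0<..<1} (heat_op \<nu> t f)"
  unfolding continuous_on_sequentially comp_def
proof (intro allI ballI impI)
  fix X :: "nat \<Rightarrow> real" and x assume x: "x \<in> {0<..<1}" and X: "(\<forall>n. X n \<in> {0<..<1}) \<and> X \<longlonglongrightarrow> x"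
  obtain B where B: "B > 0" "\<forall>x y. 0 < x \<longrightarrow> x < 1 \<longrightarrow> 0 < y \<longrightarrow> y < 1 \<longrightarrow> \<bar>heat_kernel \<nu> t x y\<bar> \<le> B"
    using heat_kernel_bounded[OF t] by blast
  note [measurable] = borel_measurable_integrable[OF f]
  have [measurable]: "heat_kernel \<nu> t x \<in> borel_measurable (eta \<nu>)" "heat_kernel \<nu> t (X i) \<in> borel_measurable (eta \<nu>)" for i
    using x X t by (auto intro!: heat_kernel_measurable)
  show "(\<lambda>n. heat_op \<nu> t f (X n)) \<longlonglongrightarrow> heat_op \<nu> t f x"
    unfolding heat_op_def
  proof (rule integral_dominated_convergence)
    show "integrable (eta \<nu>) (\<lambda>y. B * cmod (f y))" using f by simp
    show "AE y in eta \<nu>. (\<lambda>i. complex_of_real (heat_kernel \<nu> t (X i) y) * f y) \<longlonglongrightarrow> complex_of_real (heat_kernel \<nu> t x y) * f y"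
    proof (rule AE_I2)
      fix y assume "y \<in> space (eta \<nu>)"
      then have y: "0 < y" "y < 1" by auto
      have "(\<lambda>i. dkern t (X i) y / (psi 1 (X i) * psi 1 y)) \<longlonglongrightarrow> dkern t x y / (psi 1 x * psi 1 y)"
      proof (intro tendsto_intros dkern_tendsto t y)
        show "(\<lambda>i. psi 1 (X i)) \<longlonglongrightarrow> psi 1 x"
          using DERIV_isCont[OF DERIV_psi] X by (blast intro: isCont_tendsto_compose)
        show "psi 1 x * psi 1 y \<noteq> 0" using psi_1_pos[of x] psi_1_pos[of y] x y by simp
      qed (use X in auto)
      moreover have "heat_kernel \<nu> t (X i) y = dkern t (X i) y / (psi 1 (X i) * psi 1 y)" for i
        using t X y by (intro heat_kernel_eq) auto
      moreover have "heat_kernel \<nu> t x y = dkern t x y / (psi 1 x * psi 1 y)"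
        using t x y by (intro heat_kernel_eq) auto
      ultimately have "(\<lambda>i. heat_kernel \<nu> t (X i) y) \<longlonglongrightarrow> heat_kernel \<nu> t x y" by simp
      then show "(\<lambda>i. complex_of_real (heat_kernel \<nu> t (X i) y) * f y) \<longlonglongrightarrow> complex_of_real (heat_kernel \<nu> t x y) * f y"
        by (intro tendsto_intros)
    qed
    show "AE y in eta \<nu>. norm (complex_of_real (heat_kernel \<nu> t (X i) y) * f y) \<le> B * cmod (f y)" for i
    proof (rule AE_I2)
      fix y assume "y \<in> space (eta \<nu>)"
      then have "\<bar>heat_kernel \<nu> t (X i) y\<bar> \<le> B" using B(2) X by auto
      then show "norm (complex_of_real (heat_kernel \<nu> t (X i) y) * f y) \<le> B * cmod (f y)"
        by (simp add: norm_mult mult_right_mono)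
    qed
  qed measurable
qed

lemma heat_op_M_eq: "heat_op_M \<nu> t f x = complex_of_real (exp ((lam 1)\<^sup>2 * t)) * heat_op \<nu> t f x"
  unfolding heat_op_M_def heat_op_def heat_kernel_M_def by (simp add: mult.assoc)

lemma max_heat_op_le: "max_heat_op \<nu> f x \<le> max_heat_op_M \<nu> f x"
  unfolding max_heat_op_def max_heat_op_M_def
proof (rule SUP_mono)
  fix t :: real assume t: "t \<in> {0<..}"
  have "1 * cmod (heat_op \<nu> t f x) \<le> exp ((lam 1)\<^sup>2 * t) * cmod (heat_op \<nu> t f x)"
    using t by (intro mult_right_mono) auto
  then have "ennreal (cmod (heat_op \<nu> t f x)) \<le> ennreal (cmod (heat_op_M \<nu> t f x))"
    by (intro ennreal_leI) (simp add: heat_op_M_eq norm_mult)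
  then show "\<exists>s\<in>{0<..}. ennreal (cmod (heat_op \<nu> t f x)) \<le> ennreal (cmod (heat_op_M \<nu> s f x))"
    using t by blast
qed

lemma max_heat_ops_measurable:
  assumes "integrable (eta \<nu>) f"
  shows "max_heat_op \<nu> f \<in> borel_measurable (eta \<nu>)" "max_heat_op_M \<nu> f \<in> borel_measurable (eta \<nu>)"
proof -
  have sets: "A \<in> sets (eta \<nu>)" if "open A" "A \<subseteq> {0<..<1}" for A
    using that by (auto simp: sets_eta sets_restrict_space_iff)
  show "max_heat_op \<nu> f \<in> borel_measurable (eta \<nu>)"
    unfolding max_heat_op_def[abs_def]
    by (rule measurable_SUP_continuous[of _ "{0<..<1}"])
       (use assms sets in \<open>auto intro!: continuous_intros continuous_on_heat_op\<close>)
  show "max_heat_op_M \<nu> f \<in> borel_measurable (eta \<nu>)"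
    unfolding max_heat_op_M_def[abs_def] heat_op_M_eq
    by (rule measurable_SUP_continuous[of _ "{0<..<1}"])
       (use assms sets in \<open>auto intro!: continuous_intros continuous_on_heat_op\<close>)
qed

section \<open>Boundedness of the maximal operators\<close>

lemma finite_eta: "emeasure (eta \<nu>) (space (eta \<nu>)) < \<infinity>"
proof -
  obtain C where C': "\<forall>x R. 0 < x \<longrightarrow> x < 1 \<longrightarrow> 0 < R \<longrightarrow>
      emeasure (eta \<nu>) (ball x R \<inter> {0<..<1}) \<le> ennreal (C * vol x R)"
    using emeasure_eta_ball by blast
  have "ball (1 / 2) 1 \<inter> {0<..<1} = {0<..<1::real}" by (auto simp: dist_real_def)
  then have "emeasure (eta \<nu>) (space (eta \<nu>)) \<le> ennreal (C * vol (1 / 2) 1)"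
    using C'[rule_format, of "1 / 2" 1] by simp
  also have "\<dots> < \<infinity>" by simp
  finally show ?thesis .
qed

text \<open>The measure is finite, and \<open>|f| \<le> 1 + |f|^q\<close> for finite
  exponents.\<close>

lemma Lp_space_integrable:
  assumes p: "1 \<le> p" and f: "f \<in> Lp_space p (eta \<nu>)"
  shows "integrable (eta \<nu>) f"
proof -
  have fm[measurable]: "f \<in> borel_measurable (eta \<nu>)" and fin: "Lp_norm p (eta \<nu>) (\<lambda>x. ennreal (cmod (f x))) < \<infinity>"
    using f by (auto simp: Lp_space_def)
  have "(\<integral>\<^sup>+ x. ennreal (cmod (f x)) \<partial>eta \<nu>) < \<infinity>"
  proof (cases "p = \<infinity>")
    case True
    define b where "b = esssup (eta \<nu>) (\<lambda>x. ennreal (cmod (f x)))"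
    have "(\<integral>\<^sup>+ x. ennreal (cmod (f x)) \<partial>eta \<nu>) \<le> (\<integral>\<^sup>+ x. b \<partial>eta \<nu>)"
      unfolding b_def by (intro nn_integral_mono_AE esssup_AE)
    also have "\<dots> = b * emeasure (eta \<nu>) (space (eta \<nu>))" by (rule nn_integral_const)
    also have "\<dots> < \<infinity>" using fin True finite_eta by (simp add: Lp_norm_def b_def ennreal_mult_less_top)
    finally show ?thesis .
  next
    case False
    define q where "q = enn2real p"
    have q: "q \<ge> 1" using p False unfolding q_def
      by (cases p) (auto simp flip: ennreal_1)
    have I: "(\<integral>\<^sup>+ x. ennreal (cmod (f x) powr q) \<partial>eta \<nu>) < \<infinity>"
      using fin False by (auto simp: Lp_norm_def q_def ennreal_powr_def less_top split: if_splits)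
    have "(\<integral>\<^sup>+ x. ennreal (cmod (f x)) \<partial>eta \<nu>) \<le> (\<integral>\<^sup>+ x. 1 + ennreal (cmod (f x) powr q) \<partial>eta \<nu>)"
    proof (rule nn_integral_mono)
      fix x
      have "cmod (f x) \<le> 1 + cmod (f x) powr q"
      proof (cases "cmod (f x) \<le> 1")
        case False
        then have "cmod (f x) powr 1 \<le> cmod (f x) powr q" using q by (intro powr_mono) auto
        then show ?thesis using False by simp
      qed (simp add: add_increasing2)
      then have "ennreal (cmod (f x)) \<le> ennreal (1 + cmod (f x) powr q)" by (rule ennreal_leI)
      then show "ennreal (cmod (f x)) \<le> 1 + ennreal (cmod (f x) powr q)" by simp
    qed
    also have "\<dots> = emeasure (eta \<nu>) (space (eta \<nu>)) + (\<integral>\<^sup>+ x. ennreal (cmod (f x) powr q) \<partial>eta \<nu>)"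
      by (subst nn_integral_add) (auto simp del: space_eta)
    also have "\<dots> < \<infinity>" using I finite_eta by simp
    finally show ?thesis .
  qed
  then show ?thesis by (intro integrableI_bounded) auto
qed

text \<open>Serves both maximal operators, which enter only through domination by \<open>HL\<close>
  and measurability. For finite \<open>p\<close>, \<open>|f|\<close> is cut at height
  \<open>c * s\<close>: the lower part contributes at most \<open>s / 2\<close> by
  \<open>HL_bounded\<close>, and the weak type bound is applied to the upper part.\<close>

lemma bounded_if_le_HL:
  assumes C: "C > 0" and T: "\<And>f x. f \<in> borel_measurable (eta \<nu>) \<Longrightarrow> 0 < x \<Longrightarrow> x < 1 \<Longrightarrow>
       T f x \<le> ennreal C * HL (\<lambda>y. ennreal (cmod (f y))) x"
    and meas: "\<And>f. integrable (eta \<nu>) f \<Longrightarrow> T f \<in> borel_measurable (eta \<nu>)"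
  shows "\<forall>p. 1 < p \<longrightarrow> bounded_on_Lp p (eta \<nu>) T" and "bounded_L1_weak_L1 (eta \<nu>) T"
proof -
  obtain D where D: "D > 0" and D': "\<forall>h\<in>borel_measurable (eta \<nu>). \<forall>s>0. \<exists>A\<in>sets (eta \<nu>).
     {x \<in> {0<..<1}. ennreal s < HL h x} \<subseteq> A \<and> emeasure (eta \<nu>) A \<le> ennreal (D / s) * (\<integral>\<^sup>+ y. h y \<partial>eta \<nu>)"
    using HL_weak_type by blast
  obtain E where E: "E > 0" and E': "\<forall>h b x. (AE y in eta \<nu>. h y \<le> b) \<longrightarrow> 0 < x \<longrightarrow> x < 1 \<longrightarrow> HL h x \<le> ennreal E * b"
    using HL_bounded by blast
  \<comment> \<open>For arbitrary \<open>S\<close>, since monotonicity of \<open>emeasure\<close>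
    asks measurability only of the larger set.\<close>
  have weak: "emeasure (eta \<nu>) S \<le> ennreal (D / s) * (\<integral>\<^sup>+ y. h y \<partial>eta \<nu>)"
    if h: "h \<in> borel_measurable (eta \<nu>)" "s > 0" and S: "S \<subseteq> {x \<in> {0<..<1}. ennreal s < HL h x}" for h s S
  proof -
    obtain A where A: "A \<in> sets (eta \<nu>)" "{x \<in> {0<..<1}. ennreal s < HL h x} \<subseteq> A"
      "emeasure (eta \<nu>) A \<le> ennreal (D / s) * (\<integral>\<^sup>+ y. h y \<partial>eta \<nu>)"
      using D' h by blast
    have "emeasure (eta \<nu>) S \<le> emeasure (eta \<nu>) A" using A S by (intro emeasure_mono) auto
    then show ?thesis using A(3) by (rule order_trans)
  qed
  have level: "ennreal (s / c) < b" if "ennreal s < ennreal c * b" "c > 0" "s > 0" for s c :: real and b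
  proof (rule ccontr)
    assume "\<not> ennreal (s / c) < b"
    then have "ennreal c * b \<le> ennreal c * ennreal (s / c)" by (intro mult_left_mono) auto
    also have "\<dots> = ennreal s" using that by (simp flip: ennreal_mult)
    finally show False using that(1) by simp
  qed
  show "bounded_L1_weak_L1 (eta \<nu>) T"
    unfolding bounded_L1_weak_L1_def
  proof (intro exI[of _ "D * C"] ballI conjI)
    fix f assume f: "f \<in> Lp_space 1 (eta \<nu>)"
    then have fm[measurable]: "f \<in> borel_measurable (eta \<nu>)" by (simp add: Lp_space_def)
    show "T f \<in> borel_measurable (eta \<nu>)" using Lp_space_integrable[OF _ f] by (intro meas) simp
    define I where "I = (\<integral>\<^sup>+ y. ennreal (cmod (f y)) \<partial>eta \<nu>)"
    have I: "Lp_norm 1 (eta \<nu>) (\<lambda>x. ennreal (cmod (f x))) = I"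
      by (simp add: Lp_norm_def I_def ennreal_powr_1)
    show "weak_L1_norm (eta \<nu>) (T f) \<le> ennreal (D * C) * Lp_norm 1 (eta \<nu>) (\<lambda>x. ennreal (cmod (f x)))"
      unfolding weak_L1_norm_def I
    proof (rule SUP_least)
      fix s :: real assume "s \<in> {0<..}"
      then have s: "s > 0" by simp
      have "emeasure (eta \<nu>) {x \<in> space (eta \<nu>). ennreal s < T f x} \<le> ennreal (D / (s / C)) * I"
        unfolding I_def
      proof (rule weak)
        show "{x \<in> space (eta \<nu>). ennreal s < T f x} \<subseteq> {x \<in> {0<..<1}. ennreal (s / C) < HL (\<lambda>y. ennreal (cmod (f y))) x}"
        proof
          fix x assume "x \<in> {x \<in> space (eta \<nu>). ennreal s < T f x}"
          then have x: "0 < x" "x < 1" "ennreal s < T f x" by auto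
          have "ennreal s < ennreal C * HL (\<lambda>y. ennreal (cmod (f y))) x"
            using x(3) T[OF fm x(1,2)] by (rule less_le_trans)
          from level[OF this C s] x show "x \<in> {x \<in> {0<..<1}. ennreal (s / C) < HL (\<lambda>y. ennreal (cmod (f y))) x}" by simp
        qed
      qed (use s C in auto)
      then have "ennreal s * emeasure (eta \<nu>) {x \<in> space (eta \<nu>). ennreal s < T f x} \<le> ennreal s * (ennreal (D / (s / C)) * I)"
        by (intro mult_left_mono) auto
      also have "\<dots> = ennreal (D * C) * I"
        using s C D by (simp add: mult.assoc[symmetric] flip: ennreal_mult)
      finally show "ennreal s * emeasure (eta \<nu>) {x \<in> space (eta \<nu>). ennreal s < T f x} \<le> ennreal (D * C) * I" .
    qed
  qed
  show "\<forall>p. 1 < p \<longrightarrow> bounded_on_Lp p (eta \<nu>) T"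
  proof (intro allI impI)
    fix p :: ennreal assume p1: "1 < p"
    show "bounded_on_Lp p (eta \<nu>) T"
    proof (cases "p = \<infinity>")
      case True
      show ?thesis unfolding bounded_on_Lp_def
      proof (intro exI[of _ "C * E"] ballI conjI)
        fix f assume f: "f \<in> Lp_space p (eta \<nu>)"
        then have fm[measurable]: "f \<in> borel_measurable (eta \<nu>)" by (simp add: Lp_space_def)
        show Tm: "T f \<in> borel_measurable (eta \<nu>)" using Lp_space_integrable[OF _ f] p1 by (intro meas) simp
        define b where "b = esssup (eta \<nu>) (\<lambda>x. ennreal (cmod (f x)))"
        have AE: "AE y in eta \<nu>. ennreal (cmod (f y)) \<le> b" unfolding b_def by (rule esssup_AE)
        have "T f x \<le> ennreal (C * E) * b" if x: "0 < x" "x < 1" for x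
        proof -
          have "T f x \<le> ennreal C * (ennreal E * b)"
            using E' AE x by (intro order_trans[OF T[OF fm x]] mult_left_mono) auto
          then show ?thesis using C E by (simp add: ennreal_mult mult.assoc)
        qed
        then have "esssup (eta \<nu>) (T f) \<le> ennreal (C * E) * b"
          using Tm by (intro esssup_I AE_I2) auto
        then show "Lp_norm p (eta \<nu>) (T f) \<le> ennreal (C * E) * Lp_norm p (eta \<nu>) (\<lambda>x. ennreal (cmod (f x)))"
          using True by (simp add: Lp_norm_def b_def)
      qed
    next
      case False
      define q where "q = enn2real p"
      have q: "q > 1" using p1 False unfolding q_def
        by (cases p) (auto simp: ennreal_less_iff simp flip: ennreal_1)
      \<comment> \<open>Then \<open>C * E * c * s = s / 2\<close>: the part of \<open>h\<close>
        below \<open>c * s\<close> uses up half of the level \<open>s\<close>.\<close>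
      define c where "c = 1 / (2 * C * E)"
      have c: "c > 0" using C E by (simp add: c_def)
      \<comment> \<open>The constant of \<open>weak_type_to_strong_type\<close> with
        \<open>A = 2 * C * D\<close>.\<close>
      define K where "K = 2 * C * D * q * (1 / c) powr (q - 1) / (q - 1)"
      have K: "K \<ge> 0" using C D q by (simp add: K_def)
      show ?thesis unfolding bounded_on_Lp_def
      proof (intro exI[of _ "K powr (1 / q)"] ballI conjI)
        fix f assume f: "f \<in> Lp_space p (eta \<nu>)"
        then have fm[measurable]: "f \<in> borel_measurable (eta \<nu>)"
          and fin: "Lp_norm p (eta \<nu>) (\<lambda>x. ennreal (cmod (f x))) < \<infinity>" by (auto simp: Lp_space_def)
        show Tm: "T f \<in> borel_measurable (eta \<nu>)" using Lp_space_integrable[OF _ f] p1 by (intro meas) simp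
        define h where "h = (\<lambda>x. cmod (f x))"
        have h[measurable]: "h \<in> borel_measurable (eta \<nu>)" unfolding h_def by measurable
        define I where "I = (\<integral>\<^sup>+ x. ennreal (h x powr q) \<partial>eta \<nu>)"
        have I: "Lp_norm p (eta \<nu>) (\<lambda>x. ennreal (cmod (f x))) = ennreal_powr I (1 / q)"
          using False by (simp add: Lp_norm_def I_def h_def q_def ennreal_powr_def)
        have "(\<integral>\<^sup>+ x. ennreal_powr (T f x) q \<partial>eta \<nu>) \<le> ennreal K * I"
          unfolding K_def I_def
        proof (rule weak_type_to_strong_type)
          have "finite_measure (eta \<nu>)" using finite_eta by (intro finite_measureI) auto
          then show "sigma_finite_measure (eta \<nu>)" by (simp add: finite_measure_def)
          fix s :: real assume s: "s > 0"
          define h1 where "h1 = (\<lambda>x. ennreal (h x) * indicator {x. c * s < h x} x)"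
          define h2 where "h2 = (\<lambda>x. ennreal (h x) * indicator {x. h x \<le> c * s} x)"
          have [measurable]: "h1 \<in> borel_measurable (eta \<nu>)" "h2 \<in> borel_measurable (eta \<nu>)"
            unfolding h1_def h2_def by measurable
          have hsum: "(\<lambda>x. ennreal (h x)) = (\<lambda>x. h1 x + h2 x)"
            by (auto simp: h1_def h2_def fun_eq_iff split: split_indicator)
          have "emeasure (eta \<nu>) {x \<in> space (eta \<nu>). ennreal s < T f x} \<le> ennreal (D / (s / 2 / C)) * (\<integral>\<^sup>+ y. h1 y \<partial>eta \<nu>)"
          proof (rule weak)
            show "{x \<in> space (eta \<nu>). ennreal s < T f x} \<subseteq> {x \<in> {0<..<1}. ennreal (s / 2 / C) < HL h1 x}"
            proof
              fix x assume "x \<in> {x \<in> space (eta \<nu>). ennreal s < T f x}"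
              then have x: "0 < x" "x < 1" "ennreal s < T f x" by auto
              have "AE y in eta \<nu>. h2 y \<le> ennreal (c * s)"
                by (rule AE_I2) (auto simp: h2_def intro: ennreal_leI split: split_indicator)
              then have "HL h2 x \<le> ennreal E * ennreal (c * s)" using E' x by blast
              then have "ennreal C * HL h2 x \<le> ennreal C * (ennreal E * ennreal (c * s))" by (rule mult_left_mono) simp
              also have "\<dots> = ennreal (s / 2)" using C E c s by (simp add: c_def flip: ennreal_mult)
              finally have b2: "ennreal C * HL h2 x \<le> ennreal (s / 2)" .
              have "ennreal (s / 2) + ennreal (s / 2) = ennreal s" using s by (simp flip: ennreal_plus)
              also have "\<dots> < T f x" by fact
              also have "\<dots> \<le> ennreal C * HL (\<lambda>y. ennreal (h y)) x" unfolding h_def by (rule T[OF fm x(1,2)])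
              also have "\<dots> \<le> ennreal C * (HL h1 x + HL h2 x)"
                unfolding hsum using x by (intro mult_left_mono HL_add) auto
              also have "\<dots> \<le> ennreal C * HL h1 x + ennreal (s / 2)"
                using b2 by (simp add: distrib_left add_left_mono)
              finally have "ennreal (s / 2) < ennreal C * HL h1 x"
                by (meson add_right_mono leD leI)
              from level[OF this C] s x show "x \<in> {x \<in> {0<..<1}. ennreal (s / 2 / C) < HL h1 x}" by simp
            qed
          qed (use s C in auto)
          also have "D / (s / 2 / C) = 2 * C * D / s" using s C by simp
          finally show "emeasure (eta \<nu>) {x \<in> space (eta \<nu>). ennreal s < T f x}
             \<le> ennreal (2 * C * D / s) * (\<integral>\<^sup>+ x. ennreal (h x) * indicator {x. c * s < h x} x \<partial>eta \<nu>)"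
            by (simp add: h1_def)
        qed (use Tm q C D c in \<open>auto simp: h_def\<close>)
        then have "Lp_norm p (eta \<nu>) (T f) \<le> ennreal_powr (ennreal K * I) (1 / q)"
          using False q by (simp add: Lp_norm_def q_def[symmetric] ennreal_powr_mono)
        also have "\<dots> \<le> ennreal (K powr (1 / q)) * ennreal_powr I (1 / q)"
        proof -
          have "I \<noteq> \<infinity>" using fin I by (auto simp: ennreal_powr_def)
          then obtain i where i: "i \<ge> 0" "I = ennreal i" by (cases I) auto
          show ?thesis using K i
            by (simp add: ennreal_powr_def powr_mult flip: ennreal_mult)
        qed
        finally show "Lp_norm p (eta \<nu>) (T f) \<le> ennreal (K powr (1 / q)) * Lp_norm p (eta \<nu>) (\<lambda>x. ennreal (cmod (f x)))"
          using I by simp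
      qed
    qed
  qed
qed

theorem maximal_heat_operators_bounded:
  "(\<forall>p::ennreal. 1 < p \<longrightarrow>
      bounded_on_Lp p (eta \<nu>) (max_heat_op \<nu>) \<and> bounded_on_Lp p (eta \<nu>) (max_heat_op_M \<nu>)) \<and>
   bounded_L1_weak_L1 (eta \<nu>) (max_heat_op \<nu>) \<and> bounded_L1_weak_L1 (eta \<nu>) (max_heat_op_M \<nu>)"
proof -
  obtain C where C: "C > 0" and C': "\<forall>f\<in>borel_measurable (eta \<nu>). \<forall>t>0. \<forall>x. 0 < x \<longrightarrow> x < 1 \<longrightarrow>
     ennreal (cmod (heat_op_M \<nu> t f x)) \<le> ennreal C * HL (\<lambda>y. ennreal (cmod (f y))) x"
    using heat_op_M_le_HL by blast
  have M: "max_heat_op_M \<nu> f x \<le> ennreal C * HL (\<lambda>y. ennreal (cmod (f y))) x"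
    if "f \<in> borel_measurable (eta \<nu>)" "0 < x" "x < 1" for f x
    unfolding max_heat_op_M_def using C' that by (intro SUP_least) auto
  then have "max_heat_op \<nu> f x \<le> ennreal C * HL (\<lambda>y. ennreal (cmod (f y))) x"
    if "f \<in> borel_measurable (eta \<nu>)" "0 < x" "x < 1" for f x
    using max_heat_op_le[of f x] that by (meson order_trans)
  then show ?thesis
    using bounded_if_le_HL[where T = "max_heat_op_M \<nu>", OF C M max_heat_ops_measurable(2)]
      bounded_if_le_HL[where T = "max_heat_op \<nu>", OF C _ max_heat_ops_measurable(1)] by blast
qed

end

theorem theorem7p9:
  fixes \<nu> :: real
  assumes "\<nu> > -1"
  shows "(\<forall>p::ennreal. 1 < p \<longrightarrow>
            bounded_on_Lp p (eta \<nu>) (max_heat_op \<nu>) \<and>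
            bounded_on_Lp p (eta \<nu>) (max_heat_op_M \<nu>)) \<and>
         bounded_L1_weak_L1 (eta \<nu>) (max_heat_op \<nu>) \<and>
         bounded_L1_weak_L1 (eta \<nu>) (max_heat_op_M \<nu>)"
proof -
  interpret bessel \<nu> "2 * \<nu> + 1" using assms by unfold_locales simp_all
  show ?thesis by (rule maximal_heat_operators_bounded)
qed

end
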